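(* Let $1<p<\infty$. There exists a sequence $\{e_n\}_{n\in\mathbb{N}}$ of functions on $[0,1]$ that is uniformly bounded (i.e. $\sup_n\|e_n\|_{L_\infty([0,1])}<\infty$), is an orthonormal basis for $L_2([0,1])$, and is an almost greedy basis for $L_p([0,1])$.
   Context: $L_p([0,1])$ is the Lebesgue space of complex-valued functions with respect to Lebesgue measure. A bounded Schauder basis of a Banach space $X$ is a Schauder basis $\{e_n\}_{n\in\mathbb{N}}$ with $0<\inf_n\|e_n\|_X\le\sup_n\|e_n\|_X<\infty$; its dual (biorthogonal) system is denoted $\{e_n^*\}_{n\in\mathbb{N}}$. Greedy approximants: for $x\in X$, the greedy ordering is the map $\rho:\mathbb{N}\to\mathbb{N}$ with $\rho(\mathbb{N})\supseteq\{j:e_j^*(x)\ne 0\}$ such that for $j<k$ either $|e^*_{\rho(k)}(x)|<|e^*_{\rho(j)}(x)|$, or $|e^*_{\rho(k)}(x)|=|e^*_{\rho(j)}(x)|$ and $\rho(k)>\rho(j)$. The greedy $m$-term approximant of $x$ is $\mathcal{G}_m(x)=\sum_{j=1}^m e^*_{\rho(j)}(x)e_{\rho(j)}$. A bounded Schauder basis $\{e_n\}_n$ of $X$ is almost greedy if there is a constant $C$ such that for all $x\in X$ and all $n\in\mathbb{N}$, $$\|x-\mathcal{G}_n(x)\|_X\le C\inf\Big\{\Big\|x-\sum_{j\in A}e_j^*(x)e_j\Big\|_X : A\subset\mathbb{N},\ |A|=n\Big\}.$$ *)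

theory Defs
  imports "HOL-Analysis.Analysis" "HOL-Probability.Essential_Supremum"
begin

section \<open>Lebesgue spaces on the unit interval\<close>

text \<open>
  Elements of \<open>L\<^sub>p([0,1])\<close> are represented by functions on the reals, of which only the
  restriction to \<open>[0,1]\<close> matters. Functions that agree almost everywhere are not identified;
  \<open>Lp_norm p\<close> is accordingly a seminorm, and equality in \<open>L\<^sub>p\<close> is \<open>Lp_norm p\<close>-distance zero.
\<close>

abbreviation unit_lebesgue :: "real measure" where
  "unit_lebesgue \<equiv> lebesgue_on {0..1}"

definition Lp_space :: "real \<Rightarrow> (real \<Rightarrow> complex) set" where
  "Lp_space p = {f \<in> borel_measurable unit_lebesgue.
                   integrable unit_lebesgue (\<lambda>x. norm (f x) powr p)}"

definition Lp_norm :: "real \<Rightarrow> (real \<Rightarrow> complex) \<Rightarrow> real" where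
  "Lp_norm p f = (LINT x|unit_lebesgue. norm (f x) powr p) powr (1 / p)"

definition Linf_norm :: "(real \<Rightarrow> complex) \<Rightarrow> ereal" where
  "Linf_norm f = esssup unit_lebesgue (\<lambda>x. ereal (norm (f x)))"

definition uniformly_bounded :: "(nat \<Rightarrow> real \<Rightarrow> complex) \<Rightarrow> bool" where
  "uniformly_bounded e \<longleftrightarrow> (SUP n. Linf_norm (e n)) < \<infinity>"

definition L2_inner :: "(real \<Rightarrow> complex) \<Rightarrow> (real \<Rightarrow> complex) \<Rightarrow> complex" where
  "L2_inner f g = (LINT x|unit_lebesgue. f x * cnj (g x))"

text \<open>An orthonormal basis is an orthonormal system whose linear span is dense.\<close>

definition orthonormal_basis_L2 :: "(nat \<Rightarrow> real \<Rightarrow> complex) \<Rightarrow> bool" where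
  "orthonormal_basis_L2 e \<longleftrightarrow>
     (\<forall>n. e n \<in> Lp_space 2) \<and>
     (\<forall>m n. L2_inner (e m) (e n) = (if m = n then 1 else 0)) \<and>
     (\<forall>f\<in>Lp_space 2. \<forall>\<epsilon>>0. \<exists>N c. Lp_norm 2 (\<lambda>x. f x - (\<Sum>k<N. c k * e k x)) < \<epsilon>)"


section \<open>Schauder bases\<close>

definition Lp_expansion ::
    "real \<Rightarrow> (nat \<Rightarrow> real \<Rightarrow> complex) \<Rightarrow> (real \<Rightarrow> complex) \<Rightarrow> (nat \<Rightarrow> complex) \<Rightarrow> bool" where
  "Lp_expansion p e f c \<longleftrightarrow> (\<lambda>n. Lp_norm p (\<lambda>x. f x - (\<Sum>k<n. c k * e k x))) \<longlonglongrightarrow> 0"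

definition schauder_basis_Lp :: "real \<Rightarrow> (nat \<Rightarrow> real \<Rightarrow> complex) \<Rightarrow> bool" where
  "schauder_basis_Lp p e \<longleftrightarrow>
     (\<forall>n. e n \<in> Lp_space p) \<and> (\<forall>f\<in>Lp_space p. \<exists>!c. Lp_expansion p e f c)"

definition bounded_schauder_basis_Lp :: "real \<Rightarrow> (nat \<Rightarrow> real \<Rightarrow> complex) \<Rightarrow> bool" where
  "bounded_schauder_basis_Lp p e \<longleftrightarrow>
     schauder_basis_Lp p e \<and>
     0 < (INF n. Lp_norm p (e n)) \<and> bdd_above (range (\<lambda>n. Lp_norm p (e n)))"

text \<open>\<open>dual_coeff p e f n\<close> is the value at \<open>f\<close> of the \<open>n\<close>-th biorthogonal functional of \<open>e\<close>.\<close>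

definition dual_coeff ::
    "real \<Rightarrow> (nat \<Rightarrow> real \<Rightarrow> complex) \<Rightarrow> (real \<Rightarrow> complex) \<Rightarrow> nat \<Rightarrow> complex" where
  "dual_coeff p e f = (THE c. Lp_expansion p e f c)"


section \<open>Greedy approximation\<close>

definition is_greedy_ordering :: "(nat \<Rightarrow> complex) \<Rightarrow> (nat \<Rightarrow> nat) \<Rightarrow> bool" where
  "is_greedy_ordering c \<rho> \<longleftrightarrow>
     {j. c j \<noteq> 0} \<subseteq> range \<rho> \<and>
     (\<forall>j k. j < k \<longrightarrow>
        norm (c (\<rho> k)) < norm (c (\<rho> j)) \<or>
        norm (c (\<rho> k)) = norm (c (\<rho> j)) \<and> \<rho> k > \<rho> j)"

text \<open>
  A greedy ordering exists whenever \<open>c\<close> tends to \<open>0\<close>, as the coefficients with respect to a bounded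
  Schauder basis do. It is unique up to the choice of indices with zero coefficient, which do not
  contribute to the greedy approximants.
\<close>

lemma greedy_ordering_exists:
  assumes "c \<longlonglongrightarrow> 0"
  shows "\<exists>\<rho>. is_greedy_ordering c \<rho>"
proof -
  define S where "S = (if finite {j. c j \<noteq> 0} then UNIV else {j. c j \<noteq> 0})"
  define before where
    "before j k \<longleftrightarrow> norm (c k) < norm (c j) \<or> norm (c k) = norm (c j) \<and> j < k" for j k :: nat
  define P where "P k = {j\<in>S. before j k}" for k
  define r where "r k = card (P k)" for k
  have infS: "infinite S"
    by (auto simp: S_def)
  have finP: "finite (P k)" if "k \<in> S" for k
  proof (cases "c k = 0")
    case True
    then have "finite {j. c j \<noteq> 0}"
      using that by (auto simp: S_def split: if_splits)
    then have "finite ({j. c j \<noteq> 0} \<union> {..<k})"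
      by simp
    moreover have "P k \<subseteq> {j. c j \<noteq> 0} \<union> {..<k}"
      using True by (auto simp: P_def before_def)
    ultimately show ?thesis
      by (rule rev_finite_subset)
  next
    case False
    then obtain N where N: "\<And>n. n \<ge> N \<Longrightarrow> norm (c n) < norm (c k)"
      using LIMSEQ_D[OF assms, of "norm (c k)"] by auto
    have "P k \<subseteq> {..<N}"
    proof
      fix j assume "j \<in> P k"
      then have "norm (c k) \<le> norm (c j)"
        by (auto simp: P_def before_def)
      with N[of j] show "j \<in> {..<N}"
        by (cases "N \<le> j") auto
    qed
    then show ?thesis
      by (rule finite_subset) simp
  qed
  have mono: "r j < r k" if "before j k" "j \<in> S" "k \<in> S" for j k
  proof -
    have "P j \<subset> P k"
      using that by (auto simp: P_def before_def)
    then show ?thesis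
      unfolding r_def using finP that by (intro psubset_card_mono) auto
  qed
  have total: "before j k \<or> before k j \<or> j = k" for j k
    by (auto simp: before_def)
  have inj: "inj_on r S"
    by (rule inj_onI) (metis mono total less_irrefl)
  have surj: "\<exists>k\<in>S. r k = m" for m
  proof -
    have "infinite (r ` S)"
      using infS inj finite_imageD by blast
    then have "\<exists>n\<ge>m. n \<in> r ` S"
      by (meson infinite_nat_iff_unbounded_le)
    then obtain n where n: "n \<ge> m \<and> n \<in> r ` S"
      and least: "\<And>i. i \<ge> m \<and> i \<in> r ` S \<Longrightarrow> n \<le> i"
      using exists_least_iff[of "\<lambda>n. n \<ge> m \<and> n \<in> r ` S"] by (meson not_le)
    then obtain k where k: "k \<in> S" "n = r k"
      by auto
    have "r ` P k \<subseteq> {..<m}"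
    proof
      fix i assume "i \<in> r ` P k"
      then obtain j where "j \<in> S" "before j k" "i = r j"
        by (auto simp: P_def)
      with least[of i] mono[of j k] k show "i \<in> {..<m}"
        by force
    qed
    then have "card (r ` P k) \<le> m"
      using card_mono[of "{..<m}"] by fastforce
    moreover have "card (r ` P k) = r k"
      unfolding r_def[of k] by (intro card_image inj_on_subset[OF inj]) (auto simp: P_def)
    ultimately show ?thesis
      using n k by (intro bexI[of _ k]) auto
  qed
  then obtain \<rho> where \<rho>: "\<And>m. \<rho> m \<in> S" "\<And>m. r (\<rho> m) = m"
    by metis
  have "k = \<rho> (r k)" if "k \<in> S" for k
    using inj \<rho> that by (metis inj_onD)
  then have "S \<subseteq> range \<rho>"
    by blast
  moreover have "{j. c j \<noteq> 0} \<subseteq> S"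
    by (auto simp: S_def)
  moreover have "before (\<rho> j) (\<rho> k)" if "j < k" for j k
    using total[of "\<rho> j" "\<rho> k"] mono[of "\<rho> k" "\<rho> j"] \<rho> that
    by (metis not_less_iff_gr_or_eq)
  ultimately show ?thesis
    unfolding is_greedy_ordering_def before_def by blast
qed

lemma greedy_ordering_unique:
  assumes "is_greedy_ordering c \<rho>" "is_greedy_ordering c \<sigma>" "c (\<rho> j) \<noteq> 0"
  shows "\<sigma> j = \<rho> j"
  using assms(3)
proof (induction j rule: less_induct)
  case (less j)
  define before where
    "before j k \<longleftrightarrow> norm (c k) < norm (c j) \<or> norm (c k) = norm (c j) \<and> j < k" for j k :: nat
  have \<rho>: "before (\<rho> i) (\<rho> k)" and \<sigma>: "before (\<sigma> i) (\<sigma> k)" if "i < k" for i k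
    using assms that by (auto simp: is_greedy_ordering_def before_def)
  have asym: "\<not> before k i" if "before i k" for i k
    using that by (auto simp: before_def)
  have eq: "\<sigma> i = \<rho> i" if "i < j" for i
  proof -
    have "norm (c (\<rho> j)) \<le> norm (c (\<rho> i))"
      using \<rho>[OF that] by (auto simp: before_def)
    then have "c (\<rho> i) \<noteq> 0"
      using less.prems by auto
    then show ?thesis
      using less.IH that by blast
  qed
  obtain k where k: "\<rho> j = \<sigma> k"
    using assms(2) less.prems by (auto simp: is_greedy_ordering_def)
  consider "k < j" | "k = j" | "j < k"
    by linarith
  then show ?case
  proof cases
    case 1
    then show ?thesis
      using eq[of k] k \<rho>[of k j] asym by metis
  next
    case 2
    then show ?thesis
      using k by simp
  next
    case 3
    have b: "before (\<sigma> j) (\<rho> j)"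
      using \<sigma>[OF 3] k by simp
    then have "c (\<sigma> j) \<noteq> 0"
      using less.prems by (auto simp: before_def)
    then obtain l where l: "\<sigma> j = \<rho> l"
      using assms(1) by (auto simp: is_greedy_ordering_def)
    have "l < j"
      using b l \<rho>[of j l] asym by (metis linorder_neqE_nat)
    then show ?thesis
      using eq[of l] l \<sigma>[of l j] asym by metis
  qed
qed

definition greedy_ordering :: "(nat \<Rightarrow> complex) \<Rightarrow> nat \<Rightarrow> nat" where
  "greedy_ordering c = (SOME \<rho>. is_greedy_ordering c \<rho>)"

definition greedy_approx ::
    "real \<Rightarrow> (nat \<Rightarrow> real \<Rightarrow> complex) \<Rightarrow> nat \<Rightarrow> (real \<Rightarrow> complex) \<Rightarrow> real \<Rightarrow> complex" where
  "greedy_approx p e m f =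
     (let c = dual_coeff p e f; \<rho> = greedy_ordering c
      in (\<lambda>x. \<Sum>j<m. c (\<rho> j) * e (\<rho> j) x))"

definition almost_greedy_basis_Lp :: "real \<Rightarrow> (nat \<Rightarrow> real \<Rightarrow> complex) \<Rightarrow> bool" where
  "almost_greedy_basis_Lp p e \<longleftrightarrow>
     bounded_schauder_basis_Lp p e \<and>
     (\<exists>C. \<forall>f\<in>Lp_space p. \<forall>n.
        Lp_norm p (\<lambda>x. f x - greedy_approx p e n f x)
          \<le> C * Inf {Lp_norm p (\<lambda>x. f x - (\<Sum>j\<in>A. dual_coeff p e f j * e j x)) | A.
                      finite A \<and> card A = n})"

end

theory Submission
  imports Defs "HOL-Library.Nat_Bijection" "HOL-Library.Discrete_Functions" "HOL-Library.Infinite_Set"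
begin

text \<open>
  The basis consists of Walsh functions that are mixed blockwise with Rademacher functions.
  Most Rademacher functions are set aside, and \<open>\<phi>\<^sub>0, \<phi>\<^sub>1, \<dots>\<close> are the other Walsh functions in
  their natural order. The block \<open>k\<close> of the basis has \<open>2\<^sup>k\<close> elements. They are the images of
  \<open>\<phi>\<^sub>k\<close> and of \<open>2\<^sup>k - 1\<close> fresh Rademacher functions under the orthogonal Haar matrix, whose first
  column is constant and whose rows have bounded \<open>\<ell>\<^sub>1\<close>-norm:
  \<open>\<psi>\<^sub>i = 2\<^bsup>-k/2\<^esup> \<phi>\<^sub>k + \<Sum>\<^sub>j h\<^sub>i\<^sub>j r\<^sub>j\<close>. Orthogonality of the matrix makes the system an orthonormal basis, and the
  bound on its rows makes it uniformly bounded.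

  Two properties of \<open>L\<^sub>p\<close> with \<open>1 < p < \<infinity>\<close> enter. By the inequality of Khintchine the \<open>L\<^sub>p\<close>-norm
  of a Rademacher sum is at most a multiple of the \<open>\<ell>\<^sub>2\<close>-norm of its coefficients
  (\<open>Khintchine\<close>), and by duality the Rademacher coefficients of \<open>f\<close> have \<open>\<ell>\<^sub>2\<close>-norm at
  most a multiple of \<open>\<parallel>f\<parallel>\<^sub>p\<close> (\<open>rademacher_coeffs_square_summable\<close>). By the theorem of Paley the
  partial sums of Walsh series are uniformly bounded on \<open>L\<^sub>p\<close> (\<open>walsh_partial_sum_bounded\<close>). For
  \<open>p \<le> 2\<close> this is shown with a function in the manner of Burkholder, \<open>(\<bar>x\<bar>\<^sup>2 + \<bar>y\<bar>\<^sup>2)\<^bsup>p/2\<^esup> - K \<bar>x\<bar>\<^sup>p\<close>,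
  which is midpoint concave in the directions in which a pair (sum, partial sum) moves.

  Consequently the \<open>n\<close>-th coefficient of \<open>f\<close>, for \<open>n\<close> in block \<open>k\<close>, has the form
  \<open>c\<^sub>n = 2\<^bsup>-k/2\<^esup> a\<^sub>k + d\<^sub>n\<close> with \<open>\<bar>a\<^sub>k\<bar> \<le> \<parallel>f\<parallel>\<^sub>p\<close> and \<open>(\<Sum>\<bar>d\<^sub>n\<bar>\<^sup>2)\<^bsup>1/2\<^esup> \<le> C \<parallel>f\<parallel>\<^sub>p\<close>
  (\<open>mixed_walsh_coeff_split\<close>). Moreover a sum of \<open>N\<close> elements with coefficients of modulus at most
  \<open>t\<close> has norm at most \<open>C t N\<^bsup>1/2\<^esup>\<close>, because the Rademacher part is controlled by the \<open>\<ell>\<^sub>2\<close>-norm of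
  the coefficients, and the weights \<open>2\<^bsup>-k/2\<^esup>\<close> of the \<open>\<phi>\<^sub>k\<close> are comparable to \<open>n\<^bsup>-1/2\<^esup>\<close>
  (\<open>mixed_walsh_square_root_upper_bound\<close>).

  To bound the sum over the coefficients above a threshold \<open>t\<close>
  (\<open>mixed_walsh_bounded_threshold_sums\<close>), split the blocks at the point where \<open>2\<^bsup>-k/2\<^esup> \<parallel>f\<parallel>\<^sub>p\<close> falls
  below \<open>t/2\<close>. In the later blocks every coefficient above the threshold is dominated by
  \<open>2 \<bar>d\<^sub>n\<bar>\<close>. The earlier blocks have about \<open>(\<parallel>f\<parallel>\<^sub>p/t)\<^sup>2\<close> elements altogether, so that omitting the small
  coefficients from the corresponding full partial sum costs at most a multiple of \<open>\<parallel>f\<parallel>\<^sub>p\<close>.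
  Finally, bounded threshold sums together with the square root bound in \<open>L\<^sub>p\<close> and in the dual
  space \<open>L\<^sub>q\<close> imply that the basis is almost greedy (\<open>almost_greedy_criterion\<close>).
\<close>

section \<open>The spaces \<open>L\<^sub>p([0,1])\<close>\<close>

lemma powr_mono_convex_comb:
  fixes a b l p :: real
  assumes "1 \<le> p" "0 \<le> a" "0 \<le> b" "0 \<le> l" "l \<le> 1"
  shows "(l * a + (1 - l) * b) powr p \<le> l * a powr p + (1 - l) * b powr p"
proof -
  have *: "l powr p \<le> l" if "0 \<le> l" "l \<le> 1" for l
    using powr_mono'[of 1 p l] that assms(1) by (cases "l = 0") auto
  consider "a = 0" | "b = 0" | "0 < a" "0 < b" using assms by linarith
  then show ?thesis
  proof cases
    case 1
    then show ?thesis using *[of "1 - l"] assms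
      by (simp add: powr_mult mult_right_mono)
  next
    case 2
    then show ?thesis using *[of "l"] assms
      by (simp add: powr_mult mult_right_mono)
  next
    case 3
    then show ?thesis
      using convex_onD[OF powr_convex[OF assms(1)], of l b a] assms by (simp add: algebra_simps)
  qed
qed

lemma Lp_norm_nonneg [simp]: "0 \<le> Lp_norm p f"
  by (simp add: Lp_norm_def)

lemma Lp_norm_powr:
  assumes "0 < p"
  shows "Lp_norm p f powr p = (LINT x|unit_lebesgue. norm (f x) powr p)"
  using assms by (simp add: Lp_norm_def powr_powr)

lemma Lp_norm_le_iff:
  assumes "0 < p" "0 \<le> a"
  shows "Lp_norm p f \<le> a \<longleftrightarrow> (LINT x|unit_lebesgue. norm (f x) powr p) \<le> a powr p"
  unfolding Lp_norm_powr[OF assms(1), symmetric]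
  using assms by (meson Lp_norm_nonneg less_imp_le linorder_not_less powr_less_mono2 powr_mono2)

lemma Lp_space_measurable: "f \<in> Lp_space p \<Longrightarrow> f \<in> borel_measurable unit_lebesgue"
  by (simp add: Lp_space_def)

lemma Lp_space_integrable: "f \<in> Lp_space p \<Longrightarrow> integrable unit_lebesgue (\<lambda>x. norm (f x) powr p)"
  by (simp add: Lp_space_def)

lemma measure_unit_lebesgue [simp]: "measure unit_lebesgue {0..1} = 1"
  by (simp add: measure_restrict_space)

lemma emeasure_unit_lebesgue [simp]: "emeasure unit_lebesgue {0..1} = 1"
  by (simp add: emeasure_restrict_space)

lemma finite_measure_unit_lebesgue: "finite_measure unit_lebesgue"
  by (rule finite_measureI) simp

lemma integrable_bounded:
  fixes f :: "real \<Rightarrow> 'a::{banach,second_countable_topology}"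
  assumes "f \<in> borel_measurable unit_lebesgue" "\<And>x. x \<in> {0..1} \<Longrightarrow> norm (f x) \<le> B"
  shows "integrable unit_lebesgue f"
  using assms
  by (intro finite_measure.integrable_const_bound[OF finite_measure_unit_lebesgue, of _ B] AE_I2)
     auto

lemma LINT_unit_const [simp]: "(LINT x|unit_lebesgue. (c :: 'a :: {banach,second_countable_topology})) = c"
  by simp

lemma bounded_in_Lp:
  assumes "f \<in> borel_measurable unit_lebesgue" "\<And>x. x \<in> {0..1} \<Longrightarrow> norm (f x) \<le> B" "0 < p"
  shows "f \<in> Lp_space p"
  unfolding Lp_space_def
  using assms by (auto intro!: integrable_bounded[where B = "B powr p"] powr_mono2)

lemma Lp_norm_le_bound:
  assumes "f \<in> borel_measurable unit_lebesgue" "\<And>x. x \<in> {0..1} \<Longrightarrow> norm (f x) \<le> B" "0 < p" "0 \<le> B"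
  shows "Lp_norm p f \<le> B"
proof -
  have "(LINT x|unit_lebesgue. norm (f x) powr p) \<le> (LINT x|unit_lebesgue. B powr p)"
    using assms bounded_in_Lp[OF assms(1-3)]
    by (intro integral_mono Lp_space_integrable) (auto intro!: powr_mono2 integrable_bounded)
  then show ?thesis using assms by (subst Lp_norm_le_iff) auto
qed

lemma Lp_space_cmult:
  assumes "f \<in> Lp_space p"
  shows "(\<lambda>x. c * f x) \<in> Lp_space p"
  using assms by (auto simp: Lp_space_def norm_mult powr_mult)

lemma Lp_norm_cmult:
  assumes "0 < p"
  shows "Lp_norm p (\<lambda>x. c * f x) = norm c * Lp_norm p f"
  using assms by (simp add: Lp_norm_def norm_mult powr_mult powr_powr)

lemma Lp_space_zero [simp]: "(\<lambda>x. 0) \<in> Lp_space p"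
  by (simp add: Lp_space_def)

lemma Lp_norm_zero [simp]: "Lp_norm p (\<lambda>x. 0) = 0"
  by (simp add: Lp_norm_def)

text \<open>
  With \<open>a\<close> and \<open>b\<close> strictly above the two norms, the integrand is at most \<open>(a + b)\<^sup>p\<close> times the convex
  combination of \<open>(\<bar>f\<bar>/a)\<^sup>p\<close> and \<open>(\<bar>g\<bar>/b)\<^sup>p\<close> with weights \<open>a/(a+b)\<close> and \<open>b/(a+b)\<close>. The slack covers
  functions of norm zero, by which one cannot divide. The inequality of Hoelder is treated in the
  same way, with the inequality of Young in place of convexity.
\<close>
lemma Minkowski_aux:
  assumes p: "1 \<le> p" and f: "f \<in> Lp_space p" and g: "g \<in> Lp_space p"
    and a: "Lp_norm p f < a" and b: "Lp_norm p g < b"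
  shows "(\<lambda>x. f x + g x) \<in> Lp_space p \<and> Lp_norm p (\<lambda>x. f x + g x) \<le> a + b"
proof -
  have pos: "0 < a" "0 < b"
    using a b Lp_norm_nonneg[of p f] Lp_norm_nonneg[of p g] by linarith+
  define l where "l = a / (a + b)"
  have l: "0 \<le> l" "l \<le> 1" and l': "1 - l = b / (a + b)"
    using pos by (auto simp: l_def field_simps)
  define h where "h x = (a + b) powr p * (l * (norm (f x) powr p / a powr p) + (1 - l) * (norm (g x) powr p / b powr p))" for x
  have le: "norm (f x + g x) powr p \<le> h x" for x
  proof -
    have "norm (f x + g x) powr p \<le> (norm (f x) + norm (g x)) powr p"
      using p by (intro powr_mono2 norm_triangle_ineq) auto
    also have "norm (f x) + norm (g x) = (a + b) * (l * (norm (f x) / a) + (1 - l) * (norm (g x) / b))"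
    proof -
      have "a + b \<noteq> 0" using pos by simp
      then have "(a + b) * l = a" "(a + b) * (1 - l) = b"
        by (simp_all add: l_def right_diff_distrib)
      then have "(a + b) * (l * (norm (f x) / a) + (1 - l) * (norm (g x) / b))
          = a * (norm (f x) / a) + b * (norm (g x) / b)"
        by (simp only: distrib_left mult.assoc[symmetric])
      then show ?thesis using pos by simp
    qed
    also have "\<dots> powr p = (a + b) powr p * (l * (norm (f x) / a) + (1 - l) * (norm (g x) / b)) powr p"
      using pos l by (intro powr_mult)
    also have "\<dots> \<le> (a + b) powr p * (l * (norm (f x) / a) powr p + (1 - l) * (norm (g x) / b) powr p)"
      using pos l p by (intro mult_left_mono powr_mono_convex_comb) auto
    finally show ?thesis using pos by (simp add: h_def powr_divide)
  qed
  have inth: "integrable unit_lebesgue h"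
    unfolding h_def using Lp_space_integrable[OF f] Lp_space_integrable[OF g] by simp
  have meas: "(\<lambda>x. f x + g x) \<in> borel_measurable unit_lebesgue"
    using Lp_space_measurable[OF f] Lp_space_measurable[OF g] by measurable
  have int: "integrable unit_lebesgue (\<lambda>x. norm (f x + g x) powr p)"
    using le meas by (intro Bochner_Integration.integrable_bound[OF inth] AE_I2)
       (auto intro: order_trans[OF le abs_ge_self])
  have "(LINT x|unit_lebesgue. norm (f x + g x) powr p) \<le> (LINT x|unit_lebesgue. h x)"
    using le by (intro integral_mono int inth)
  also have "\<dots> = (a + b) powr p * (l * (Lp_norm p f powr p / a powr p) + (1 - l) * (Lp_norm p g powr p / b powr p))"
    unfolding h_def using Lp_space_integrable[OF f] Lp_space_integrable[OF g] p
    by (simp add: Lp_norm_powr)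
  also have "\<dots> \<le> (a + b) powr p * (l * 1 + (1 - l) * 1)"
    using a b l pos p by (intro mult_left_mono add_mono) (auto simp: divide_le_eq_1 intro!: powr_mono2)
  finally have "Lp_norm p (\<lambda>x. f x + g x) \<le> a + b"
    using p pos by (subst Lp_norm_le_iff) auto
  then show ?thesis using int meas by (simp add: Lp_space_def)
qed

lemma Lp_space_add:
  assumes "1 \<le> p" "f \<in> Lp_space p" "g \<in> Lp_space p"
  shows "(\<lambda>x. f x + g x) \<in> Lp_space p"
  using Minkowski_aux[OF assms, of "Lp_norm p f + 1" "Lp_norm p g + 1"] by simp

lemma Lp_norm_triangle:
  assumes "1 \<le> p" "f \<in> Lp_space p" "g \<in> Lp_space p"
  shows "Lp_norm p (\<lambda>x. f x + g x) \<le> Lp_norm p f + Lp_norm p g"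
proof (rule field_le_epsilon)
  fix e :: real assume "0 < e"
  then show "Lp_norm p (\<lambda>x. f x + g x) \<le> Lp_norm p f + Lp_norm p g + e"
    using Minkowski_aux[OF assms, of "Lp_norm p f + e / 2" "Lp_norm p g + e / 2"] by simp
qed

lemma Lp_space_diff:
  assumes "1 \<le> p" "f \<in> Lp_space p" "g \<in> Lp_space p"
  shows "(\<lambda>x. f x - g x) \<in> Lp_space p"
  using Lp_space_add[OF assms(1,2) Lp_space_cmult[OF assms(3), of "-1"]] by simp

lemma Lp_norm_triangle_diff:
  assumes "1 \<le> p" "f \<in> Lp_space p" "g \<in> Lp_space p"
  shows "Lp_norm p (\<lambda>x. f x - g x) \<le> Lp_norm p f + Lp_norm p g"
  using Lp_norm_triangle[OF assms(1,2) Lp_space_cmult[OF assms(3), of "-1"]]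
    Lp_norm_cmult[of p "-1" g] assms by simp

lemma Lp_space_sum:
  assumes "1 \<le> p" "\<And>i. i \<in> I \<Longrightarrow> f i \<in> Lp_space p"
  shows "(\<lambda>x. \<Sum>i\<in>I. f i x) \<in> Lp_space p"
  using assms(2)
  by (induction I rule: infinite_finite_induct) (auto intro!: Lp_space_add assms(1))

lemma Lp_norm_sum_le:
  assumes "1 \<le> p" "\<And>i. i \<in> I \<Longrightarrow> f i \<in> Lp_space p"
  shows "Lp_norm p (\<lambda>x. \<Sum>i\<in>I. f i x) \<le> (\<Sum>i\<in>I. Lp_norm p (f i))"
  using assms(2)
proof (induction I rule: infinite_finite_induct)
  case (insert i I)
  have "Lp_norm p (\<lambda>x. f i x + (\<Sum>i\<in>I. f i x)) \<le> Lp_norm p (f i) + Lp_norm p (\<lambda>x. \<Sum>i\<in>I. f i x)"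
    using insert assms(1) by (intro Lp_norm_triangle Lp_space_sum) auto
  then show ?case using insert by fastforce
qed auto

lemma Hoelder_aux:
  assumes p: "1 < p" and q: "1 < q" and pq: "1 / p + 1 / q = 1"
    and f: "f \<in> Lp_space p" and g: "g \<in> Lp_space q"
    and a: "Lp_norm p f < a" and b: "Lp_norm q g < b"
  shows "integrable unit_lebesgue (\<lambda>x. f x * g x) \<and> norm (LINT x|unit_lebesgue. f x * g x) \<le> a * b"
proof -
  have pos: "0 < a" "0 < b"
    using a b Lp_norm_nonneg[of p f] Lp_norm_nonneg[of q g] by linarith+
  define h where "h x = a * b * (norm (f x) powr p / a powr p / p + norm (g x) powr q / b powr q / q)" for x
  have le: "norm (f x * g x) \<le> h x" for x
  proof -
    have "(norm (f x) / a) * (norm (g x) / b) \<le> (norm (f x) / a) powr p / p + (norm (g x) / b) powr q / q"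
      using pos p q pq by (intro Youngs_inequality) auto
    then have "norm (f x) * norm (g x) / (a * b) \<le> norm (f x) powr p / a powr p / p + norm (g x) powr q / b powr q / q"
      using pos by (simp add: powr_divide)
    then show ?thesis
      using pos by (simp add: h_def norm_mult pos_divide_le_eq mult.commute)
  qed
  have inth: "integrable unit_lebesgue h"
    unfolding h_def using Lp_space_integrable[OF f] Lp_space_integrable[OF g] by simp
  have meas: "(\<lambda>x. f x * g x) \<in> borel_measurable unit_lebesgue"
    using Lp_space_measurable[OF f] Lp_space_measurable[OF g] by measurable
  have int: "integrable unit_lebesgue (\<lambda>x. f x * g x)"
    using le meas by (intro Bochner_Integration.integrable_bound[OF inth] AE_I2)
       (auto intro: order_trans[OF le abs_ge_self])
  have "norm (LINT x|unit_lebesgue. f x * g x) \<le> (LINT x|unit_lebesgue. norm (f x * g x))"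
    by (rule integral_norm_bound)
  also have "\<dots> \<le> (LINT x|unit_lebesgue. h x)"
    using le by (intro integral_mono integrable_norm int inth)
  also have "\<dots> = a * b * (Lp_norm p f powr p / a powr p / p + Lp_norm q g powr q / b powr q / q)"
    unfolding h_def using Lp_space_integrable[OF f] Lp_space_integrable[OF g] p q
    by (simp add: Lp_norm_powr)
  also have "\<dots> \<le> a * b * (1 / p + 1 / q)"
    using a b pos p q
    by (intro mult_left_mono add_mono divide_right_mono) (auto simp: divide_le_eq_1 intro!: powr_mono2)
  finally show ?thesis using int pq by simp
qed

lemma Hoelder_integrable:
  assumes "1 < p" "1 < q" "1 / p + 1 / q = 1" "f \<in> Lp_space p" "g \<in> Lp_space q"
  shows "integrable unit_lebesgue (\<lambda>x. f x * g x)"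
  using Hoelder_aux[OF assms, of "Lp_norm p f + 1" "Lp_norm q g + 1"] by simp

lemma Hoelder_inequality:
  assumes "1 < p" "1 < q" "1 / p + 1 / q = 1" "f \<in> Lp_space p" "g \<in> Lp_space q"
  shows "norm (LINT x|unit_lebesgue. f x * g x) \<le> Lp_norm p f * Lp_norm q g"
proof (rule tendsto_lowerbound)
  show "((\<lambda>e. (Lp_norm p f + e) * (Lp_norm q g + e)) \<longlongrightarrow> Lp_norm p f * Lp_norm q g) (at_right 0)"
    by (auto intro!: tendsto_eq_intros)
  show "\<forall>\<^sub>F e in at_right 0. norm (LINT x|unit_lebesgue. f x * g x) \<le> (Lp_norm p f + e) * (Lp_norm q g + e)"
    using Hoelder_aux[OF assms]
    by (auto simp: eventually_at_right_field intro!: exI[of _ 1])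
qed auto

section \<open>Bounded orthonormal systems\<close>

lemma conjugate_exponent:
  fixes p :: real
  assumes "1 < p"
  obtains q where "1 < q" "1 / p + 1 / q = 1" "1 / q + 1 / p = 1"
  using assms by (intro that[of "p / (p - 1)"]) (auto simp: field_simps)

definition fourier_coeff :: "(nat \<Rightarrow> real \<Rightarrow> complex) \<Rightarrow> (real \<Rightarrow> complex) \<Rightarrow> nat \<Rightarrow> complex" where
  "fourier_coeff e f n = (LINT x|unit_lebesgue. f x * e n x)"

text \<open>
  The systems below are real-valued, so that coefficients are integrals without conjugation, and
  uniformly bounded, so that they have coefficients on every \<open>L\<^sub>p\<close> with \<open>p > 1\<close>. Functions take complex
  values because \<open>Lp_space\<close> does.
\<close>
locale bounded_orthonormal_system =
  fixes e :: "nat \<Rightarrow> real \<Rightarrow> complex" and B :: real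
  assumes measurable_e [measurable]: "e n \<in> borel_measurable unit_lebesgue"
    and norm_e_le: "x \<in> {0..1} \<Longrightarrow> norm (e n x) \<le> B"
    and cnj_e: "cnj (e n x) = e n x"
    and orthonormal: "(LINT x|unit_lebesgue. e m x * e n x) = (if m = n then 1 else 0)"
begin

lemma B_nonneg: "0 \<le> B"
  using order.trans[OF norm_ge_zero norm_e_le[of 0 0]] by simp

lemma e_in_Lp: "0 < p \<Longrightarrow> e n \<in> Lp_space p"
  by (intro bounded_in_Lp[where B = B] measurable_e norm_e_le) auto

lemma Lp_norm_e_le: "0 < p \<Longrightarrow> Lp_norm p (e n) \<le> B"
  by (intro Lp_norm_le_bound measurable_e norm_e_le B_nonneg) auto

lemma sum_in_Lp: "1 \<le> p \<Longrightarrow> (\<lambda>x. \<Sum>n\<in>I. c n * e n x) \<in> Lp_space p"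
  by (intro Lp_space_sum Lp_space_cmult e_in_Lp) auto

lemma Lp_norm_sum_le_l1:
  assumes "1 \<le> p"
  shows "Lp_norm p (\<lambda>x. \<Sum>n\<in>I. c n * e n x) \<le> (\<Sum>n\<in>I. norm (c n)) * B"
proof -
  have "Lp_norm p (\<lambda>x. \<Sum>n\<in>I. c n * e n x) \<le> (\<Sum>n\<in>I. Lp_norm p (\<lambda>x. c n * e n x))"
    using assms by (intro Lp_norm_sum_le Lp_space_cmult e_in_Lp) auto
  also have "\<dots> \<le> (\<Sum>n\<in>I. norm (c n) * B)"
    using assms by (intro sum_mono) (simp add: Lp_norm_cmult Lp_norm_e_le mult_left_mono)
  finally show ?thesis by (simp add: sum_distrib_right)
qed

lemma coeff_integrable:
  assumes "1 < p" "f \<in> Lp_space p"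
  shows "integrable unit_lebesgue (\<lambda>x. f x * e n x)"
proof -
  obtain q where "1 < q" "1 / p + 1 / q = 1" using conjugate_exponent[OF assms(1)] .
  then show ?thesis using assms by (intro Hoelder_integrable e_in_Lp) auto
qed

lemma norm_coeff_le:
  assumes "1 < p" "f \<in> Lp_space p"
  shows "norm (fourier_coeff e f n) \<le> Lp_norm p f * B"
proof -
  obtain q where q: "1 < q" "1 / p + 1 / q = 1" using conjugate_exponent[OF assms(1)] .
  have "norm (fourier_coeff e f n) \<le> Lp_norm p f * Lp_norm q (e n)"
    unfolding fourier_coeff_def using assms q by (intro Hoelder_inequality e_in_Lp) auto
  also have "\<dots> \<le> Lp_norm p f * B" using q by (intro mult_left_mono Lp_norm_e_le) auto
  finally show ?thesis .
qed

lemma coeff_diff: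
  assumes "1 < p" "f \<in> Lp_space p" "g \<in> Lp_space p"
  shows "fourier_coeff e (\<lambda>x. f x - g x) n = fourier_coeff e f n - fourier_coeff e g n"
  using coeff_integrable[OF assms(1,2)] coeff_integrable[OF assms(1,3)]
  by (simp add: fourier_coeff_def left_diff_distrib)

lemma LINT_times_sum:
  assumes "1 < p" "f \<in> Lp_space p"
  shows "(LINT x|unit_lebesgue. f x * (\<Sum>n\<in>I. c n * e n x)) = (\<Sum>n\<in>I. c n * fourier_coeff e f n)"
proof -
  have "(LINT x|unit_lebesgue. f x * (\<Sum>n\<in>I. c n * e n x)) = (LINT x|unit_lebesgue. (\<Sum>n\<in>I. c n * (f x * e n x)))"
    by (simp add: sum_distrib_left mult.left_commute)
  then show ?thesis
    using coeff_integrable[OF assms] by (simp add: Bochner_Integration.integral_sum fourier_coeff_def)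
qed

lemma coeff_sum:
  assumes "finite I"
  shows "fourier_coeff e (\<lambda>x. \<Sum>n\<in>I. c n * e n x) k = (if k \<in> I then c k else 0)"
proof -
  have "fourier_coeff e (\<lambda>x. \<Sum>n\<in>I. c n * e n x) k = (LINT x|unit_lebesgue. e k x * (\<Sum>n\<in>I. c n * e n x))"
    by (simp add: fourier_coeff_def mult.commute)
  also have "\<dots> = (\<Sum>n\<in>I. c n * fourier_coeff e (e k) n)"
    by (rule LINT_times_sum[of 2]) (auto intro: e_in_Lp)
  also have "\<dots> = (\<Sum>n\<in>I. if k = n then c n else 0)"
    by (intro sum.cong) (auto simp: fourier_coeff_def orthonormal)
  finally show ?thesis using assms by simp
qed

lemma LINT_sums_mult:
  assumes "finite I" "finite J"
  shows "(LINT x|unit_lebesgue. (\<Sum>m\<in>I. c m * e m x) * (\<Sum>m\<in>J. d m * e m x)) = (\<Sum>m\<in>I \<inter> J. c m * d m)"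
proof -
  have "(LINT x|unit_lebesgue. (\<Sum>m\<in>I. c m * e m x) * (\<Sum>m\<in>J. d m * e m x))
      = (\<Sum>m\<in>J. d m * (if m \<in> I then c m else 0))"
    using LINT_times_sum[of 2, OF _ sum_in_Lp] by (simp add: coeff_sum[OF assms(1)])
  also have "\<dots> = (\<Sum>m\<in>J. if m \<in> I then c m * d m else 0)"
    by (intro sum.cong) auto
  also have "\<dots> = (\<Sum>m\<in>I \<inter> J. c m * d m)"
    by (subst Int_commute) (simp add: sum.inter_restrict[OF assms(2)])
  finally show ?thesis .
qed

end

section \<open>Dyadic step functions\<close>

text \<open>
  The cells of level \<open>n\<close> are the intervals \<open>(i/2\<^sup>n, (i+1)/2\<^sup>n]\<close>, and the point \<open>0\<close>, where the integer
  below is negative, is put into cell \<open>0\<close> by the truncation of \<open>nat\<close>. In this way every point of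
  the closed unit interval has an index below \<open>2\<^sup>n\<close>, and statements about step functions hold at
  every point rather than almost everywhere.
\<close>
definition dyadic_index :: "nat \<Rightarrow> real \<Rightarrow> nat" where
  "dyadic_index n x = nat (\<lceil>2 ^ n * x\<rceil> - 1)"

lemma dyadic_index_less: "x \<in> {0..1} \<Longrightarrow> dyadic_index n x < 2 ^ n"
proof -
  assume x: "x \<in> {0..1}"
  have "2 ^ n * x \<le> 2 ^ n" using x by simp
  then have "\<lceil>2 ^ n * x\<rceil> \<le> 2 ^ n" by (simp add: ceiling_le_iff)
  then show ?thesis by (auto simp: dyadic_index_def nat_less_iff)
qed

lemma dyadic_index_eq_iff:
  assumes "0 < x"
  shows "dyadic_index n x = i \<longleftrightarrow> x \<in> {real i / 2 ^ n<..real (Suc i) / 2 ^ n}"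
proof -
  have "1 \<le> \<lceil>2 ^ n * x\<rceil>" using assms by (simp add: one_le_ceiling)
  then have "dyadic_index n x = i \<longleftrightarrow> \<lceil>2 ^ n * x\<rceil> = int (Suc i)"
    by (auto simp: dyadic_index_def)
  also have "\<dots> \<longleftrightarrow> real i < 2 ^ n * x \<and> 2 ^ n * x \<le> real (Suc i)"
    by (simp add: ceiling_eq_iff)
  finally show ?thesis by (simp add: field_simps)
qed

lemma dyadic_index_zero [simp]: "dyadic_index n 0 = 0"
  by (simp add: dyadic_index_def)

lemma dyadic_index_div2: "0 \<le> x \<Longrightarrow> dyadic_index (Suc n) x div 2 = dyadic_index n x"
proof (cases "x = 0")
  case False
  assume "0 \<le> x"
  with False have x: "0 < x" by simp
  define i where "i = dyadic_index (Suc n) x"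
  have "real i / 2 ^ Suc n < x" "x \<le> real (Suc i) / 2 ^ Suc n"
    using dyadic_index_eq_iff[OF x, of "Suc n" i] by (auto simp: i_def)
  then have a: "real i < 2 * (2 ^ n * x)" "2 * (2 ^ n * x) \<le> real i + 1" by (auto simp: field_simps)
  define j where "j = i div 2"
  have "real (2 * j) \<le> real i" "real i \<le> real (2 * j + 1)" unfolding j_def of_nat_le_iff by auto
  with a have "real j < 2 ^ n * x" "2 ^ n * x \<le> real j + 1" by auto
  then have "dyadic_index n x = j"
    by (subst dyadic_index_eq_iff[OF x]) (auto simp: field_simps)
  then show ?thesis by (simp add: i_def j_def)
qed simp

text \<open>
  In this form, closure under arbitrary pointwise operations is immediate.
\<close>
definition dyadic_step :: "nat \<Rightarrow> (real \<Rightarrow> 'a) \<Rightarrow> bool" where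
  "dyadic_step n g \<longleftrightarrow>
     (\<forall>x\<in>{0..1}. \<forall>y\<in>{0..1}. dyadic_index n x = dyadic_index n y \<longrightarrow> g x = g y)"

lemma dyadic_step_const [simp]: "dyadic_step n (\<lambda>x. c)"
  by (simp add: dyadic_step_def)

lemma dyadic_step_comp: "dyadic_step n f \<Longrightarrow> dyadic_step n (\<lambda>x. F (f x))"
  unfolding dyadic_step_def by metis

lemma dyadic_step_comp2: "dyadic_step n f \<Longrightarrow> dyadic_step n g \<Longrightarrow> dyadic_step n (\<lambda>x. F (f x) (g x))"
  unfolding dyadic_step_def by metis

lemma dyadic_step_sum: "(\<And>i. i \<in> I \<Longrightarrow> dyadic_step n (f i)) \<Longrightarrow> dyadic_step n (\<lambda>x. \<Sum>i\<in>I. f i x)"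
  unfolding dyadic_step_def by (metis (mono_tags, lifting) sum.cong)

lemma dyadic_step_prod: "(\<And>i. i \<in> I \<Longrightarrow> dyadic_step n (f i)) \<Longrightarrow> dyadic_step n (\<lambda>x. \<Prod>i\<in>I. f i x)"
  unfolding dyadic_step_def by (metis (mono_tags, lifting) prod.cong)

lemma dyadic_step_Suc: "dyadic_step n g \<Longrightarrow> dyadic_step (Suc n) g"
  unfolding dyadic_step_def by (metis atLeastAtMost_iff dyadic_index_div2)

lemma dyadic_step_mono: "dyadic_step n g \<Longrightarrow> n \<le> m \<Longrightarrow> dyadic_step m g"
  by (rule dec_induct[of n m "\<lambda>m. dyadic_step m g"]) (auto intro: dyadic_step_Suc)

lemma dyadic_step_index: "dyadic_step n (\<lambda>x. F (dyadic_index n x))"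
  by (auto simp: dyadic_step_def)

lemma cell_right_end_le_1:
  assumes "i < 2 ^ n"
  shows "real (Suc i) / 2 ^ n \<le> 1"
proof -
  have "real (Suc i) \<le> real (2 ^ n)"
    using assms by (simp only: of_nat_le_iff Suc_le_eq)
  then show ?thesis by (simp add: divide_le_eq_1)
qed

lemma dyadic_index_right_end: "dyadic_index n (real (Suc i) / 2 ^ n) = i"
  by (subst dyadic_index_eq_iff) (auto simp: divide_strict_right_mono)

lemma dyadic_step_obtain:
  assumes "dyadic_step n g"
  obtains G where "\<And>x. x \<in> {0..1} \<Longrightarrow> g x = G (dyadic_index n x)"
proof
  fix x :: real assume x: "x \<in> {0..1}"
  have "real (Suc (dyadic_index n x)) / 2 ^ n \<le> 1"
    by (rule cell_right_end_le_1[OF dyadic_index_less[OF x]])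
  then have "real (Suc (dyadic_index n x)) / 2 ^ n \<in> {0..1}" by simp
  then show "g x = (\<lambda>i. g (real (Suc i) / 2 ^ n)) (dyadic_index n x)"
    using assms x dyadic_index_right_end unfolding dyadic_step_def by metis
qed

lemma dyadic_index_measurable: "dyadic_index n \<in> measurable unit_lebesgue (count_space UNIV)"
proof -
  have "dyadic_index n \<in> measurable borel (count_space UNIV)"
    unfolding dyadic_index_def[abs_def] by measurable
  then show ?thesis
    by (intro measurable_restrict_space1 measurable_completion) (auto simp: measurable_cong_sets[OF sets_lborel])
qed

lemma dyadic_step_measurable:
  fixes g :: "real \<Rightarrow> 'a::topological_space"
  assumes "dyadic_step n g"
  shows "g \<in> borel_measurable unit_lebesgue"
proof -
  obtain G where G: "\<And>x. x \<in> {0..1} \<Longrightarrow> g x = G (dyadic_index n x)"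
    using dyadic_step_obtain[OF assms] by blast
  have "(\<lambda>x. G (dyadic_index n x)) \<in> borel_measurable unit_lebesgue"
    by (rule measurable_compose[OF dyadic_index_measurable]) simp
  then show ?thesis
    by (subst measurable_cong[of _ _ "\<lambda>x. G (dyadic_index n x)"]) (auto simp: G)
qed

lemma dyadic_step_bounded:
  fixes g :: "real \<Rightarrow> 'a::real_normed_vector"
  assumes "dyadic_step n g"
  obtains B where "0 \<le> B" "\<And>x. x \<in> {0..1} \<Longrightarrow> norm (g x) \<le> B"
proof -
  obtain G where G: "\<And>x. x \<in> {0..1} \<Longrightarrow> g x = G (dyadic_index n x)"
    using dyadic_step_obtain[OF assms] by blast
  show ?thesis
  proof
    show "0 \<le> (\<Sum>i<2^n. norm (G i))" by (simp add: sum_nonneg)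
    show "norm (g x) \<le> (\<Sum>i<2^n. norm (G i))" if "x \<in> {0..1}" for x
      unfolding G[OF that] using dyadic_index_less[OF that, of n]
      by (intro member_le_sum[of "dyadic_index n x" _ "\<lambda>i. norm (G i)"]) auto
  qed
qed

lemma dyadic_step_integrable:
  fixes g :: "real \<Rightarrow> 'a::{banach,second_countable_topology}"
  assumes "dyadic_step n g"
  shows "integrable unit_lebesgue g"
  using dyadic_step_bounded[OF assms] integrable_bounded[OF dyadic_step_measurable[OF assms]] by metis

lemma dyadic_step_in_Lp: "dyadic_step n g \<Longrightarrow> 0 < p \<Longrightarrow> g \<in> Lp_space p"
  using dyadic_step_bounded[of n g] bounded_in_Lp[OF dyadic_step_measurable[of n g], of _ p] by metis

lemma measure_dyadic_cell:
  assumes "i < 2 ^ n"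
  shows "measure unit_lebesgue {x\<in>{0..1}. dyadic_index n x = i} = 1 / 2 ^ n"
proof -
  define I where "I = {real i / 2 ^ n<..real (Suc i) / 2 ^ n}"
  have le: "real (Suc i) / 2 ^ n \<le> 1"
    by (rule cell_right_end_le_1[OF assms])
  have sub: "I \<subseteq> {0..1}" and pos: "\<And>x. x \<in> I \<Longrightarrow> 0 < x"
  proof -
    have "0 \<le> real i / 2 ^ n" by simp
    then show "I \<subseteq> {0..1}" "\<And>x. x \<in> I \<Longrightarrow> 0 < x"
      using le unfolding I_def subset_iff greaterThanAtMost_iff atLeastAtMost_iff by (metis less_le_not_le order.trans order.strict_trans1)+
  qed
  have mI: "measure lebesgue I = 1 / 2 ^ n"
    by (simp add: I_def divide_right_mono diff_divide_distrib[symmetric])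
  let ?S = "{x\<in>{0..1}. dyadic_index n x = i}"
  have S: "?S \<in> sets unit_lebesgue"
    using measurable_sets[OF dyadic_index_measurable, of "{i}" n]
    by (simp add: vimage_def Int_def conj_commute)
  have "measure unit_lebesgue ?S = measure lebesgue ?S"
    by (rule measure_restrict_space) auto
  also have "\<dots> = measure lebesgue I"
  proof (rule measure_eq_AE)
    have "AE x in lebesgue. x \<noteq> 0"
      by (intro AE_completion AE_lborel_singleton)
    moreover have "x \<noteq> 0 \<Longrightarrow> x \<in> ?S \<longleftrightarrow> x \<in> I" for x :: real
      using dyadic_index_eq_iff[of x n i] sub pos[of x] unfolding I_def[symmetric] by force
    ultimately show "AE x in lebesgue. x \<in> ?S \<longleftrightarrow> x \<in> I" by (auto elim: eventually_mono)
    show "?S \<in> sets lebesgue" using S by (simp add: sets_restrict_space_iff)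
    show "I \<in> sets lebesgue" by (simp add: I_def)
  qed
  finally show ?thesis using mI by simp
qed

lemma LINT_dyadic_step:
  fixes G :: "nat \<Rightarrow> 'a::{banach,second_countable_topology}"
  shows "(LINT x|unit_lebesgue. G (dyadic_index n x)) = (1 / 2 ^ n) *\<^sub>R (\<Sum>i<2^n. G i)"
proof -
  let ?S = "\<lambda>i. {x\<in>{0..1}. dyadic_index n x = i}"
  have S: "?S i \<in> sets unit_lebesgue" for i
    using measurable_sets[OF dyadic_index_measurable, of "{i}" n]
    by (simp add: vimage_def Int_def conj_commute)
  have fin: "emeasure unit_lebesgue (?S i) < \<infinity>" for i
    using finite_measure.emeasure_finite[OF finite_measure_unit_lebesgue] by (simp add: less_top)
  have "(LINT x|unit_lebesgue. G (dyadic_index n x))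
      = (LINT x|unit_lebesgue. (\<Sum>i<2^n. indicator (?S i) x *\<^sub>R G i))"
  proof (rule Bochner_Integration.integral_cong)
    fix x assume "x \<in> space unit_lebesgue"
    then have x: "x \<in> {0..1}" by simp
    have "(\<Sum>i<2^n. indicator (?S i) x *\<^sub>R G i) = (\<Sum>i<2^n. if i = dyadic_index n x then G i else 0)"
      using x by (intro sum.cong) (auto simp: indicator_def)
    then show "G (dyadic_index n x) = (\<Sum>i<2^n. indicator (?S i) x *\<^sub>R G i)"
      using dyadic_index_less[OF x, of n] by (simp add: sum.delta)
  qed simp
  also have "\<dots> = (\<Sum>i<2^n. measure unit_lebesgue (?S i) *\<^sub>R G i)"
  proof (subst Bochner_Integration.integral_sum)
    have *: "has_bochner_integral unit_lebesgue (\<lambda>x. indicator (?S i) x *\<^sub>R G i) (measure unit_lebesgue (?S i) *\<^sub>R G i)" for i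
      by (rule has_bochner_integral_scaleR_left, rule has_bochner_integral_real_indicator[OF S fin])
    show "integrable unit_lebesgue (\<lambda>x. indicator (?S i) x *\<^sub>R G i)" for i
      using * by (auto simp: has_bochner_integral_iff)
    show "(\<Sum>i<2^n. LINT x|unit_lebesgue. indicator (?S i) x *\<^sub>R G i) = (\<Sum>i<2^n. measure unit_lebesgue (?S i) *\<^sub>R G i)"
      using * by (auto simp: has_bochner_integral_iff)
  qed
  also have "\<dots> = (1 / 2 ^ n) *\<^sub>R (\<Sum>i<2^n. G i)"
    unfolding scaleR_sum_right by (intro sum.cong refl, subst measure_dyadic_cell) auto
  finally show ?thesis .
qed

definition rademacher :: "nat \<Rightarrow> real \<Rightarrow> real" where
  "rademacher n x = (-1) ^ dyadic_index (Suc n) x"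

lemma rademacher_cases: "rademacher n x = 1 \<or> rademacher n x = -1"
  by (cases "even (dyadic_index (Suc n) x)") (auto simp: rademacher_def)

lemma abs_rademacher [simp]: "\<bar>rademacher n x\<bar> = 1"
  using rademacher_cases[of n x] by auto

lemma dyadic_step_rademacher: "n < m \<Longrightarrow> dyadic_step m (rademacher n)"
  by (rule dyadic_step_mono[of "Suc n"])
     (auto simp: rademacher_def[abs_def] intro: dyadic_step_index[of _ "\<lambda>i. (-1) ^ i"])

text \<open>
  The function \<open>r\<^sub>n\<close> takes the values \<open>1\<close> and \<open>-1\<close> on the two halves of each cell of level \<open>n\<close>, and
  \<open>g\<close> is constant on the cell.
\<close>
lemma LINT_rademacher_times:
  fixes g :: "real \<Rightarrow> 'a::{banach,second_countable_topology}"
  assumes "dyadic_step n g"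
  shows "(LINT x|unit_lebesgue. rademacher n x *\<^sub>R g x) = 0"
proof -
  obtain G where G: "\<And>x. x \<in> {0..1} \<Longrightarrow> g x = G (dyadic_index n x)"
    using dyadic_step_obtain[OF assms] by blast
  have "(LINT x|unit_lebesgue. rademacher n x *\<^sub>R g x)
      = (LINT x|unit_lebesgue. (\<lambda>i. (-1) ^ i *\<^sub>R G (i div 2)) (dyadic_index (Suc n) x))"
    by (intro Bochner_Integration.integral_cong) (auto simp: G rademacher_def dyadic_index_div2)
  also have "\<dots> = (1 / 2 ^ Suc n) *\<^sub>R (\<Sum>i<2 ^ Suc n. (-1) ^ i *\<^sub>R G (i div 2))"
    by (rule LINT_dyadic_step)
  also have "(\<Sum>i<2 * m. (-1) ^ i *\<^sub>R G (i div 2)) = 0" for m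
    by (induction m) auto
  from this[of "2 ^ n"] have "(\<Sum>i<2 ^ Suc n. (-1) ^ i *\<^sub>R G (i div 2)) = 0"
    by simp
  finally show ?thesis by simp
qed

text \<open>
  The step that drives all inductions on the level: conditionally on the first \<open>n\<close> binary digits the
  next sign is \<open>1\<close> or \<open>-1\<close> with equal probability.
\<close>
lemma LINT_average_over_sign:
  fixes F :: "real \<Rightarrow> real \<Rightarrow> 'a::{banach,second_countable_topology}"
  assumes "\<And>s. dyadic_step n (F s)"
  shows "(LINT x|unit_lebesgue. F (rademacher n x) x) = (LINT x|unit_lebesgue. (1/2) *\<^sub>R (F 1 x + F (-1) x))"
proof -
  let ?A = "\<lambda>x. (1/2) *\<^sub>R (F 1 x + F (-1) x)" and ?D = "\<lambda>x. (1/2) *\<^sub>R (F 1 x - F (-1) x)"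
  have A: "dyadic_step n ?A" and D: "dyadic_step n ?D"
    by (rule dyadic_step_comp2[OF assms assms])+
  have RD: "dyadic_step (Suc n) (\<lambda>x. rademacher n x *\<^sub>R ?D x)"
    by (rule dyadic_step_comp2[OF dyadic_step_rademacher dyadic_step_Suc[OF D]]) simp
  have half: "(1/2) *\<^sub>R (a + b) + (1/2) *\<^sub>R (a - b) = a" "(1/2) *\<^sub>R (a + b) - (1/2) *\<^sub>R (a - b) = b" for a b :: 'a
    unfolding scaleR_add_right[symmetric] scaleR_diff_right[symmetric] by (simp_all add: scaleR_2[symmetric])
  have "F (rademacher n x) x = ?A x + rademacher n x *\<^sub>R ?D x" for x
    using rademacher_cases[of n x] half by auto
  then have "(LINT x|unit_lebesgue. F (rademacher n x) x) = (LINT x|unit_lebesgue. ?A x + rademacher n x *\<^sub>R ?D x)"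
    by simp
  also have "\<dots> = (LINT x|unit_lebesgue. ?A x) + (LINT x|unit_lebesgue. rademacher n x *\<^sub>R ?D x)"
    by (rule Bochner_Integration.integral_add) (rule dyadic_step_integrable A RD)+
  also have "(LINT x|unit_lebesgue. rademacher n x *\<^sub>R ?D x) = 0"
    by (rule LINT_rademacher_times[OF D])
  finally show ?thesis by simp
qed

section \<open>Walsh functions\<close>

lemma sum_lessThan_add:
  fixes f :: "nat \<Rightarrow> 'a::comm_monoid_add"
  shows "(\<Sum>m<a+b. f m) = (\<Sum>m<a. f m) + (\<Sum>m<b. f (a + m))"
  by (induction b) (auto simp: add.assoc)

text \<open>
  Walsh functions in the order of Paley: \<open>set_decode m\<close> is the set of positions of the binary digit
  \<open>1\<close> in \<open>m\<close>. In particular the Rademacher functions are the Walsh functions of index \<open>2\<^sup>j\<close>.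
\<close>
definition walsh :: "nat \<Rightarrow> real \<Rightarrow> complex" where
  "walsh m x = (\<Prod>j\<in>set_decode m. of_real (rademacher j x))"

lemma walsh_0 [simp]: "walsh 0 x = 1"
  by (simp add: walsh_def)

lemma set_decode_less: "j \<in> set_decode m \<Longrightarrow> m < 2 ^ n \<Longrightarrow> j < n"
proof (rule ccontr)
  assume j: "j \<in> set_decode m" and m: "m < 2 ^ n" and "\<not> j < n"
  then have "(2::nat) ^ n \<le> 2 ^ j" by (intro power_increasing) auto
  with m have "m div 2 ^ j = 0" by (intro div_less) linarith
  with j show False by (simp add: set_decode_def)
qed

lemma walsh_top:
  assumes "m < 2 ^ n"
  shows "walsh (2 ^ n + m) x = of_real (rademacher n x) * walsh m x"
proof -
  have "n \<notin> set_decode m" using set_decode_less[OF _ assms] by auto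
  then show ?thesis by (simp add: walsh_def set_decode_plus_power_2)
qed

lemma walsh_power_two: "walsh (2 ^ n) x = of_real (rademacher n x)"
  using walsh_top[of 0 n x] by simp

lemma norm_walsh [simp]: "norm (walsh m x) = 1"
  by (simp add: walsh_def prod_norm[symmetric])

lemma cnj_walsh [simp]: "cnj (walsh m x) = walsh m x"
  by (simp add: walsh_def)

lemma dyadic_step_walsh:
  assumes "m < 2 ^ n"
  shows "dyadic_step n (walsh m)"
  unfolding walsh_def[abs_def]
  by (intro dyadic_step_prod dyadic_step_comp[where F = of_real] dyadic_step_rademacher)
     (rule set_decode_less[OF _ assms])

lemma dyadic_step_walsh_sum: "(\<And>m. m \<in> I \<Longrightarrow> m < 2 ^ n) \<Longrightarrow> dyadic_step n (\<lambda>x. \<Sum>m\<in>I. c m * walsh m x)"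
  by (intro dyadic_step_sum dyadic_step_comp[where F = "\<lambda>z. _ * z"] dyadic_step_walsh)

lemma walsh_measurable [measurable]: "walsh m \<in> borel_measurable unit_lebesgue"
  using dyadic_step_measurable[OF dyadic_step_walsh[OF less_exp]] .

lemma LINT_walsh_mult:
  "(LINT x|unit_lebesgue. walsh m x * walsh k x) = (if m = k then 1 else 0)"
proof -
  have "m < 2 ^ n \<Longrightarrow> k < 2 ^ n \<Longrightarrow> (LINT x|unit_lebesgue. walsh m x * walsh k x) = (if m = k then 1 else 0)" for n m k
  proof (induction n arbitrary: m k)
    case (Suc n)
    have zero: "(LINT x|unit_lebesgue. walsh (2 ^ n + a) x * walsh b x) = 0" if "a < 2 ^ n" "b < 2 ^ n" for a b
    proof -
      have "(LINT x|unit_lebesgue. walsh (2 ^ n + a) x * walsh b x)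
          = (LINT x|unit_lebesgue. rademacher n x *\<^sub>R (walsh a x * walsh b x))"
        using that by (simp add: walsh_top scaleR_conv_of_real mult.assoc)
      also have "\<dots> = 0"
        by (intro LINT_rademacher_times dyadic_step_comp2[OF dyadic_step_walsh dyadic_step_walsh] that)
      finally show ?thesis .
    qed
    have sq: "of_real (rademacher n x) * a * (of_real (rademacher n x) * b) = a * b" for x and a b :: complex
      using rademacher_cases[of n x] by auto
    have split: "\<exists>a<2^n. j = 2 ^ n + a" if "j < 2 ^ Suc n" "\<not> j < 2 ^ n" for j :: nat
      using that by (intro exI[of _ "j - 2 ^ n"]) auto
    show ?case
    proof (cases "m < 2 ^ n"; cases "k < 2 ^ n")
      assume "m < 2 ^ n" "k < 2 ^ n"
      then show ?thesis by (rule Suc.IH)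
    next
      assume m: "m < 2 ^ n" and k: "\<not> k < 2 ^ n"
      then obtain a where "a < 2 ^ n" "k = 2 ^ n + a" using split Suc.prems by blast
      then show ?thesis using zero[of a m] m by (simp add: mult.commute)
    next
      assume k: "k < 2 ^ n" and m: "\<not> m < 2 ^ n"
      then obtain a where "a < 2 ^ n" "m = 2 ^ n + a" using split Suc.prems by blast
      then show ?thesis using zero[of a k] k by simp
    next
      assume m: "\<not> m < 2 ^ n" and k: "\<not> k < 2 ^ n"
      obtain a where a: "a < 2 ^ n" "m = 2 ^ n + a" using split m Suc.prems by blast
      obtain b where b: "b < 2 ^ n" "k = 2 ^ n + b" using split k Suc.prems by blast
      show ?thesis using Suc.IH[OF a(1) b(1)] a b by (simp add: walsh_top sq)
    qed
  qed simp
  moreover have "m < 2 ^ (m + k)" "k < 2 ^ (m + k)"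
    using less_exp[of "m + k"] by linarith+
  ultimately show ?thesis by blast
qed

interpretation walsh: bounded_orthonormal_system walsh 1
  by unfold_locales (auto simp: LINT_walsh_mult)

lemma walsh_sum_split:
  "(\<Sum>m<2 ^ Suc n. c m * walsh m x)
    = (\<Sum>m<2 ^ n. c m * walsh m x) + of_real (rademacher n x) * (\<Sum>m<2 ^ n. c (2 ^ n + m) * walsh m x)"
proof -
  have "(\<Sum>m<2 ^ n. c (2 ^ n + m) * walsh (2 ^ n + m) x)
      = (\<Sum>m<2 ^ n. of_real (rademacher n x) * (c (2 ^ n + m) * walsh m x))"
    by (intro sum.cong) (auto simp: walsh_top mult_ac)
  then show ?thesis
    using sum_lessThan_add[of "\<lambda>m. c m * walsh m x" "2 ^ n" "2 ^ n"]
    by (simp add: mult_2 sum_distrib_left)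
qed

text \<open>
  By induction on the level: on a cell of level \<open>n\<close> with values \<open>u\<close> and \<open>v\<close> on its two halves, the
  function is \<open>(u + v)/2 + r\<^sub>n (u - v)/2\<close>, and both coefficients are step functions of level \<open>n\<close>.
\<close>
lemma dyadic_step_eq_walsh_sum:
  fixes g :: "real \<Rightarrow> complex"
  assumes "dyadic_step n g"
  shows "\<exists>c. \<forall>x\<in>{0..1}. g x = (\<Sum>m<2 ^ n. c m * walsh m x)"
  using assms
proof (induction n arbitrary: g)
  case 0
  obtain G where G: "\<And>x. x \<in> {0..1} \<Longrightarrow> g x = G (dyadic_index 0 x)"
    using dyadic_step_obtain[OF 0] by blast
  have "g x = G 0" if "x \<in> {0..1}" for x
    using dyadic_index_less[OF that, of 0] G[OF that] by simp
  then show ?case by (intro exI[of _ "\<lambda>m. G 0"]) simp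
next
  case (Suc n)
  obtain G where G: "\<And>x. x \<in> {0..1} \<Longrightarrow> g x = G (dyadic_index (Suc n) x)"
    using dyadic_step_obtain[OF Suc.prems] by blast
  define A B where "A x = (G (2 * dyadic_index n x) + G (2 * dyadic_index n x + 1)) / 2"
    and "B x = (G (2 * dyadic_index n x) - G (2 * dyadic_index n x + 1)) / 2" for x
  have "dyadic_step n A" "dyadic_step n B"
    unfolding A_def[abs_def] B_def[abs_def]
    by (rule dyadic_step_index[of n "\<lambda>i. (G (2 * i) + G (2 * i + 1)) / 2"],
        rule dyadic_step_index[of n "\<lambda>i. (G (2 * i) - G (2 * i + 1)) / 2"])
  then obtain c d where c: "\<And>x. x \<in> {0..1} \<Longrightarrow> A x = (\<Sum>m<2 ^ n. c m * walsh m x)"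
    and d: "\<And>x. x \<in> {0..1} \<Longrightarrow> B x = (\<Sum>m<2 ^ n. d m * walsh m x)"
    using Suc.IH by metis
  define e where "e m = (if m < 2 ^ n then c m else d (m - 2 ^ n))" for m
  have "g x = (\<Sum>m<2 ^ Suc n. e m * walsh m x)" if x: "x \<in> {0..1}" for x
  proof -
    define i where "i = dyadic_index (Suc n) x"
    have i: "dyadic_index n x = i div 2"
      using x dyadic_index_div2[of x n] by (simp add: i_def)
    have "g x = A x + of_real (rademacher n x) * B x"
    proof (cases "even i")
      case True
      then show ?thesis using G[OF x] i unfolding A_def B_def rademacher_def i_def[symmetric]
        by (simp add: add_divide_distrib[symmetric])
    next
      case False
      then have "Suc (2 * (i div 2)) = i" by presburger
      then show ?thesis using G[OF x] i False unfolding A_def B_def rademacher_def i_def[symmetric]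
        by (simp add: field_simps)
    qed
    also have "\<dots> = (\<Sum>m<2 ^ Suc n. e m * walsh m x)"
      unfolding walsh_sum_split using c[OF x] d[OF x] by (simp add: e_def)
    finally show ?thesis .
  qed
  then show ?case by blast
qed

lemma Lp_norm_tendsto_0:
  assumes p: "0 < p" and meas: "\<And>n. g n \<in> borel_measurable unit_lebesgue"
    and w: "integrable unit_lebesgue w" and le: "\<And>n x. x \<in> {0..1} \<Longrightarrow> norm (g n x) powr p \<le> w x"
    and lim: "AE x in unit_lebesgue. (\<lambda>n. g n x) \<longlonglongrightarrow> 0"
  shows "(\<lambda>n. Lp_norm p (g n)) \<longlonglongrightarrow> 0"
proof -
  have "(\<lambda>n. LINT x|unit_lebesgue. norm (g n x) powr p) \<longlonglongrightarrow> (LINT x|unit_lebesgue. 0)"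
  proof (rule integral_dominated_convergence[where w = w])
    show "(\<lambda>x. norm (g n x) powr p) \<in> borel_measurable unit_lebesgue" for n
      using meas by measurable
    show "AE x in unit_lebesgue. (\<lambda>n. norm (g n x) powr p) \<longlonglongrightarrow> 0"
      using lim
    proof eventually_elim
      case (elim x)
      have "(\<lambda>n. norm (g n x) powr p) \<longlonglongrightarrow> 0 powr p"
        using p tendsto_norm_zero[OF elim] by (intro tendsto_powr') auto
      then show ?case by simp
    qed
  qed (use w le in auto)
  then have "(\<lambda>n. (LINT x|unit_lebesgue. norm (g n x) powr p) powr (1 / p)) \<longlonglongrightarrow> 0 powr (1 / p)"
    using p by (intro tendsto_powr') auto
  then show ?thesis by (simp add: Lp_norm_def)
qed

text \<open>
  A measurable function is almost everywhere a limit of continuous functions. These need not be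
  dominated, so \<open>f\<close> is first replaced by its truncation to a disc of large radius. Projection to the disc
  is continuous and can then be applied to the approximating functions as well, which makes them bounded.
\<close>
lemma continuous_functions_dense_Lp:
  assumes p: "1 \<le> p" and f: "f \<in> Lp_space p" and e: "0 < e"
  shows "\<exists>g. continuous_on UNIV g \<and> g \<in> Lp_space p \<and> Lp_norm p (\<lambda>x. f x - g x) < e"
proof -
  define T :: "nat \<Rightarrow> complex \<Rightarrow> complex" where "T K = closest_point (cball 0 (real K))" for K
  have Tcont: "continuous_on UNIV (T K)" for K
    unfolding T_def by (rule continuous_on_closest_point) auto
  then have Tmeas [measurable]: "T K \<in> borel_measurable borel" for K
    by (rule borel_measurable_continuous_onI)
  have Tbound: "norm (T K z) \<le> real K" for K z
    using closest_point_in_set[of "cball 0 (real K)" z] by (auto simp: T_def)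
  have Tdist: "norm (z - T K z) \<le> norm z" for K z
    using closest_point_le[of "cball 0 (real K)" 0 z] by (simp add: T_def dist_norm)
  have Tself: "T K z = z" if "norm z \<le> real K" for K z
    using that by (auto simp: T_def intro: closest_point_self)
  have fm [measurable]: "f \<in> borel_measurable unit_lebesgue" using f by (rule Lp_space_measurable)
  have "(\<lambda>K. Lp_norm p (\<lambda>x. f x - T K (f x))) \<longlonglongrightarrow> 0"
  proof (rule Lp_norm_tendsto_0[where w = "\<lambda>x. norm (f x) powr p"])
    show "(\<lambda>x. f x - T K (f x)) \<in> borel_measurable unit_lebesgue" for K by measurable
    show "AE x in unit_lebesgue. (\<lambda>K. f x - T K (f x)) \<longlonglongrightarrow> 0"
    proof (rule AE_I2)
      fix x
      have "eventually (\<lambda>K. f x - T K (f x) = 0) sequentially"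
        using eventually_ge_at_top[of "nat \<lceil>norm (f x)\<rceil>"]
        by eventually_elim (simp add: Tself nat_le_iff ceiling_le_iff)
      then show "(\<lambda>K. f x - T K (f x)) \<longlonglongrightarrow> 0"
        by (rule tendsto_eventually)
    qed
  qed (use p f Tdist in \<open>auto intro!: powr_mono2 dest: Lp_space_integrable\<close>)
  then have "eventually (\<lambda>K. Lp_norm p (\<lambda>x. f x - T K (f x)) < e / 2) sequentially"
    using e by (intro order_tendstoD) auto
  then obtain K where K: "Lp_norm p (\<lambda>x. f x - T K (f x)) < e / 2"
    by (auto simp: eventually_sequentially)
  obtain N g where N: "negligible N" and g: "\<And>n. continuous_on UNIV (g n)"
    and lim: "\<And>x. x \<notin> N \<Longrightarrow> (\<lambda>n. g n x) \<longlonglongrightarrow> (if x \<in> {0..1} then f x else 0)"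
    using fm measurable_on_iff_borel_measurable[of "{0..1::real}" f] unfolding measurable_on_def by auto
  have Tg: "continuous_on UNIV (\<lambda>x. T K (g n x))" for n
    using g continuous_on_compose2[OF Tcont] by auto
  have Tgm: "(\<lambda>x. T K (g n x)) \<in> borel_measurable unit_lebesgue" for n
    using borel_measurable_continuous_onI[OF Tg[of n]]
    by (intro measurable_restrict_space1 measurable_completion) (simp add: measurable_lborel1)
  have "(\<lambda>n. Lp_norm p (\<lambda>x. T K (f x) - T K (g n x))) \<longlonglongrightarrow> 0"
  proof (rule Lp_norm_tendsto_0[where w = "\<lambda>x. (2 * real K) powr p"])
    show "(\<lambda>x. T K (f x) - T K (g n x)) \<in> borel_measurable unit_lebesgue" for n
      using Tgm[of n] by measurable
    show "norm (T K (f x) - T K (g n x)) powr p \<le> (2 * real K) powr p" for n x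
      using p Tbound[of K "f x"] Tbound[of K "g n x"] norm_triangle_ineq4[of "T K (f x)" "T K (g n x)"]
      by (intro powr_mono2) auto
    have "AE x in lebesgue. x \<notin> N"
      using N by (simp add: negligible_iff_null_sets AE_not_in)
    then have "AE x in unit_lebesgue. x \<notin> N"
      by (subst AE_restrict_space_iff) auto
    then show "AE x in unit_lebesgue. (\<lambda>n. T K (f x) - T K (g n x)) \<longlonglongrightarrow> 0"
    proof (rule AE_mp, intro AE_I2 impI)
      fix x assume x: "x \<in> space unit_lebesgue" "x \<notin> N"
      have "(\<lambda>n. g n x) \<longlonglongrightarrow> f x" using lim[OF x(2)] x by simp
      then have "(\<lambda>n. T K (g n x)) \<longlonglongrightarrow> T K (f x)"
        using Tcont by (intro isCont_tendsto_compose[of _ "T K"]) (auto simp: continuous_on_eq_continuous_at)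
      then have "(\<lambda>n. T K (f x) - T K (g n x)) \<longlonglongrightarrow> T K (f x) - T K (f x)"
        by (intro tendsto_intros)
      then show "(\<lambda>n. T K (f x) - T K (g n x)) \<longlonglongrightarrow> 0" by simp
    qed
  qed (use p in auto)
  then have "eventually (\<lambda>n. Lp_norm p (\<lambda>x. T K (f x) - T K (g n x)) < e / 2) sequentially"
    using e by (intro order_tendstoD) auto
  then obtain n where n: "Lp_norm p (\<lambda>x. T K (f x) - T K (g n x)) < e / 2"
    by (auto simp: eventually_sequentially)
  have TfL: "(\<lambda>x. T K (f x)) \<in> Lp_space p" and TgL: "(\<lambda>x. T K (g n x)) \<in> Lp_space p"
    using p Tbound Tgm by (auto intro!: bounded_in_Lp[where B = K])
  have "Lp_norm p (\<lambda>x. (f x - T K (f x)) + (T K (f x) - T K (g n x)))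
      \<le> Lp_norm p (\<lambda>x. f x - T K (f x)) + Lp_norm p (\<lambda>x. T K (f x) - T K (g n x))"
    by (intro Lp_norm_triangle Lp_space_diff p f TfL TgL)
  also have "\<dots> < e" using K n by simp
  finally show ?thesis using Tg TgL by (intro exI[of _ "\<lambda>x. T K (g n x)"]) simp
qed

lemma walsh_sums_dense_Lp:
  assumes p: "1 \<le> p" and f: "f \<in> Lp_space p" and e: "0 < e"
  shows "\<exists>n c. Lp_norm p (\<lambda>x. f x - (\<Sum>m<2 ^ n. c m * walsh m x)) < e"
proof -
  obtain g where g: "continuous_on UNIV g" "g \<in> Lp_space p" "Lp_norm p (\<lambda>x. f x - g x) < e / 2"
    using continuous_functions_dense_Lp[OF p f, of "e / 2"] e by auto
  have "uniformly_continuous_on {0..1} g"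
    by (intro compact_uniformly_continuous continuous_on_subset[OF g(1)]) auto
  then obtain d where d: "0 < d" "\<And>x y. x \<in> {0..1} \<Longrightarrow> y \<in> {0..1} \<Longrightarrow> dist y x < d \<Longrightarrow> dist (g y) (g x) < e / 4"
    unfolding uniformly_continuous_on_def using e by (metis zero_less_divide_iff zero_less_numeral)
  obtain n where n: "(1 / 2) ^ n < d"
    using real_arch_pow_inv[OF d(1), of "1 / 2"] by auto
  define h where "h x = g (real (dyadic_index n x) / 2 ^ n)" for x
  have h: "dyadic_step n h"
    unfolding h_def[abs_def] by (rule dyadic_step_index)
  have close: "norm (g x - h x) \<le> e / 4" if x: "x \<in> {0..1}" for x
  proof (cases "x = 0")
    case False
    with x have "0 < x" by simp
    define i where "i = dyadic_index n x"
    have i: "real i / 2 ^ n < x" "x \<le> real (Suc i) / 2 ^ n"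
      using dyadic_index_eq_iff[OF \<open>0 < x\<close>, of n i] by (auto simp: i_def)
    have "\<bar>x - real i / 2 ^ n\<bar> \<le> (1 / 2) ^ n"
      using i by (simp add: power_divide add_divide_distrib)
    then have "dist x (real i / 2 ^ n) < d" using n by (simp add: dist_real_def)
    moreover have "0 \<le> real i / 2 ^ n" by simp
    then have "real i / 2 ^ n \<in> {0..1}" using i x unfolding atLeastAtMost_iff by linarith
    ultimately show ?thesis using d(2)[of "real i / 2 ^ n" x] x by (simp add: h_def i_def dist_norm)
  qed (use e in \<open>simp add: h_def\<close>)
  obtain c where c: "\<And>x. x \<in> {0..1} \<Longrightarrow> h x = (\<Sum>m<2 ^ n. c m * walsh m x)"
    using dyadic_step_eq_walsh_sum[OF h] by blast
  have hL: "h \<in> Lp_space p" using p by (intro dyadic_step_in_Lp[OF h]) auto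
  have "Lp_norm p (\<lambda>x. g x - h x) \<le> e / 4"
    using p e close by (intro Lp_norm_le_bound Lp_space_measurable[OF Lp_space_diff[OF p g(2) hL]]) auto
  moreover have "Lp_norm p (\<lambda>x. (f x - g x) + (g x - h x)) \<le> Lp_norm p (\<lambda>x. f x - g x) + Lp_norm p (\<lambda>x. g x - h x)"
    by (intro Lp_norm_triangle Lp_space_diff p f hL g)
  ultimately have "Lp_norm p (\<lambda>x. f x - h x) < e" using g(3) e by simp
  also have "Lp_norm p (\<lambda>x. f x - h x) = Lp_norm p (\<lambda>x. f x - (\<Sum>m<2 ^ n. c m * walsh m x))"
    unfolding Lp_norm_def using c by (intro arg_cong2[where f = "(powr)"] Bochner_Integration.integral_cong) auto
  finally show ?thesis by blast
qed

section \<open>Partial sums of Walsh series\<close>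

text \<open>
  This is the smooth form of the concavity behind the theorem of Paley. The hypotheses hold for
  \<open>Q0 t = \<bar>x + t h\<bar>\<^sup>2 + \<delta>\<close> and \<open>Q1 t = Q0 t + \<bar>y + t k\<bar>\<^sup>2\<close> with \<open>\<bar>k\<bar> \<le> \<bar>h\<bar>\<close>. The reason for concavity is that
  for \<open>p \<le> 2\<close> the exponent \<open>p/2 - 1\<close> is nonpositive. Therefore the second derivative of
  \<open>Q1\<^bsup>p/2\<^esup>\<close> is at most a multiple of \<open>\<bar>h\<bar>\<^sup>2 Q1\<^bsup>p/2-1\<^esup> \<le> \<bar>h\<bar>\<^sup>2 Q0\<^bsup>p/2-1\<^esup>\<close>, whereas that of
  \<open>Q0\<^bsup>p/2\<^esup>\<close> is at least \<open>p (p - 1)\<close> times the latter quantity. The factor \<open>2/(p - 1)\<close> makes the second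
  term prevail.
\<close>
lemma quadratic_powr_midpoint_concave:
  fixes a0 b0 c0 a1 b1 c1 p :: real
  defines "Q0 \<equiv> \<lambda>t. a0 + b0 * t + c0 * t\<^sup>2" and "Q1 \<equiv> \<lambda>t. a1 + b1 * t + c1 * t\<^sup>2"
  assumes p: "1 < p" "p \<le> 2"
    and pos: "\<And>t. 0 < Q0 t" and le: "\<And>t. Q0 t \<le> Q1 t"
    and disc: "\<And>t. (b0 + 2 * c0 * t)\<^sup>2 \<le> 4 * c0 * Q0 t" and c: "0 \<le> c0" "c1 \<le> 2 * c0"
  defines "\<phi> \<equiv> \<lambda>t. Q1 t powr (p / 2) - 2 / (p - 1) * Q0 t powr (p / 2)"
  shows "\<phi> 1 + \<phi> (-1) \<le> 2 * \<phi> 0"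
proof -
  define s where "s = p / 2"
  have s: "1 / 2 < s" "s \<le> 1" using p by (auto simp: s_def)
  define K where "K = 2 / (p - 1)"
  have "p - 1 \<noteq> 0" using p by simp
  then have "K * (p - 1) = 2" unfolding K_def times_divide_eq_left by (rule nonzero_mult_div_cancel_right)
  moreover have "p - 1 = 2 * s - 1" by (simp add: s_def)
  ultimately have K: "K * (2 * s - 1) = 2" "0 < K" using p by (simp_all only:) (simp add: K_def)
  define \<phi>' where "\<phi>' t = s * Q1 t powr (s - 1) * (b1 + 2 * c1 * t) - K * (s * Q0 t powr (s - 1) * (b0 + 2 * c0 * t))" for t
  define \<phi>'' where "\<phi>'' t = s * ((s - 1) * Q1 t powr (s - 2) * (b1 + 2 * c1 * t)\<^sup>2 + Q1 t powr (s - 1) * (2 * c1))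
     - K * (s * ((s - 1) * Q0 t powr (s - 2) * (b0 + 2 * c0 * t)\<^sup>2 + Q0 t powr (s - 1) * (2 * c0)))" for t
  have pos1: "0 < Q1 t" for t using pos le by (rule order_less_le_trans)
  have dQ: "(Q0 has_real_derivative b0 + 2 * c0 * t) (at t)" "(Q1 has_real_derivative b1 + 2 * c1 * t) (at t)" for t
    unfolding Q0_def Q1_def by (auto intro!: derivative_eq_intros)
  have dP: "((\<lambda>t. Q0 t powr r) has_real_derivative r * Q0 t powr (r - 1) * (b0 + 2 * c0 * t)) (at t)"
     "((\<lambda>t. Q1 t powr r) has_real_derivative r * Q1 t powr (r - 1) * (b1 + 2 * c1 * t)) (at t)" for r t
    using DERIV_fun_powr[OF dQ(1) pos, of r t] DERIV_fun_powr[OF dQ(2) pos1, of r t] by simp_all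
  have "concave_on UNIV \<phi>"
  proof (rule f''_le0_imp_concave[where f' = \<phi>' and f'' = \<phi>''])
    show "(\<phi> has_real_derivative \<phi>' t) (at t)" for t
      unfolding \<phi>_def \<phi>'_def K_def[symmetric] s_def[symmetric]
      by (intro DERIV_diff DERIV_cmult dP)
    have lin: "((\<lambda>t. b + 2 * c * t) has_real_derivative 2 * c) (at t)" for b c t :: real
      by (auto intro!: derivative_eq_intros)
    show "(\<phi>' has_real_derivative \<phi>'' t) (at t)" for t
      unfolding \<phi>'_def[abs_def] \<phi>''_def
      by (rule derivative_eq_intros dP lin refl)+ (simp add: algebra_simps power2_eq_square)
    fix t
    define R where "R = Q0 t powr (s - 1)"
    have R: "0 < R" using pos[of t] by (simp add: R_def)
    have R1: "Q1 t powr (s - 1) \<le> R"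
      unfolding R_def using s le pos by (intro powr_mono2') auto
    have "Q0 t powr (s - 2) * (b0 + 2 * c0 * t)\<^sup>2 \<le> Q0 t powr (s - 2) * (4 * c0 * Q0 t)"
      by (intro mult_left_mono disc) auto
    also have "\<dots> = 4 * c0 * R"
      using pos[of t] by (simp add: R_def powr_diff power2_eq_square)
    finally have R0: "Q0 t powr (s - 2) * (b0 + 2 * c0 * t)\<^sup>2 \<le> 4 * c0 * R" .
    have "(s - 1) * Q1 t powr (s - 2) * (b1 + 2 * c1 * t)\<^sup>2 \<le> 0"
      using s by (intro mult_nonpos_nonneg) auto
    moreover have "Q1 t powr (s - 1) * (2 * c1) \<le> Q1 t powr (s - 1) * (2 * (2 * c0))"
      using c by (intro mult_left_mono) auto
    moreover have "Q1 t powr (s - 1) * (2 * (2 * c0)) \<le> R * (2 * (2 * c0))"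
      using c R1 by (intro mult_right_mono) auto
    ultimately have u: "(s - 1) * Q1 t powr (s - 2) * (b1 + 2 * c1 * t)\<^sup>2 + Q1 t powr (s - 1) * (2 * c1) \<le> 4 * c0 * R"
      by (simp add: mult_ac)
    have "(s - 1) * (4 * c0 * R) \<le> (s - 1) * (Q0 t powr (s - 2) * (b0 + 2 * c0 * t)\<^sup>2)"
      using s R0 by (intro mult_left_mono_neg) auto
    then have "(2 * s - 1) * (2 * c0 * R) \<le> (s - 1) * Q0 t powr (s - 2) * (b0 + 2 * c0 * t)\<^sup>2 + R * (2 * c0)"
      by (simp add: algebra_simps)
    then have "K * ((2 * s - 1) * (2 * c0 * R)) \<le> K * ((s - 1) * Q0 t powr (s - 2) * (b0 + 2 * c0 * t)\<^sup>2 + R * (2 * c0))"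
      using K by (intro mult_left_mono) auto
    then have "4 * c0 * R \<le> K * ((s - 1) * Q0 t powr (s - 2) * (b0 + 2 * c0 * t)\<^sup>2 + R * (2 * c0))"
      unfolding mult.assoc[symmetric] K by simp
    with u have "s * ((s - 1) * Q1 t powr (s - 2) * (b1 + 2 * c1 * t)\<^sup>2 + Q1 t powr (s - 1) * (2 * c1))
        \<le> s * (K * ((s - 1) * Q0 t powr (s - 2) * (b0 + 2 * c0 * t)\<^sup>2 + R * (2 * c0)))"
      using s by (intro mult_left_mono) auto
    then show "\<phi>'' t \<le> 0"
      unfolding \<phi>''_def R_def by (simp add: mult.left_commute)
  qed auto
  from concave_onD[OF this, of "1/2" 1 "-1"] show ?thesis by simp
qed

text \<open>
  In the application \<open>x\<close> is the value of a Walsh sum and \<open>y\<close> that of its partial sum. The integral of this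
  function cannot increase when a digit is revealed and it is nonpositive at the start, which yields
  the bound for \<open>\<bar>y\<bar>\<^sup>p\<close>.
\<close>
definition burkholder :: "real \<Rightarrow> complex \<Rightarrow> complex \<Rightarrow> real" where
  "burkholder p x y = ((norm x)\<^sup>2 + (norm y)\<^sup>2) powr (p / 2) - 2 / (p - 1) * norm x powr p"

text \<open>
  Since \<open>\<bar>x\<bar>\<^sup>p\<close> is not twice differentiable at \<open>0\<close>, the squares are increased by \<open>\<delta> > 0\<close>, which then
  tends to \<open>0\<close>.
\<close>
lemma burkholder_midpoint:
  assumes p: "1 < p" "p \<le> 2" and k: "norm k \<le> norm h"
  shows "burkholder p (x + h) (y + k) + burkholder p (x - h) (y - k) \<le> 2 * burkholder p x y"
proof -
  define B where "B d x y = ((norm x)\<^sup>2 + (norm y)\<^sup>2 + d) powr (p / 2) - 2 / (p - 1) * ((norm x)\<^sup>2 + d) powr (p / 2)"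
    for d :: real and x y :: complex
  have B: "B d (x + h) (y + k) + B d (x - h) (y - k) \<le> 2 * B d x y" if d: "0 < d" for d
  proof -
    have Q: "(norm (u + of_real t * v))\<^sup>2 = (norm u)\<^sup>2 + 2 * (u \<bullet> v) * t + (norm v)\<^sup>2 * t\<^sup>2" for u v :: complex and t :: real
      unfolding scaleR_conv_of_real[symmetric] power2_norm_eq_inner
      by (simp add: inner_add_left inner_add_right inner_commute power2_eq_square)
    have Qd: "(2 * (u \<bullet> v) + 2 * (norm v)\<^sup>2 * t)\<^sup>2 \<le> 4 * (norm v)\<^sup>2 * (norm (u + of_real t * v))\<^sup>2" for u v :: complex and t :: real
    proof -
      have "2 * (u \<bullet> v) + 2 * (norm v)\<^sup>2 * t = 2 * ((u + of_real t * v) \<bullet> v)"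
        by (simp add: power2_norm_eq_inner inner_add_left scaleR_conv_of_real[symmetric])
      moreover have "((u + of_real t * v) \<bullet> v)\<^sup>2 \<le> (norm (u + of_real t * v) * norm v)\<^sup>2"
        using Cauchy_Schwarz_ineq2[of "u + of_real t * v" v] by (simp add: abs_le_square_iff[symmetric])
      ultimately show ?thesis by (simp add: power_mult_distrib mult_ac)
    qed
    have "norm k ^ 2 \<le> norm h ^ 2" using k by (intro power_mono) auto
    define a0 b0 c0 a1 b1 c1 where "a0 = (norm x)\<^sup>2 + d" "b0 = 2 * (x \<bullet> h)" "c0 = (norm h)\<^sup>2"
      "a1 = (norm x)\<^sup>2 + (norm y)\<^sup>2 + d" "b1 = 2 * (x \<bullet> h) + 2 * (y \<bullet> k)" "c1 = (norm h)\<^sup>2 + (norm k)\<^sup>2"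
    note defs = this
    have Q0: "a0 + b0 * t + c0 * t\<^sup>2 = (norm (x + of_real t * h))\<^sup>2 + d" for t
      unfolding Q defs by (simp add: algebra_simps)
    have Q1: "a1 + b1 * t + c1 * t\<^sup>2 = (norm (x + of_real t * h))\<^sup>2 + (norm (y + of_real t * k))\<^sup>2 + d" for t
      unfolding Q defs by (simp add: algebra_simps)
    have "(\<lambda>t. (a1 + b1 * t + c1 * t\<^sup>2) powr (p / 2) - 2 / (p - 1) * (a0 + b0 * t + c0 * t\<^sup>2) powr (p / 2)) 1 +
       (\<lambda>t. (a1 + b1 * t + c1 * t\<^sup>2) powr (p / 2) - 2 / (p - 1) * (a0 + b0 * t + c0 * t\<^sup>2) powr (p / 2)) (-1)
      \<le> 2 * (\<lambda>t. (a1 + b1 * t + c1 * t\<^sup>2) powr (p / 2) - 2 / (p - 1) * (a0 + b0 * t + c0 * t\<^sup>2) powr (p / 2)) 0"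
    proof (rule quadratic_powr_midpoint_concave[OF p])
      fix t :: real
      show "0 < a0 + b0 * t + c0 * t\<^sup>2" unfolding Q0 using d by (simp add: add_nonneg_pos)
      show "a0 + b0 * t + c0 * t\<^sup>2 \<le> a1 + b1 * t + c1 * t\<^sup>2" unfolding Q0 Q1 by simp
      have "(b0 + 2 * c0 * t)\<^sup>2 \<le> 4 * c0 * (norm (x + of_real t * h))\<^sup>2"
        unfolding defs by (rule Qd)
      also have "\<dots> \<le> 4 * c0 * ((norm (x + of_real t * h))\<^sup>2 + d)"
        using d by (intro mult_left_mono) (auto simp: defs)
      finally show "(b0 + 2 * c0 * t)\<^sup>2 \<le> 4 * c0 * (a0 + b0 * t + c0 * t\<^sup>2)" unfolding Q0 .
    qed (use \<open>norm k ^ 2 \<le> norm h ^ 2\<close> in \<open>auto simp: defs\<close>)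
    then show ?thesis
      unfolding Q0 Q1 B_def by simp
  qed
  have lim: "((\<lambda>d. B d u v) \<longlongrightarrow> burkholder p u v) (at_right 0)" for u v
  proof -
    have "((\<lambda>d. B d u v) \<longlongrightarrow> ((norm u)\<^sup>2 + (norm v)\<^sup>2 + 0) powr (p / 2) - 2 / (p - 1) * ((norm u)\<^sup>2 + 0) powr (p / 2)) (at_right 0)"
      unfolding B_def using p
      by (intro tendsto_intros tendsto_powr' ) (auto simp: eventually_at_right_field intro!: exI[of _ 1])
    also have "(norm u)\<^sup>2 powr (p / 2) = norm u powr p"
      by (cases "u = 0") (simp_all add: powr_powr flip: powr_numeral)
    then have "((norm u)\<^sup>2 + (norm v)\<^sup>2 + 0) powr (p / 2) - 2 / (p - 1) * ((norm u)\<^sup>2 + 0) powr (p / 2) = burkholder p u v"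
      by (simp add: burkholder_def)
    finally show ?thesis .
  qed
  show ?thesis
  proof (rule tendsto_le)
    show "((\<lambda>d. B d (x + h) (y + k) + B d (x - h) (y - k)) \<longlongrightarrow> burkholder p (x + h) (y + k) + burkholder p (x - h) (y - k)) (at_right 0)"
      by (intro tendsto_add lim)
    show "((\<lambda>d. 2 * B d x y) \<longlongrightarrow> 2 * burkholder p x y) (at_right 0)"
      by (intro tendsto_mult tendsto_const lim)
    show "eventually (\<lambda>d. B d (x + h) (y + k) + B d (x - h) (y - k) \<le> 2 * B d x y) (at_right 0)"
      using B by (auto simp: eventually_at_right_field intro!: exI[of _ 1])
  qed auto
qed

lemma burkholder_nonpos:
  assumes p: "1 < p" "p \<le> 2" and le: "norm y \<le> norm x"
  shows "burkholder p x y \<le> 0"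
proof -
  have "(norm y)\<^sup>2 \<le> (norm x)\<^sup>2" using le by (intro power_mono) auto
  then have "((norm x)\<^sup>2 + (norm y)\<^sup>2) powr (p / 2) \<le> (2 * (norm x)\<^sup>2) powr (p / 2)"
    using p by (intro powr_mono2) auto
  also have "\<dots> = 2 powr (p / 2) * norm x powr p"
    by (cases "x = 0") (simp_all add: powr_mult powr_powr flip: powr_numeral)
  also have "2 powr (p / 2) \<le> (2::real) powr 1"
    using p by (intro powr_mono) auto
  also have "(2::real) powr 1 \<le> 2 / (p - 1)"
    using p by (simp add: field_simps)
  finally show ?thesis by (simp add: burkholder_def mult_right_mono)
qed

lemma norm_powr_le_burkholder:
  assumes "0 < p"
  shows "norm y powr p \<le> burkholder p x y + 2 / (p - 1) * norm x powr p"
proof -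
  have "norm y powr p = ((norm y)\<^sup>2) powr (p / 2)"
    by (cases "y = 0") (simp_all add: powr_powr flip: powr_numeral)
  also have "\<dots> \<le> ((norm x)\<^sup>2 + (norm y)\<^sup>2) powr (p / 2)"
    using assms by (intro powr_mono2) auto
  finally show ?thesis by (simp add: burkholder_def)
qed

text \<open>
  Induction on the level, splitting off the last sign. Write the sum as \<open>A + r D\<close> with the sign \<open>r\<close>.
  If \<open>N \<le> 2\<^sup>n\<close> the partial sum is a partial sum \<open>S\<close> of \<open>A\<close>, and averaging over \<open>r\<close> moves only the first
  argument away from \<open>(A, S)\<close>. Otherwise the partial sum is \<open>A + r S\<close> with a partial sum \<open>S\<close> of \<open>D\<close>.
  Multiplied by \<open>r\<close>, which does not change absolute values, the pair becomes \<open>(D, S)\<close> moved by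
  \<open>r A\<close> in both arguments. In both cases the midpoint inequality reduces the claim to the level \<open>n\<close>.
\<close>
lemma LINT_burkholder_walsh_nonpos:
  assumes p: "1 < p" "p \<le> 2" and N: "N \<le> 2 ^ n"
  shows "(LINT x|unit_lebesgue. burkholder p (\<Sum>m<2 ^ n. c m * walsh m x) (\<Sum>m<N. c m * walsh m x)) \<le> 0"
  using N
proof (induction n arbitrary: c N)
  case 0
  then consider "N = 0" | "N = 1" by (metis One_nat_def le_Suc_eq le_zero_eq power_0)
  then have *: "norm (\<Sum>m<N. c m * walsh m x) \<le> norm (\<Sum>m<2 ^ 0. c m * walsh m x)" for x
    by cases auto
  have **: "integrable unit_lebesgue (\<lambda>x. burkholder p (\<Sum>m<2 ^ 0. c m * walsh m x) (\<Sum>m<N. c m * walsh m x))"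
    by (intro dyadic_step_integrable[of 0] dyadic_step_comp2[where F = "burkholder p"] dyadic_step_walsh_sum) (use 0 in auto)
  have "(LINT x|unit_lebesgue. burkholder p (\<Sum>m<2 ^ 0. c m * walsh m x) (\<Sum>m<N. c m * walsh m x)) \<le> (LINT x|unit_lebesgue. 0)"
    by (intro integral_mono ** burkholder_nonpos[OF p] *) simp
  then show ?case by simp
next
  case (Suc n)
  define A where "A x = (\<Sum>m<2 ^ n. c m * walsh m x)" for x
  define D where "D x = (\<Sum>m<2 ^ n. c (2 ^ n + m) * walsh m x)" for x
  have stepA: "dyadic_step n A" and stepD: "dyadic_step n D"
    unfolding A_def[abs_def] D_def[abs_def] by (rule dyadic_step_walsh_sum; simp)+
  have reduce: "(LINT x|unit_lebesgue. burkholder p (\<Sum>m<2 ^ Suc n. c m * walsh m x) (\<Sum>m<N. c m * walsh m x)) \<le> 0"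
    if E: "\<And>x. (\<Sum>m<N. c m * walsh m x) = U x + of_real (rademacher n x) * V x"
      and U: "dyadic_step n U" and V: "dyadic_step n V" and P: "dyadic_step n P" and R: "dyadic_step n R"
      and mid: "\<And>x. burkholder p (A x + D x) (U x + V x) + burkholder p (A x - D x) (U x - V x) \<le> 2 * burkholder p (P x) (R x)"
      and le: "(LINT x|unit_lebesgue. burkholder p (P x) (R x)) \<le> 0" for U V P R
  proof -
    define F where "F s x = burkholder p (A x + of_real s * D x) (U x + of_real s * V x)" for s x
    have F: "dyadic_step n (F s)" for s
      unfolding F_def[abs_def]
      by (intro dyadic_step_comp2[where F = "burkholder p"] dyadic_step_comp2[where F = "\<lambda>a b. a + of_real s * b"] stepA stepD U V)
    have "(LINT x|unit_lebesgue. burkholder p (\<Sum>m<2 ^ Suc n. c m * walsh m x) (\<Sum>m<N. c m * walsh m x))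
        = (LINT x|unit_lebesgue. F (rademacher n x) x)"
      unfolding walsh_sum_split E F_def A_def D_def ..
    also have "\<dots> = (LINT x|unit_lebesgue. (1/2) *\<^sub>R (F 1 x + F (-1) x))"
      by (rule LINT_average_over_sign[OF F])
    also have "\<dots> \<le> (LINT x|unit_lebesgue. burkholder p (P x) (R x))"
    proof (rule integral_mono)
      show "integrable unit_lebesgue (\<lambda>x. (1/2) *\<^sub>R (F 1 x + F (-1) x))"
        by (intro dyadic_step_integrable[of n] dyadic_step_comp2[where F = "\<lambda>a b. (1/2) *\<^sub>R (a + b)"] F)
      show "integrable unit_lebesgue (\<lambda>x. burkholder p (P x) (R x))"
        by (intro dyadic_step_integrable[of n] dyadic_step_comp2[where F = "burkholder p"] P R)
      show "(1/2) *\<^sub>R (F 1 x + F (-1) x) \<le> burkholder p (P x) (R x)" for x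
        using mid[of x] by (simp add: F_def)
    qed
    finally show ?thesis using le by simp
  qed
  show ?case
  proof (cases "N \<le> 2 ^ n")
    case True
    define S where "S x = (\<Sum>m<N. c m * walsh m x)" for x
    have S: "dyadic_step n S" unfolding S_def[abs_def] using True by (intro dyadic_step_walsh_sum) auto
    show ?thesis
    proof (rule reduce[of S "\<lambda>x. 0" A S])
      show "burkholder p (A x + D x) (S x + 0) + burkholder p (A x - D x) (S x - 0) \<le> 2 * burkholder p (A x) (S x)" for x
        by (rule burkholder_midpoint[OF p]) simp
    qed (use S stepA Suc.IH[OF True, of c] in \<open>auto simp: S_def A_def\<close>)
  next
    case False
    define M where "M = N - 2 ^ n"
    have M: "N = 2 ^ n + M" "M \<le> 2 ^ n" using False Suc.prems by (auto simp: M_def)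
    define S where "S x = (\<Sum>m<M. c (2 ^ n + m) * walsh m x)" for x
    have S: "dyadic_step n S" unfolding S_def[abs_def] using M by (intro dyadic_step_walsh_sum) auto
    show ?thesis
    proof (rule reduce[of A S D S])
      fix x
      have "(\<Sum>m<M. c (2 ^ n + m) * walsh (2 ^ n + m) x) = (\<Sum>m<M. of_real (rademacher n x) * (c (2 ^ n + m) * walsh m x))"
        using M by (intro sum.cong) (auto simp: walsh_top mult_ac)
      then show "(\<Sum>m<N. c m * walsh m x) = A x + of_real (rademacher n x) * S x"
        unfolding M(1) sum_lessThan_add A_def S_def by (simp add: sum_distrib_left)
      have sym: "burkholder p (A x - D x) (A x - S x) = burkholder p (D x - A x) (S x - A x)"
        by (simp add: burkholder_def norm_minus_commute)
      have "burkholder p (D x + A x) (S x + A x) + burkholder p (D x - A x) (S x - A x) \<le> 2 * burkholder p (D x) (S x)"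
        by (rule burkholder_midpoint[OF p]) simp
      then show "burkholder p (A x + D x) (A x + S x) + burkholder p (A x - D x) (A x - S x) \<le> 2 * burkholder p (D x) (S x)"
        unfolding sym by (simp add: add.commute)
    qed (use S stepA stepD Suc.IH[OF M(2), of "\<lambda>m. c (2 ^ n + m)"] in \<open>auto simp: S_def D_def\<close>)
  qed
qed

lemma walsh_partial_sum_le_small_p:
  assumes p: "1 < p" "p \<le> 2" and N: "N \<le> 2 ^ n"
  shows "Lp_norm p (\<lambda>x. \<Sum>m<N. c m * walsh m x)
    \<le> (2 / (p - 1)) powr (1 / p) * Lp_norm p (\<lambda>x. \<Sum>m<2 ^ n. c m * walsh m x)"
proof -
  let ?f = "\<lambda>x. \<Sum>m<2 ^ n. c m * walsh m x" and ?g = "\<lambda>x. \<Sum>m<N. c m * walsh m x"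
  have f: "dyadic_step n ?f" and g: "dyadic_step n ?g"
    using N by (auto intro!: dyadic_step_walsh_sum)
  have int: "integrable unit_lebesgue (\<lambda>x. burkholder p (?f x) (?g x))" "integrable unit_lebesgue (\<lambda>x. norm (?f x) powr p)"
     "integrable unit_lebesgue (\<lambda>x. norm (?g x) powr p)"
    by (intro dyadic_step_integrable[of n] dyadic_step_comp2[where F = "burkholder p"] dyadic_step_comp[where F = "\<lambda>z. norm z powr p"] f g)+
  have "(LINT x|unit_lebesgue. norm (?g x) powr p) \<le> (LINT x|unit_lebesgue. burkholder p (?f x) (?g x) + 2 / (p - 1) * norm (?f x) powr p)"
    using p int by (intro integral_mono norm_powr_le_burkholder) auto
  also have "\<dots> = (LINT x|unit_lebesgue. burkholder p (?f x) (?g x)) + 2 / (p - 1) * (LINT x|unit_lebesgue. norm (?f x) powr p)"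
    using int by simp
  also have "\<dots> \<le> 2 / (p - 1) * (LINT x|unit_lebesgue. norm (?f x) powr p)"
    using LINT_burkholder_walsh_nonpos[OF p N, of c] by simp
  also have "\<dots> = ((2 / (p - 1)) powr (1 / p) * Lp_norm p ?f) powr p"
    using p by (simp add: powr_mult powr_powr Lp_norm_powr)
  finally show ?thesis using p by (subst Lp_norm_le_iff) auto
qed

text \<open>
  Duality. Partial sums are self-adjoint, and the norm of the partial sum \<open>h\<close> is attained on the
  function \<open>cnj h \<bar>h\<bar>\<^bsup>p-2\<^esup>\<close>, which is again a step function and hence a Walsh sum.
\<close>
lemma walsh_partial_sum_le_large_p:
  assumes p: "2 \<le> p" and q: "1 / p + 1 / q = 1" and N: "N \<le> 2 ^ n"
  shows "Lp_norm p (\<lambda>x. \<Sum>m<N. c m * walsh m x)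
    \<le> (2 / (q - 1)) powr (1 / q) * Lp_norm p (\<lambda>x. \<Sum>m<2 ^ n. c m * walsh m x)"
proof -
  let ?f = "\<lambda>x. \<Sum>m<2 ^ n. c m * walsh m x" and ?h = "\<lambda>x. \<Sum>m<N. c m * walsh m x"
  have q_eq: "q = p / (p - 1)" using p q by (cases "q = 0") (auto simp: field_simps)
  have q12: "1 < q" "q \<le> 2" using p by (auto simp: q_eq field_simps)
  have pq: "(p - 1) * q = p" "p / q = p - 1" using p by (auto simp: q_eq)
  define C where "C = (2 / (q - 1)) powr (1 / q)"
  define g where "g x = cnj (?h x) * of_real (norm (?h x) powr (p - 2))" for x
  have f: "dyadic_step n ?f" and h: "dyadic_step n ?h"
    using N by (auto intro!: dyadic_step_walsh_sum)
  have "dyadic_step n g"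
    unfolding g_def[abs_def] by (rule dyadic_step_comp[OF h])
  then obtain d where d: "\<And>x. x \<in> {0..1} \<Longrightarrow> g x = (\<Sum>m<2 ^ n. d m * walsh m x)"
    using dyadic_step_eq_walsh_sum by blast
  let ?g = "\<lambda>x. \<Sum>m<2 ^ n. d m * walsh m x" and ?G = "\<lambda>x. \<Sum>m<N. d m * walsh m x"
  have G: "dyadic_step n ?G" using N by (intro dyadic_step_walsh_sum) auto
  have hg: "?h x * g x = of_real (norm (?h x) powr p)" for x
  proof -
    have "?h x * g x = of_real ((norm (?h x))\<^sup>2 * norm (?h x) powr (p - 2))"
      by (simp add: g_def complex_norm_square mult.assoc[symmetric] del: of_real_power)
    also have "(norm (?h x))\<^sup>2 * norm (?h x) powr (p - 2) = norm (?h x) powr p"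
      by (cases "?h x = 0") (simp_all add: powr_add[symmetric] flip: powr_numeral)
    finally show ?thesis .
  qed
  have ng: "norm (g x) powr q = norm (?h x) powr p" for x
  proof (cases "?h x = 0")
    case False
    have "norm (g x) = norm (?h x) powr 1 * norm (?h x) powr (p - 2)"
      unfolding g_def norm_mult complex_mod_cnj by simp
    also have "\<dots> = norm (?h x) powr (p - 1)" by (simp add: powr_mult_base)
    finally show ?thesis by (simp add: powr_powr pq)
  qed (simp add: g_def)
  have "Lp_norm q ?g powr q = (LINT x|unit_lebesgue. norm (g x) powr q)"
    using q12 by (subst Lp_norm_powr) (auto intro!: Bochner_Integration.integral_cong simp: d)
  also have "\<dots> = Lp_norm p ?h powr p"
    using p unfolding ng by (simp add: Lp_norm_powr)
  finally have "(Lp_norm q ?g powr q) powr (1 / q) = (Lp_norm p ?h powr p) powr (1 / q)" by simp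
  then have normg: "Lp_norm q ?g = Lp_norm p ?h powr (p - 1)"
    using q12 by (simp add: powr_powr pq)
  have "Lp_norm p ?h powr p = norm (of_real (LINT x|unit_lebesgue. norm (?h x) powr p) :: complex)"
    using p by (simp add: Lp_norm_powr)
  also have "complex_of_real (LINT x|unit_lebesgue. norm (?h x) powr p) = (LINT x|unit_lebesgue. ?h x * ?g x)"
    unfolding integral_complex_of_real[symmetric] hg[symmetric]
    by (intro Bochner_Integration.integral_cong) (auto simp: d)
  also have "\<dots> = (LINT x|unit_lebesgue. ?f x * ?G x)"
    using N by (simp add: walsh.LINT_sums_mult Int_absorb1 Int_absorb2)
  also have "norm \<dots> \<le> Lp_norm p ?f * Lp_norm q ?G"
    using p q12 q by (intro Hoelder_inequality dyadic_step_in_Lp[OF f] dyadic_step_in_Lp[OF G]) auto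
  also have "\<dots> \<le> Lp_norm p ?f * (C * Lp_norm q ?g)"
    unfolding C_def by (intro mult_left_mono walsh_partial_sum_le_small_p q12 N) auto
  finally have main: "Lp_norm p ?h powr p \<le> C * Lp_norm p ?f * Lp_norm p ?h powr (p - 1)"
    by (simp add: normg mult_ac)
  show ?thesis
  proof (cases "Lp_norm p ?h = 0")
    case False
    then have pos: "0 < Lp_norm p ?h" using Lp_norm_nonneg[of p ?h] by linarith
    have "Lp_norm p ?h powr p = Lp_norm p ?h * Lp_norm p ?h powr (p - 1)"
      using powr_mult_base[of "Lp_norm p ?h" "p - 1"] by simp
    with main pos show ?thesis by (simp add: C_def)
  qed simp
qed

text \<open>
  The theorem of Paley. Walsh sums are dense, and a single partial sum operator is continuous with a
  norm that may depend on \<open>N\<close>, so the uniform bound extends from Walsh sums to all of \<open>L\<^sub>p\<close>.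
\<close>
theorem walsh_partial_sum_bounded:
  assumes p: "1 < p"
  shows "\<exists>C\<ge>0. \<forall>f\<in>Lp_space p. \<forall>N. Lp_norm p (\<lambda>x. \<Sum>m<N. fourier_coeff walsh f m * walsh m x) \<le> C * Lp_norm p f"
proof -
  obtain q where q: "1 < q" "1 / p + 1 / q = 1" using conjugate_exponent[OF p] .
  define C where "C = (if p \<le> 2 then (2 / (p - 1)) powr (1 / p) else (2 / (q - 1)) powr (1 / q))"
  have C0: "0 \<le> C" by (simp add: C_def)
  have poly: "Lp_norm p (\<lambda>x. \<Sum>m<N. c m * walsh m x) \<le> C * Lp_norm p (\<lambda>x. \<Sum>m<2 ^ n. c m * walsh m x)"
    if "N \<le> 2 ^ n" for N n c
    using walsh_partial_sum_le_small_p[of p N n c] walsh_partial_sum_le_large_p[of p q N n c] that p q by (simp add: C_def)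
  have "Lp_norm p (\<lambda>x. \<Sum>m<N. fourier_coeff walsh f m * walsh m x) \<le> C * Lp_norm p f" if f: "f \<in> Lp_space p" for f N
  proof (rule field_le_epsilon)
    fix e :: real assume e: "0 < e"
    \<comment> \<open>An error of \<open>d\<close> in the approximation enters \<open>C\<close> times through the norm of the approximating sum
       and \<open>N\<close> times through the individual coefficients.\<close>
    define d where "d = e / (C + N + 1)"
    have d: "0 < d" "(C + N) * d \<le> e"
      using e C0 by (auto simp: d_def field_simps)
    obtain n c where c: "Lp_norm p (\<lambda>x. f x - (\<Sum>m<2 ^ n. c m * walsh m x)) < d"
      using walsh_sums_dense_Lp[OF _ f d(1)] p by auto
    define a where "a m = (if m < 2 ^ n then c m else 0)" for m
    define k where "k = max n N"
    have Nk: "N \<le> 2 ^ k" and nk: "(2::nat) ^ n \<le> 2 ^ k"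
      using order.trans[OF _ less_imp_le[OF less_exp], of N k] by (auto simp: k_def)
    define g where "g x = (\<Sum>m<2 ^ k. a m * walsh m x)" for x
    have g_eq: "g x = (\<Sum>m<2 ^ n. c m * walsh m x)" for x
      unfolding g_def using nk by (intro sum.mono_neutral_cong_right) (auto simp: a_def)
    have g: "g \<in> Lp_space p" unfolding g_def[abs_def] using p by (intro walsh.sum_in_Lp) auto
    have fg: "(\<lambda>x. f x - g x) \<in> Lp_space p" using p by (intro Lp_space_diff f g) auto
    have small: "Lp_norm p (\<lambda>x. f x - g x) \<le> d" using c unfolding g_eq by simp
    have "(\<lambda>x. \<Sum>m<N. fourier_coeff walsh f m * walsh m x)
       = (\<lambda>x. (\<Sum>m<N. a m * walsh m x) + (\<Sum>m<N. fourier_coeff walsh (\<lambda>x. f x - g x) m * walsh m x))"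
    proof
      fix x
      have "fourier_coeff walsh f m = a m + fourier_coeff walsh (\<lambda>x. f x - g x) m" if "m < N" for m
        using that Nk unfolding walsh.coeff_diff[OF p f g] by (simp add: g_def[abs_def] walsh.coeff_sum)
      then show "(\<Sum>m<N. fourier_coeff walsh f m * walsh m x)
         = (\<Sum>m<N. a m * walsh m x) + (\<Sum>m<N. fourier_coeff walsh (\<lambda>x. f x - g x) m * walsh m x)"
        by (simp add: sum.distrib[symmetric] distrib_right)
    qed
    then have "Lp_norm p (\<lambda>x. \<Sum>m<N. fourier_coeff walsh f m * walsh m x)
       \<le> Lp_norm p (\<lambda>x. \<Sum>m<N. a m * walsh m x) + Lp_norm p (\<lambda>x. \<Sum>m<N. fourier_coeff walsh (\<lambda>x. f x - g x) m * walsh m x)"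
      using p by (simp only:) (intro Lp_norm_triangle walsh.sum_in_Lp; simp)
    also have "Lp_norm p (\<lambda>x. \<Sum>m<N. a m * walsh m x) \<le> C * Lp_norm p g"
      unfolding g_def[abs_def] by (rule poly[OF Nk])
    also have "C * Lp_norm p g \<le> C * (Lp_norm p f + d)"
    proof -
      have "Lp_norm p (\<lambda>x. f x - (f x - g x)) \<le> Lp_norm p f + Lp_norm p (\<lambda>x. f x - g x)"
        using p by (intro Lp_norm_triangle_diff f fg) auto
      then show ?thesis using small C0 by (intro mult_left_mono) auto
    qed
    also have "Lp_norm p (\<lambda>x. \<Sum>m<N. fourier_coeff walsh (\<lambda>x. f x - g x) m * walsh m x)
       \<le> (\<Sum>m<N. norm (fourier_coeff walsh (\<lambda>x. f x - g x) m)) * 1"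
      using p by (intro walsh.Lp_norm_sum_le_l1) auto
    also have "\<dots> \<le> (\<Sum>m<N. d) * 1"
      using order.trans[OF walsh.norm_coeff_le[OF p fg] ] small by (intro mult_right_mono sum_mono) auto
    finally show "Lp_norm p (\<lambda>x. \<Sum>m<N. fourier_coeff walsh f m * walsh m x) \<le> C * Lp_norm p f + e"
      using C0 d by (simp add: algebra_simps)
  qed
  then show ?thesis using C0 by blast
qed

section \<open>Rademacher sums\<close>

lemma tanh_real_le_self: "0 \<le> x \<Longrightarrow> tanh x \<le> (x :: real)"
proof -
  assume x: "0 \<le> x"
  have "(\<lambda>x. x - tanh x) 0 \<le> (\<lambda>x. x - tanh x) x"
  proof (rule DERIV_nonneg_imp_nondecreasing[OF x])
    fix y :: real
    have "((\<lambda>x. x - tanh x) has_real_derivative 1 - (1 - (tanh y)\<^sup>2)) (at y)"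
      by (auto intro!: derivative_eq_intros simp: less_imp_neq[symmetric])
    then show "\<exists>z. ((\<lambda>x. x - tanh x) has_real_derivative z) (at y) \<and> 0 \<le> z" by force
  qed
  then show ?thesis by simp
qed

lemma cosh_le_exp_half_square: "cosh (x :: real) \<le> exp (x\<^sup>2 / 2)"
proof -
  have *: "cosh x \<le> exp (x\<^sup>2 / 2)" if x: "0 \<le> x" for x :: real
  proof -
    have "(\<lambda>x. x\<^sup>2 / 2 - ln (cosh x)) 0 \<le> (\<lambda>x. x\<^sup>2 / 2 - ln (cosh x)) x"
    proof (rule DERIV_nonneg_imp_nondecreasing[OF x])
      fix y :: real assume "0 \<le> y"
      have "((\<lambda>x. x\<^sup>2 / 2 - ln (cosh x)) has_real_derivative y - tanh y) (at y)"
        by (auto intro!: derivative_eq_intros simp: tanh_def)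
      then show "\<exists>z. ((\<lambda>x. x\<^sup>2 / 2 - ln (cosh x)) has_real_derivative z) (at y) \<and> 0 \<le> z"
        using tanh_real_le_self[OF \<open>0 \<le> y\<close>] by force
    qed
    then have "exp (ln (cosh x)) \<le> exp (x\<^sup>2 / 2)"
      unfolding exp_le_cancel_iff by simp
    then show ?thesis by (simp only: exp_ln cosh_real_pos)
  qed
  show ?thesis using *[of "\<bar>x\<bar>"] by (cases "0 \<le> x") (auto simp: cosh_minus[of x, symmetric] simp del: cosh_minus)
qed

lemma LINT_exp_rademacher_sum_le:
  fixes b :: "nat \<Rightarrow> real"
  shows "(LINT x|unit_lebesgue. exp (\<Sum>j<n. b j * rademacher j x)) \<le> exp ((\<Sum>j<n. (b j)\<^sup>2) / 2)"
proof (induction n)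
  case (Suc n)
  define A where "A x = (\<Sum>j<n. b j * rademacher j x)" for x
  have A: "dyadic_step n A"
    unfolding A_def[abs_def]
    by (intro dyadic_step_sum dyadic_step_comp[where F = "\<lambda>z. _ * z"] dyadic_step_rademacher) simp
  have "(LINT x|unit_lebesgue. exp (\<Sum>j<Suc n. b j * rademacher j x))
      = (LINT x|unit_lebesgue. (\<lambda>s x. exp (A x + b n * s)) (rademacher n x) x)"
    by (simp add: A_def)
  also have "\<dots> = (LINT x|unit_lebesgue. (1/2) *\<^sub>R ((\<lambda>s x. exp (A x + b n * s)) 1 x + (\<lambda>s x. exp (A x + b n * s)) (-1) x))"
    by (rule LINT_average_over_sign) (rule dyadic_step_comp[OF A])
  also have "\<dots> = (LINT x|unit_lebesgue. cosh (b n) * exp (A x))"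
    by (intro Bochner_Integration.integral_cong) (auto simp: cosh_def exp_add exp_diff exp_minus field_simps)
  also have "\<dots> = cosh (b n) * (LINT x|unit_lebesgue. exp (A x))" by simp
  also have "\<dots> \<le> exp ((b n)\<^sup>2 / 2) * exp ((\<Sum>j<n. (b j)\<^sup>2) / 2)"
    using Suc by (intro mult_mono cosh_le_exp_half_square) (auto simp: A_def)
  finally show ?case by (simp add: exp_add[symmetric] add_divide_distrib add.commute)
qed simp

text \<open>
  For coefficients normalised to \<open>\<ell>\<^sub>2\<close>-norm \<open>1\<close> the exponential moments of the sum and of its negative
  are at most \<open>e\<^bsup>1/2\<^esup>\<close>, and they dominate all powers: \<open>\<bar>t\<bar>/q \<le> e\<^bsup>\<bar>t\<bar>/q\<^esup>\<close> gives
  \<open>\<bar>t\<bar>\<^sup>q \<le> q\<^sup>q e\<^bsup>\<bar>t\<bar>\<^esup>\<close>.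
\<close>
lemma Khintchine_real:
  fixes b :: "nat \<Rightarrow> real"
  assumes q: "1 \<le> q" and J: "finite J"
  shows "Lp_norm q (\<lambda>x. of_real (\<Sum>j\<in>J. b j * rademacher j x))
    \<le> (2 * q powr q * exp (1 / 2)) powr (1 / q) * sqrt (\<Sum>j\<in>J. (b j)\<^sup>2)"
proof -
  define \<sigma> where "\<sigma> = sqrt (\<Sum>j\<in>J. (b j)\<^sup>2)"
  obtain n where n: "J \<subseteq> {..<n}" using finite_nat_bounded[OF J] by blast
  show ?thesis
  proof (cases "\<sigma> = 0")
    case True
    then have "\<forall>j\<in>J. b j = 0"
      using J by (simp add: \<sigma>_def sum_nonneg_eq_0_iff)
    then show ?thesis by simp
  next
    case False
    moreover have "0 \<le> \<sigma>" by (simp add: \<sigma>_def sum_nonneg)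
    ultimately have \<sigma>: "0 < \<sigma>" by simp
    have \<sigma>2: "(\<Sum>j\<in>J. (b j)\<^sup>2) = \<sigma>\<^sup>2" by (simp add: \<sigma>_def sum_nonneg)
    define a where "a j = (if j \<in> J then b j / \<sigma> else 0)" for j
    have a2: "(\<Sum>j<n. (a j)\<^sup>2) = 1"
    proof -
      have "(\<Sum>j<n. (a j)\<^sup>2) = (\<Sum>j\<in>J. (b j)\<^sup>2 / \<sigma>\<^sup>2)"
        using n by (intro sum.mono_neutral_cong_right) (auto simp: a_def power_divide)
      then show ?thesis using \<sigma> by (simp add: sum_divide_distrib[symmetric] \<sigma>2)
    qed
    define y where "y x = (\<Sum>j<n. a j * rademacher j x)" for x
    have y_eq: "(\<Sum>j\<in>J. b j * rademacher j x) = \<sigma> * y x" for x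
      unfolding y_def sum_distrib_left using n \<sigma>
      by (intro sum.mono_neutral_cong_left) (auto simp: a_def)
    have y: "dyadic_step n y"
      unfolding y_def[abs_def]
      by (intro dyadic_step_sum dyadic_step_comp[where F = "\<lambda>z. _ * z"] dyadic_step_rademacher) simp
    have pt: "\<bar>t\<bar> powr q \<le> q powr q * (exp t + exp (- t))" for t :: real
    proof -
      have "\<bar>t\<bar> / q \<le> exp (\<bar>t\<bar> / q)" using exp_ge_add_one_self[of "\<bar>t\<bar> / q"] by linarith
      then have "(\<bar>t\<bar> / q) powr q \<le> exp (\<bar>t\<bar> / q) powr q" using q by (intro powr_mono2) auto
      also have "\<dots> = exp \<bar>t\<bar>" using q by (simp add: exp_powr_real)
      also have "\<dots> \<le> exp t + exp (- t)" by (cases "0 \<le> t") auto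
      finally show ?thesis using q by (simp add: powr_divide pos_divide_le_eq mult.commute)
    qed
    have ex: "(LINT x|unit_lebesgue. exp (y x)) \<le> exp (1 / 2)"
      using LINT_exp_rademacher_sum_le[of a n] by (simp add: a2 y_def)
    have "(\<Sum>j<n. - a j * rademacher j x) = - y x" for x by (simp add: y_def sum_negf)
    then have exm: "(LINT x|unit_lebesgue. exp (- y x)) \<le> exp (1 / 2)"
      using LINT_exp_rademacher_sum_le[of "\<lambda>j. - a j" n] by (simp only: a2 power2_minus)
    have int: "integrable unit_lebesgue (\<lambda>x. \<bar>y x\<bar> powr q)" "integrable unit_lebesgue (\<lambda>x. exp (y x))"
        "integrable unit_lebesgue (\<lambda>x. exp (- y x))"
      by (intro dyadic_step_integrable[of n] dyadic_step_comp[where F = "\<lambda>t. \<bar>t\<bar> powr q"]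
         dyadic_step_comp[where F = exp] dyadic_step_comp[where F = "\<lambda>t. exp (- t)"] y)+
    have "(LINT x|unit_lebesgue. \<bar>y x\<bar> powr q) \<le> (LINT x|unit_lebesgue. q powr q * (exp (y x) + exp (- y x)))"
      using int by (intro integral_mono pt) auto
    also have "\<dots> = q powr q * ((LINT x|unit_lebesgue. exp (y x)) + (LINT x|unit_lebesgue. exp (- y x)))"
      using int by simp
    also have "\<dots> \<le> q powr q * (exp (1/2) + exp (1/2))"
      by (intro mult_left_mono add_mono ex exm) auto
    finally have "(LINT x|unit_lebesgue. norm (complex_of_real (y x)) powr q) \<le> 2 * q powr q * exp (1 / 2)"
      by simp
    also have "\<dots> = ((2 * q powr q * exp (1 / 2)) powr (1 / q)) powr q"
      using q by (simp add: powr_powr)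
    finally have "Lp_norm q (\<lambda>x. of_real (y x)) \<le> (2 * q powr q * exp (1 / 2)) powr (1 / q)"
      using q by (subst Lp_norm_le_iff) auto
    then have "\<sigma> * Lp_norm q (\<lambda>x. of_real (y x)) \<le> \<sigma> * (2 * q powr q * exp (1 / 2)) powr (1 / q)"
      using \<sigma> by (intro mult_left_mono) auto
    then show ?thesis
      using q \<sigma> Lp_norm_cmult[of q "of_real \<sigma>" "\<lambda>x. of_real (y x)"]
      unfolding y_eq \<sigma>_def[symmetric] by (simp add: mult.commute)
  qed
qed

theorem Khintchine:
  assumes q: "1 \<le> q"
  shows "\<exists>C\<ge>0. \<forall>J b. finite J \<longrightarrow>
    Lp_norm q (\<lambda>x. \<Sum>j\<in>J. b j * walsh (2 ^ j) x) \<le> C * sqrt (\<Sum>j\<in>J. (norm (b j))\<^sup>2)"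
proof -
  define C where "C = (2 * q powr q * exp (1 / 2)) powr (1 / q)"
  have "Lp_norm q (\<lambda>x. \<Sum>j\<in>J. b j * walsh (2 ^ j) x) \<le> (2 * C) * sqrt (\<Sum>j\<in>J. (norm (b j))\<^sup>2)"
    if J: "finite J" for J b
  proof -
    let ?R = "\<lambda>x. complex_of_real (\<Sum>j\<in>J. Re (b j) * rademacher j x)"
    let ?I = "\<lambda>x. complex_of_real (\<Sum>j\<in>J. Im (b j) * rademacher j x)"
    have eq: "(\<Sum>j\<in>J. b j * walsh (2 ^ j) x) = ?R x + \<i> * ?I x" for x
      by (simp add: complex_eq_iff walsh_power_two)
    have mono: "sqrt (\<Sum>j\<in>J. (g (b j))\<^sup>2) \<le> sqrt (\<Sum>j\<in>J. (norm (b j))\<^sup>2)"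
      if "\<And>z. \<bar>g z\<bar> \<le> norm z" for g :: "complex \<Rightarrow> real"
      using that by (intro real_sqrt_le_mono sum_mono) (simp add: abs_le_square_iff[symmetric])
    obtain n where n: "J \<subseteq> {..<n}" using finite_nat_bounded[OF J] by blast
    have L: "?R \<in> Lp_space q" "?I \<in> Lp_space q"
      using n q by (auto intro!: dyadic_step_in_Lp[of n] dyadic_step_comp[where F = complex_of_real] dyadic_step_sum dyadic_step_comp[where F = "\<lambda>z. _ * z"] dyadic_step_rademacher simp del: of_real_sum)
    have "Lp_norm q (\<lambda>x. ?R x + \<i> * ?I x) \<le> Lp_norm q ?R + Lp_norm q (\<lambda>x. \<i> * ?I x)"
      by (intro Lp_norm_triangle Lp_space_cmult q L)
    also have "\<dots> = Lp_norm q ?R + Lp_norm q ?I"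
      using q by (subst Lp_norm_cmult) auto
    also have "\<dots> \<le> C * sqrt (\<Sum>j\<in>J. (Re (b j))\<^sup>2) + C * sqrt (\<Sum>j\<in>J. (Im (b j))\<^sup>2)"
      unfolding C_def by (intro add_mono Khintchine_real q J)
    also have "\<dots> \<le> C * sqrt (\<Sum>j\<in>J. (norm (b j))\<^sup>2) + C * sqrt (\<Sum>j\<in>J. (norm (b j))\<^sup>2)"
      by (intro add_mono mult_left_mono mono) (auto simp: C_def abs_Re_le_cmod abs_Im_le_cmod)
    finally show ?thesis unfolding eq by simp
  qed
  moreover have "0 \<le> 2 * C" by (simp add: C_def)
  ultimately show ?thesis by blast
qed

text \<open>
  Pairing \<open>f\<close> with the Rademacher sum whose coefficients are the conjugates of those of \<open>f\<close> gives the
  sum of squares, and the norm of that Rademacher sum in the dual space is bounded by Khintchine.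
\<close>
theorem rademacher_coeffs_square_summable:
  assumes p: "1 < p"
  shows "\<exists>C\<ge>0. \<forall>f\<in>Lp_space p. \<forall>J. finite J \<longrightarrow>
    sqrt (\<Sum>j\<in>J. (norm (fourier_coeff walsh f (2 ^ j)))\<^sup>2) \<le> C * Lp_norm p f"
proof -
  obtain q where q: "1 < q" "1 / p + 1 / q = 1" using conjugate_exponent[OF p] .
  obtain C where C: "0 \<le> C" "\<And>J b. finite J \<Longrightarrow>
    Lp_norm q (\<lambda>x. \<Sum>j\<in>J. b j * walsh (2 ^ j) x) \<le> C * sqrt (\<Sum>j\<in>J. (norm (b j))\<^sup>2)"
    using Khintchine[of q] q by auto
  have "sqrt (\<Sum>j\<in>J. (norm (fourier_coeff walsh f (2 ^ j)))\<^sup>2) \<le> C * Lp_norm p f"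
    if f: "f \<in> Lp_space p" and J: "finite J" for f J
  proof -
    define b where "b j = fourier_coeff walsh f (2 ^ j)" for j
    define S where "S = (\<Sum>j\<in>J. (norm (b j))\<^sup>2)"
    have S: "0 \<le> S" by (simp add: S_def sum_nonneg)
    have inj: "inj_on (\<lambda>j. 2 ^ j :: nat) J" by (auto simp: inj_on_def)
    let ?g = "\<lambda>x. \<Sum>j\<in>J. cnj (b j) * walsh (2 ^ j) x"
    have g: "?g \<in> Lp_space q"
      using q by (intro Lp_space_sum Lp_space_cmult walsh.e_in_Lp) auto
    have "(LINT x|unit_lebesgue. f x * ?g x) = (LINT x|unit_lebesgue. (\<Sum>j\<in>J. cnj (b j) * (f x * walsh (2 ^ j) x)))"
      by (simp add: sum_distrib_left mult.left_commute)
    also have "\<dots> = (\<Sum>j\<in>J. cnj (b j) * b j)"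
      using walsh.coeff_integrable[OF p f] by (simp add: Bochner_Integration.integral_sum b_def fourier_coeff_def)
    also have "\<dots> = of_real S"
      unfolding S_def of_real_sum by (intro sum.cong refl) (simp add: complex_norm_square mult.commute del: of_real_power)
    finally have "S = norm (LINT x|unit_lebesgue. f x * ?g x)" using S by simp
    also have "\<dots> \<le> Lp_norm p f * Lp_norm q ?g"
      by (intro Hoelder_inequality p q f g)
    also have "\<dots> \<le> Lp_norm p f * (C * sqrt (\<Sum>j\<in>J. (norm (cnj (b j)))\<^sup>2))"
      by (intro mult_left_mono C J) auto
    finally have main: "sqrt S * sqrt S \<le> (C * Lp_norm p f) * sqrt S"
      using S by (simp add: S_def mult_ac)
    have "sqrt S \<le> C * Lp_norm p f"
    proof (cases "S = 0")
      case False
      with S have "0 < sqrt S" by simp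
      with main show ?thesis by (rule mult_right_le_imp_le)
    qed (use C in simp)
    then show ?thesis by (simp add: S_def b_def)
  qed
  with C(1) show ?thesis by blast
qed

lemma rademacher_projection_bounded:
  assumes p: "1 < p"
  shows "\<exists>C\<ge>0. \<forall>f\<in>Lp_space p. \<forall>J. finite J \<longrightarrow>
    Lp_norm p (\<lambda>x. \<Sum>j\<in>J. fourier_coeff walsh f (2 ^ j) * walsh (2 ^ j) x) \<le> C * Lp_norm p f"
proof -
  obtain C where C: "0 \<le> C" "\<And>J b. finite J \<Longrightarrow>
    Lp_norm p (\<lambda>x. \<Sum>j\<in>J. b j * walsh (2 ^ j) x) \<le> C * sqrt (\<Sum>j\<in>J. (norm (b j))\<^sup>2)"
    using Khintchine[of p] p by auto
  obtain C' where C': "0 \<le> C'" "\<And>f J. f \<in> Lp_space p \<Longrightarrow> finite J \<Longrightarrow>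
    sqrt (\<Sum>j\<in>J. (norm (fourier_coeff walsh f (2 ^ j)))\<^sup>2) \<le> C' * Lp_norm p f"
    using rademacher_coeffs_square_summable[OF p] by blast
  have "Lp_norm p (\<lambda>x. \<Sum>j\<in>J. fourier_coeff walsh f (2 ^ j) * walsh (2 ^ j) x) \<le> C * C' * Lp_norm p f"
    if "f \<in> Lp_space p" "finite J" for f J
    using order.trans[OF C(2)[OF that(2)] mult_left_mono[OF C'(2)[OF that] C(1)]] by (simp add: mult.assoc)
  then show ?thesis using C(1) C'(1) by (intro exI[of _ "C * C'"]) auto
qed

section \<open>Criterion for almost greedy bases\<close>

context bounded_orthonormal_system
begin

definition dense_in_Lp :: "real \<Rightarrow> bool" where
  "dense_in_Lp p \<longleftrightarrow> (\<forall>f\<in>Lp_space p. \<forall>\<epsilon>>0. \<exists>N c. Lp_norm p (\<lambda>x. f x - (\<Sum>k<N. c k * e k x)) < \<epsilon>)"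

definition bounded_partial_sums :: "real \<Rightarrow> bool" where
  "bounded_partial_sums p \<longleftrightarrow>
    (\<exists>C\<ge>0. \<forall>f\<in>Lp_space p. \<forall>N. Lp_norm p (\<lambda>x. \<Sum>n<N. fourier_coeff e f n * e n x) \<le> C * Lp_norm p f)"

text \<open>
  Stated for all coefficients of modulus at most \<open>t\<close>, not only for unimodular ones. By duality, this bound
  in \<open>L\<^sub>q\<close> yields the corresponding lower bound in \<open>L\<^sub>p\<close>, so in both spaces together it says that all
  sums of \<open>N\<close> elements with unimodular coefficients have norm of the order \<open>N\<^bsup>1/2\<^esup>\<close>.
\<close>
definition square_root_upper_bound :: "real \<Rightarrow> bool" where
  "square_root_upper_bound p \<longleftrightarrow>
    (\<exists>D\<ge>0. \<forall>A c t. finite A \<longrightarrow> (\<forall>n\<in>A. norm (c n) \<le> t) \<longrightarrow>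
       Lp_norm p (\<lambda>x. \<Sum>n\<in>A. c n * e n x) \<le> D * (t * sqrt (card A)))"

text \<open>
  The set \<open>A\<close> contains all indices with a coefficient above \<open>t\<close> and any choice of those with
  a coefficient equal to \<open>t\<close> in modulus. Greedy approximants are of this form, whatever the rule for ties.
\<close>
definition bounded_threshold_sums :: "real \<Rightarrow> bool" where
  "bounded_threshold_sums p \<longleftrightarrow>
    (\<exists>Q\<ge>0. \<forall>f\<in>Lp_space p. \<forall>A t. finite A \<longrightarrow> 0 \<le> t \<longrightarrow>
       (\<forall>n\<in>A. t \<le> norm (fourier_coeff e f n)) \<longrightarrow> (\<forall>n. n \<notin> A \<longrightarrow> norm (fourier_coeff e f n) \<le> t) \<longrightarrow>
       Lp_norm p (\<lambda>x. \<Sum>n\<in>A. fourier_coeff e f n * e n x) \<le> Q * Lp_norm p f)"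

lemma orthonormal_basis:
  assumes "dense_in_Lp 2"
  shows "orthonormal_basis_L2 e"
  using assms e_in_Lp
  by (auto simp: orthonormal_basis_L2_def dense_in_Lp_def L2_inner_def cnj_e orthonormal)

lemma uniformly_bounded: "uniformly_bounded e"
proof -
  have "Linf_norm (e n) \<le> ereal B" for n
    unfolding Linf_norm_def
    by (rule esssup_I) (auto intro!: AE_I2 norm_e_le)
  then have "(SUP n. Linf_norm (e n)) \<le> ereal B" by (rule SUP_least)
  then show ?thesis by (auto simp: uniformly_bounded_def less_top[symmetric] top_ereal_def)
qed

lemma coeff_diff_sum:
  assumes "1 < p" "f \<in> Lp_space p" "finite I"
  shows "fourier_coeff e (\<lambda>x. f x - (\<Sum>k\<in>I. c k * e k x)) n = fourier_coeff e f n - (if n \<in> I then c n else 0)"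
  using assms by (subst coeff_diff[OF assms(1,2)]) (auto simp: coeff_sum intro: sum_in_Lp)

lemma expansion_fourier_coeff:
  assumes p: "1 < p" and dense: "dense_in_Lp p" and bdd: "bounded_partial_sums p" and f: "f \<in> Lp_space p"
  shows "Lp_expansion p e f (fourier_coeff e f)"
  unfolding Lp_expansion_def
proof (rule LIMSEQ_I)
  obtain C where C: "0 \<le> C" "\<And>f N. f \<in> Lp_space p \<Longrightarrow>
      Lp_norm p (\<lambda>x. \<Sum>n<N. fourier_coeff e f n * e n x) \<le> C * Lp_norm p f"
    using bdd unfolding bounded_partial_sums_def by blast
  fix r :: real assume r: "0 < r"
  then have d: "0 < r / (1 + C)" using C by simp
  obtain N c where N: "Lp_norm p (\<lambda>x. f x - (\<Sum>k<N. c k * e k x)) < r / (1 + C)"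
    using dense f d unfolding dense_in_Lp_def by blast
  define g where "g x = f x - (\<Sum>k<N. c k * e k x)" for x
  have g: "g \<in> Lp_space p"
    unfolding g_def[abs_def] using p by (intro Lp_space_diff f sum_in_Lp) auto
  show "\<exists>no. \<forall>n\<ge>no. norm (Lp_norm p (\<lambda>x. f x - (\<Sum>k<n. fourier_coeff e f k * e k x)) - 0) < r"
  proof (intro exI allI impI)
    fix n assume n: "N \<le> n"
    have cg: "fourier_coeff e g k = fourier_coeff e f k - (if k < N then c k else 0)" for k
      by (simp add: g_def[abs_def] coeff_diff_sum[OF p f])
    have eq: "f x - (\<Sum>k<n. fourier_coeff e f k * e k x) = g x - (\<Sum>k<n. fourier_coeff e g k * e k x)" for x
    proof -
      have "(\<Sum>k<n. fourier_coeff e g k * e k x)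
          = (\<Sum>k<n. fourier_coeff e f k * e k x) - (\<Sum>k<n. if k < N then c k * e k x else 0)"
        unfolding sum_subtractf[symmetric]
        by (intro sum.cong) (auto simp: left_diff_distrib cg)
      also have "(\<Sum>k<n. if k < N then c k * e k x else 0) = (\<Sum>k<N. c k * e k x)"
        using n by (intro sum.mono_neutral_cong_right) auto
      finally show ?thesis by (simp add: g_def[of x])
    qed
    have "Lp_norm p (\<lambda>x. f x - (\<Sum>k<n. fourier_coeff e f k * e k x))
        \<le> Lp_norm p g + Lp_norm p (\<lambda>x. \<Sum>k<n. fourier_coeff e g k * e k x)"
      unfolding eq using p by (intro Lp_norm_triangle_diff g sum_in_Lp) auto
    also have "\<dots> \<le> (1 + C) * Lp_norm p g"
      using C(2)[OF g, of n] by (simp add: algebra_simps)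
    also have "\<dots> < (1 + C) * (r / (1 + C))"
      using N C by (intro mult_strict_left_mono) (auto simp: g_def[abs_def])
    finally show "norm (Lp_norm p (\<lambda>x. f x - (\<Sum>k<n. fourier_coeff e f k * e k x)) - 0) < r"
      using C by (simp add: add_pos_nonneg)
  qed
qed

lemma expansion_unique:
  assumes p: "1 < p" and f: "f \<in> Lp_space p" and c: "Lp_expansion p e f c"
  shows "c = fourier_coeff e f"
proof
  fix n
  have "(\<lambda>N. Lp_norm p (\<lambda>x. f x - (\<Sum>k<N. c k * e k x)) * B) \<longlonglongrightarrow> 0 * B"
    using c unfolding Lp_expansion_def by (intro tendsto_intros)
  moreover have "eventually (\<lambda>N. norm (fourier_coeff e f n - c n) \<le> Lp_norm p (\<lambda>x. f x - (\<Sum>k<N. c k * e k x)) * B) sequentially"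
    using eventually_gt_at_top[of n]
  proof eventually_elim
    case (elim N)
    have "norm (fourier_coeff e (\<lambda>x. f x - (\<Sum>k<N. c k * e k x)) n) \<le> Lp_norm p (\<lambda>x. f x - (\<Sum>k<N. c k * e k x)) * B"
      using p by (intro norm_coeff_le Lp_space_diff f sum_in_Lp) auto
    then show ?case using elim by (simp add: coeff_diff_sum[OF p f])
  qed
  ultimately have "norm (fourier_coeff e f n - c n) \<le> 0 * B"
    by (intro tendsto_lowerbound[where F = sequentially]) auto
  then show "c n = fourier_coeff e f n" by simp
qed

lemma fourier_coeff_tendsto_0:
  assumes p: "1 < p" and dense: "dense_in_Lp p" and f: "f \<in> Lp_space p"
  shows "fourier_coeff e f \<longlonglongrightarrow> 0"
proof (rule LIMSEQ_I)
  fix r :: real assume r: "0 < r"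
  have d: "0 < r / (B + 1)" using r B_nonneg by simp
  obtain N c where N: "Lp_norm p (\<lambda>x. f x - (\<Sum>k<N. c k * e k x)) < r / (B + 1)"
    using dense f d unfolding dense_in_Lp_def by blast
  show "\<exists>no. \<forall>n\<ge>no. norm (fourier_coeff e f n - 0) < r"
  proof (intro exI allI impI)
    fix n assume n: "N \<le> n"
    have "norm (fourier_coeff e f n) = norm (fourier_coeff e (\<lambda>x. f x - (\<Sum>k<N. c k * e k x)) n)"
      using n by (simp add: coeff_diff_sum[OF p f])
    also have "\<dots> \<le> Lp_norm p (\<lambda>x. f x - (\<Sum>k<N. c k * e k x)) * B"
      using p by (intro norm_coeff_le Lp_space_diff f sum_in_Lp) auto
    also have "\<dots> \<le> r / (B + 1) * B"
      using N B_nonneg by (intro mult_right_mono) auto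
    also have "\<dots> < r" using r B_nonneg by (simp add: field_simps)
    finally show "norm (fourier_coeff e f n - 0) < r" by simp
  qed
qed

lemma bounded_schauder_basis:
  assumes p: "1 < p" and dense: "dense_in_Lp p" and bdd: "bounded_partial_sums p"
  shows "bounded_schauder_basis_Lp p e"
proof -
  obtain q where q: "1 < q" "1 / p + 1 / q = 1" using conjugate_exponent[OF p] .
  have one: "1 \<le> Lp_norm p (e n) * B" for n
  proof -
    have "(LINT x|unit_lebesgue. e n x * e n x) = 1" by (simp add: orthonormal)
    then have "1 \<le> Lp_norm p (e n) * Lp_norm q (e n)"
      using Hoelder_inequality[OF p q e_in_Lp e_in_Lp, of n n] p q by simp
    also have "\<dots> \<le> Lp_norm p (e n) * B"
      using q by (intro mult_left_mono Lp_norm_e_le) auto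
    finally show ?thesis .
  qed
  then have "B \<noteq> 0" by (metis mult_zero_right not_one_le_zero)
  then have B: "0 < B" using B_nonneg by simp
  have "1 / B \<le> (INF n. Lp_norm p (e n))"
    using one B by (intro cINF_greatest) (auto simp: divide_le_eq)
  moreover have "0 < 1 / B" using B by simp
  ultimately have "0 < (INF n. Lp_norm p (e n))" by linarith
  moreover have "bdd_above (range (\<lambda>n. Lp_norm p (e n)))"
    using p by (intro bdd_aboveI[of _ B]) (auto intro!: Lp_norm_e_le)
  moreover have "schauder_basis_Lp p e"
    unfolding schauder_basis_Lp_def
    using p e_in_Lp expansion_fourier_coeff[OF p dense bdd] expansion_unique[OF p] by (auto intro!: ex1I)
  ultimately show ?thesis by (simp add: bounded_schauder_basis_Lp_def)
qed

text \<open>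
  Let \<open>g\<close> be the remainder for the competing set \<open>S\<close>. Then
  \<open>f - \<Sum>\<^sub>A c\<^sub>n e\<^sub>n = g - \<Sum>\<^bsub>A - S\<^esub> c\<^sub>n e\<^sub>n + \<Sum>\<^bsub>S - A\<^esub> c\<^sub>n e\<^sub>n\<close>.
  The first sum is a threshold sum of \<open>g\<close>. The second one has coefficients of modulus at most \<open>t\<close> and
  as many terms as the first, say \<open>m\<close>, so its norm is at most a multiple of \<open>t m\<^bsup>1/2\<^esup>\<close>. As
  \<open>g\<close> has \<open>m\<close> coefficients of modulus at least \<open>t\<close>, pairing \<open>g\<close> with the corresponding
  sum of \<open>m\<close> elements with unimodular coefficients gives
  \<open>t m \<le> \<parallel>g\<parallel>\<^sub>p D m\<^bsup>1/2\<^esup>\<close>.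
\<close>
lemma threshold_sum_near_best:
  assumes p: "1 < p" and q: "1 / p + 1 / q = 1"
    and Dp: "0 \<le> Dp" "\<forall>A c t. finite A \<longrightarrow> (\<forall>n\<in>A. norm (c n) \<le> t) \<longrightarrow>
       Lp_norm p (\<lambda>x. \<Sum>n\<in>A. c n * e n x) \<le> Dp * (t * sqrt (card A))"
    and Dq: "0 \<le> Dq" "\<forall>A c t. finite A \<longrightarrow> (\<forall>n\<in>A. norm (c n) \<le> t) \<longrightarrow>
       Lp_norm q (\<lambda>x. \<Sum>n\<in>A. c n * e n x) \<le> Dq * (t * sqrt (card A))"
    and Q: "\<forall>f\<in>Lp_space p. \<forall>A t. finite A \<longrightarrow> 0 \<le> t \<longrightarrow>
       (\<forall>n\<in>A. t \<le> norm (fourier_coeff e f n)) \<longrightarrow> (\<forall>n. n \<notin> A \<longrightarrow> norm (fourier_coeff e f n) \<le> t) \<longrightarrow>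
       Lp_norm p (\<lambda>x. \<Sum>n\<in>A. fourier_coeff e f n * e n x) \<le> Q * Lp_norm p f"
    and f: "f \<in> Lp_space p" and A: "finite A" and t: "0 \<le> t"
    and ge: "\<And>n. n \<in> A \<Longrightarrow> t \<le> norm (fourier_coeff e f n)"
    and le: "\<And>n. n \<notin> A \<Longrightarrow> norm (fourier_coeff e f n) \<le> t"
    and S: "finite S" "card S = card A"
  shows "Lp_norm p (\<lambda>x. f x - (\<Sum>n\<in>A. fourier_coeff e f n * e n x))
    \<le> (1 + Q + Dp * Dq) * Lp_norm p (\<lambda>x. f x - (\<Sum>n\<in>S. fourier_coeff e f n * e n x))"
proof -
  have q1: "1 < q"
  proof -
    obtain q' where "1 < q'" "1 / p + 1 / q' = 1" using conjugate_exponent[OF p] .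
    then have "1 / q = 1 / q'" using q by linarith
    then show ?thesis using \<open>1 < q'\<close> by (simp add: divide_inverse)
  qed
  define c where "c = fourier_coeff e f"
  define g where "g x = f x - (\<Sum>n\<in>S. c n * e n x)" for x
  have g: "g \<in> Lp_space p"
    unfolding g_def[abs_def] using p by (intro Lp_space_diff f sum_in_Lp) auto
  have cg: "fourier_coeff e g n = (if n \<in> S then 0 else c n)" for n
    unfolding g_def[abs_def] coeff_diff_sum[OF p f S(1)] by (simp add: c_def)
  define m where "m = card (A - S)"
  have m: "card (S - A) = m"
    unfolding m_def using A S by (simp add: card_Diff_subset_Int Int_commute)
  have "Lp_norm p (\<lambda>x. \<Sum>n\<in>A-S. fourier_coeff e g n * e n x) \<le> Q * Lp_norm p g"
    using A t ge le by (intro Q[rule_format, where t = t] g) (auto simp: cg c_def)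
  also have "(\<lambda>x. \<Sum>n\<in>A-S. fourier_coeff e g n * e n x) = (\<lambda>x. \<Sum>n\<in>A-S. c n * e n x)"
    by (intro ext sum.cong) (auto simp: cg)
  finally have AS: "Lp_norm p (\<lambda>x. \<Sum>n\<in>A-S. c n * e n x) \<le> Q * Lp_norm p g" .
  have SA: "Lp_norm p (\<lambda>x. \<Sum>n\<in>S-A. c n * e n x) \<le> Dp * (t * sqrt m)"
    using Dp(2)[rule_format, of "S - A" c t] S le by (auto simp: m c_def)
  have tm: "t * sqrt m \<le> Dq * Lp_norm p g"
  proof (cases "m = 0")
    case False
    define s where "s n = cnj (sgn (c n))" for n
    have "t * m \<le> (\<Sum>n\<in>A-S. norm (c n))"
      using sum_bounded_below[of "A - S" t "\<lambda>n. norm (c n)"] ge by (simp add: m_def c_def mult.commute)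
    also have "\<dots> = norm (\<Sum>n\<in>A-S. s n * fourier_coeff e g n)"
    proof -
      have "s n * fourier_coeff e g n = of_real (norm (c n))" if "n \<in> A - S" for n
        using that by (simp add: cg s_def sgn_eq complex_norm_square[symmetric] mult.commute power2_eq_square)
      then have "(\<Sum>n\<in>A-S. s n * fourier_coeff e g n) = of_real (\<Sum>n\<in>A-S. norm (c n))"
        by (simp add: of_real_sum)
      moreover have "0 \<le> (\<Sum>n\<in>A-S. norm (c n))" by (rule sum_nonneg) simp
      ultimately show ?thesis by (simp only: norm_of_real abs_of_nonneg)
    qed
    also have "\<dots> = norm (LINT x|unit_lebesgue. g x * (\<Sum>n\<in>A-S. s n * e n x))"
      by (simp add: LINT_times_sum[OF p g])
    also have "\<dots> \<le> Lp_norm p g * Lp_norm q (\<lambda>x. \<Sum>n\<in>A-S. s n * e n x)"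
      using q1 by (intro Hoelder_inequality p q g sum_in_Lp) auto
    also have "\<dots> \<le> Lp_norm p g * (Dq * (1 * sqrt m))"
      unfolding m_def using A by (intro mult_left_mono Dq(2)[rule_format]) (auto simp: s_def norm_sgn)
    finally have "(t * sqrt m) * sqrt m \<le> (Dq * Lp_norm p g) * sqrt m"
      by (simp add: mult_ac)
    then show ?thesis by (rule mult_right_le_imp_le) (use False in simp)
  qed (use Dq in simp)
  have eq: "f x - (\<Sum>n\<in>A. c n * e n x) = (g x - (\<Sum>n\<in>A-S. c n * e n x)) + (\<Sum>n\<in>S-A. c n * e n x)" for x
    using A S sum.Int_Diff[of A "\<lambda>n. c n * e n x" S] sum.Int_Diff[of S "\<lambda>n. c n * e n x" A]
    by (simp add: g_def[of x] Int_commute)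
  have "Lp_norm p (\<lambda>x. f x - (\<Sum>n\<in>A. c n * e n x))
      \<le> Lp_norm p (\<lambda>x. g x - (\<Sum>n\<in>A-S. c n * e n x)) + Lp_norm p (\<lambda>x. \<Sum>n\<in>S-A. c n * e n x)"
    unfolding eq using p by (intro Lp_norm_triangle Lp_space_diff sum_in_Lp g) auto
  also have "\<dots> \<le> (Lp_norm p g + Lp_norm p (\<lambda>x. \<Sum>n\<in>A-S. c n * e n x)) + Lp_norm p (\<lambda>x. \<Sum>n\<in>S-A. c n * e n x)"
    using p by (intro add_right_mono Lp_norm_triangle_diff sum_in_Lp g) auto
  also have "\<dots> \<le> (Lp_norm p g + Q * Lp_norm p g) + Dp * (Dq * Lp_norm p g)"
    using AS order.trans[OF SA mult_left_mono[OF tm Dp(1)]] by linarith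
  also have "\<dots> = (1 + Q + Dp * Dq) * Lp_norm p g" by (simp add: algebra_simps)
  finally show ?thesis by (simp add: c_def g_def[abs_def])
qed

theorem almost_greedy_criterion:
  assumes p: "1 < p" and q: "1 / p + 1 / q = 1"
    and dense: "dense_in_Lp p" and bdd: "bounded_partial_sums p"
    and sqp: "square_root_upper_bound p" and sqq: "square_root_upper_bound q"
    and thr: "bounded_threshold_sums p"
  shows "almost_greedy_basis_Lp p e"
proof -
  have dual: "dual_coeff p e f = fourier_coeff e f" if "f \<in> Lp_space p" for f
    unfolding dual_coeff_def
    by (rule the_equality) (rule expansion_fourier_coeff[OF p dense bdd that], rule expansion_unique[OF p that])
  obtain Dp where Dp: "0 \<le> Dp" "\<forall>A c t. finite A \<longrightarrow> (\<forall>n\<in>A. norm (c n) \<le> t) \<longrightarrow>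
       Lp_norm p (\<lambda>x. \<Sum>n\<in>A. c n * e n x) \<le> Dp * (t * sqrt (card A))"
    using sqp unfolding square_root_upper_bound_def by (elim exE conjE)
  obtain Dq where Dq: "0 \<le> Dq" "\<forall>A c t. finite A \<longrightarrow> (\<forall>n\<in>A. norm (c n) \<le> t) \<longrightarrow>
       Lp_norm q (\<lambda>x. \<Sum>n\<in>A. c n * e n x) \<le> Dq * (t * sqrt (card A))"
    using sqq unfolding square_root_upper_bound_def by (elim exE conjE)
  obtain Q where Q: "0 \<le> Q" "\<forall>f\<in>Lp_space p. \<forall>A t. finite A \<longrightarrow> 0 \<le> t \<longrightarrow>
       (\<forall>n\<in>A. t \<le> norm (fourier_coeff e f n)) \<longrightarrow> (\<forall>n. n \<notin> A \<longrightarrow> norm (fourier_coeff e f n) \<le> t) \<longrightarrow>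
       Lp_norm p (\<lambda>x. \<Sum>n\<in>A. fourier_coeff e f n * e n x) \<le> Q * Lp_norm p f"
    using thr unfolding bounded_threshold_sums_def by (elim exE conjE)
  define K where "K = 1 + Q + Dp * Dq"
  have K: "0 < K" using Q Dp Dq by (simp add: K_def add_pos_nonneg)
  have "Lp_norm p (\<lambda>x. f x - greedy_approx p e m f x)
      \<le> K * Inf {Lp_norm p (\<lambda>x. f x - (\<Sum>j\<in>S. dual_coeff p e f j * e j x)) | S. finite S \<and> card S = m}"
    if f: "f \<in> Lp_space p" for f m
  proof -
    define c where "c = fourier_coeff e f"
    define \<rho> where "\<rho> = greedy_ordering c"
    have "is_greedy_ordering c \<rho>"
      unfolding \<rho>_def greedy_ordering_def c_def
      by (rule someI_ex[of "is_greedy_ordering (fourier_coeff e f)"])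
         (rule greedy_ordering_exists[OF fourier_coeff_tendsto_0[OF p dense f]])
    then have range: "{j. c j \<noteq> 0} \<subseteq> range \<rho>"
      and ord: "\<And>j k. j < k \<Longrightarrow> norm (c (\<rho> k)) < norm (c (\<rho> j)) \<or> norm (c (\<rho> k)) = norm (c (\<rho> j)) \<and> \<rho> k > \<rho> j"
      unfolding is_greedy_ordering_def by blast+
    have mono: "norm (c (\<rho> k)) \<le> norm (c (\<rho> j))" if "j \<le> k" for j k
      using ord[of j k] that by (cases "j = k") auto
    have inj: "inj \<rho>"
    proof (rule injI)
      fix j k assume "\<rho> j = \<rho> k"
      then show "j = k" using ord[of j k] ord[of k j] by (cases j k rule: linorder_cases) auto
    qed
    define A where "A = \<rho> ` {..<m}"
    have A: "finite A" "card A = m"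
      using inj by (auto simp: A_def card_image inj_on_subset)
    have approx: "greedy_approx p e m f = (\<lambda>x. \<Sum>n\<in>A. c n * e n x)"
      unfolding greedy_approx_def dual[OF f] Let_def c_def[symmetric] \<rho>_def[symmetric] A_def
      using inj by (subst sum.reindex) (auto intro: inj_on_subset)
    \<comment> \<open>The threshold is the last coefficient taken, and for \<open>m = 0\<close> any common bound of the
       coefficients.\<close>
    obtain t where t: "0 \<le> t" "\<And>n. n \<in> A \<Longrightarrow> t \<le> norm (c n)" "\<And>n. n \<notin> A \<Longrightarrow> norm (c n) \<le> t"
    proof (cases m)
      case 0
      then have "A = {}" by (simp add: A_def)
      then show ?thesis
        using norm_coeff_le[OF p f] B_nonneg by (intro that[of "Lp_norm p f * B"]) (auto simp: c_def)
    next
      case (Suc l)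
      show ?thesis
      proof (rule that[of "norm (c (\<rho> l))"])
        show "norm (c n) \<le> norm (c (\<rho> l))" if n: "n \<notin> A" for n
        proof (cases "c n = 0")
          case False
          then obtain k where k: "n = \<rho> k" using range by auto
          with n have "\<not> k < m" by (auto simp: A_def)
          then show ?thesis unfolding k using Suc by (intro mono) auto
        qed simp
      qed (auto simp: A_def Suc intro!: mono)
    qed
    have "Lp_norm p (\<lambda>x. f x - greedy_approx p e m f x) / K
        \<le> Inf {Lp_norm p (\<lambda>x. f x - (\<Sum>j\<in>S. dual_coeff p e f j * e j x)) | S. finite S \<and> card S = m}"
    proof (rule cInf_greatest)
      show "{Lp_norm p (\<lambda>x. f x - (\<Sum>j\<in>S. dual_coeff p e f j * e j x)) | S. finite S \<and> card S = m} \<noteq> {}"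
        using A by auto
      fix y assume "y \<in> {Lp_norm p (\<lambda>x. f x - (\<Sum>j\<in>S. dual_coeff p e f j * e j x)) | S. finite S \<and> card S = m}"
      then obtain S where S: "finite S" "card S = m" "y = Lp_norm p (\<lambda>x. f x - (\<Sum>j\<in>S. c j * e j x))"
        by (auto simp: dual[OF f] c_def)
      have "Lp_norm p (\<lambda>x. f x - (\<Sum>n\<in>A. c n * e n x)) \<le> K * y"
        unfolding K_def S(3) c_def
        by (rule threshold_sum_near_best[OF p q Dp Dq Q(2) f A(1) t(1)]) (use A S t in \<open>auto simp: c_def\<close>)
      then show "Lp_norm p (\<lambda>x. f x - greedy_approx p e m f x) / K \<le> y"
        using K by (simp add: approx divide_le_eq mult.commute)
    qed
    then show ?thesis using K by (simp add: divide_le_eq mult.commute)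
  qed
  then show ?thesis
    unfolding almost_greedy_basis_Lp_def using bounded_schauder_basis[OF p dense bdd] by blast
qed

end

section \<open>Haar matrices\<close>

text \<open>
  The discrete Haar basis. Passing from \<open>k\<close> to \<open>k + 1\<close> repeats every row in two rows, and the
  new columns take the difference within these pairs. This recursion gives directly the properties that matter:
  orthogonality, a constant first column, and rows with bounded \<open>\<ell>\<^sub>1\<close>-norm. A matrix such as that of
  Walsh, which has all entries of equal modulus, lacks the last property.
\<close>
fun haar_matrix :: "nat \<Rightarrow> nat \<Rightarrow> nat \<Rightarrow> real" where
  "haar_matrix 0 i j = 1"
| "haar_matrix (Suc k) i j =
    (if j < 2 ^ k then haar_matrix k (i div 2) j / sqrt 2
     else if j = 2 ^ k + i div 2 then (-1) ^ i / sqrt 2 else 0)"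

lemma haar_matrix_first_column: "haar_matrix k i 0 = 1 / sqrt (2 ^ k)"
  by (induction k arbitrary: i) (auto simp: real_sqrt_mult)

lemma haar_matrix_row_orthonormal:
  "i < 2 ^ k \<Longrightarrow> i' < 2 ^ k \<Longrightarrow> (\<Sum>j<2 ^ k. haar_matrix k i j * haar_matrix k i' j) = (if i = i' then 1 else 0)"
proof (induction k arbitrary: i i')
  case (Suc k)
  have d: "i div 2 < 2 ^ k" "i' div 2 < 2 ^ k" using Suc.prems by auto
  have "(\<Sum>j<2 ^ Suc k. haar_matrix (Suc k) i j * haar_matrix (Suc k) i' j)
     = (\<Sum>j<2 ^ k. haar_matrix k (i div 2) j * haar_matrix k (i' div 2) j / 2)
       + (\<Sum>j<2 ^ k. if j = i div 2 then (if i' div 2 = i div 2 then (-1) ^ i * (-1) ^ i' / 2 else 0) else 0)"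
    unfolding power_Suc mult_2 sum_lessThan_add
    by (intro arg_cong2[where f = "(+)"] sum.cong refl) auto
  also have "\<dots> = (if i div 2 = i' div 2 then 1 / 2 else 0) + (if i' div 2 = i div 2 then (-1) ^ i * (-1) ^ i' / 2 else 0)"
    using Suc.IH[OF d] d by (simp add: sum_divide_distrib[symmetric])
  also have "\<dots> = (if i = i' then 1 else 0)"
  proof (cases "i div 2 = i' div 2 \<and> i \<noteq> i'")
    case True
    then have "even i \<noteq> even i'" by presburger
    then have "(-1) ^ i * (-1) ^ i' = (-1 :: real)" by auto
    with True show ?thesis by simp
  qed (auto simp: power_mult_distrib[symmetric])
  finally show ?case .
qed simp

lemma sum_lessThan_double:
  fixes f :: "nat \<Rightarrow> 'a::comm_monoid_add"
  shows "(\<Sum>i<2 * n. f i) = (\<Sum>i<n. f (2 * i) + f (2 * i + 1))"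
  by (induction n) (auto simp: add_ac)

lemma haar_matrix_column_orthonormal:
  "j < 2 ^ k \<Longrightarrow> j' < 2 ^ k \<Longrightarrow> (\<Sum>i<2 ^ k. haar_matrix k i j * haar_matrix k i j') = (if j = j' then 1 else 0)"
proof (induction k arbitrary: j j')
  case (Suc k)
  have "(\<Sum>i<2 ^ Suc k. haar_matrix (Suc k) i j * haar_matrix (Suc k) i j')
      = (\<Sum>i<2 ^ k. (if j < 2 ^ k then if j' < 2 ^ k then haar_matrix k i j * haar_matrix k i j' else 0
           else if j' < 2 ^ k then 0 else if i = j - 2 ^ k then if j = j' then 1 else 0 else 0))"
    unfolding power_Suc sum_lessThan_double by (intro sum.cong refl) auto
  also have "\<dots> = (if j = j' then 1 else 0)"
    using Suc by (cases "j < 2 ^ k"; cases "j' < 2 ^ k") auto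
  finally show ?case .
qed simp

text \<open>
  The row norm obeys \<open>\<lambda> \<mapsto> (\<lambda> + 1)/\<surd>2\<close>, which preserves the bound \<open>3\<close>.
\<close>
lemma haar_matrix_row_l1:
  "i < 2 ^ k \<Longrightarrow> (\<Sum>j<2 ^ k. \<bar>haar_matrix k i j\<bar>) \<le> 3"
proof (induction k arbitrary: i)
  case (Suc k)
  have d: "i div 2 < 2 ^ k" using Suc.prems by auto
  have "(\<Sum>j<2 ^ Suc k. \<bar>haar_matrix (Suc k) i j\<bar>)
     = (\<Sum>j<2 ^ k. \<bar>haar_matrix k (i div 2) j\<bar> / sqrt 2) + (\<Sum>j<2 ^ k. if j = i div 2 then 1 / sqrt 2 else 0)"
    unfolding power_Suc mult_2 sum_lessThan_add
    by (intro arg_cong2[where f = "(+)"] sum.cong refl) auto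
  also have "\<dots> = ((\<Sum>j<2 ^ k. \<bar>haar_matrix k (i div 2) j\<bar>) + 1) / sqrt 2"
    using d by (simp add: sum_divide_distrib[symmetric] add_divide_distrib)
  also have "\<dots> \<le> (3 + 1) / sqrt 2"
    using Suc.IH[OF d] by (intro divide_right_mono) auto
  also have "\<dots> \<le> 3"
  proof -
    have "(4 / 3 :: real) \<le> sqrt 2" by (rule real_le_rsqrt) (simp add: power2_eq_square)
    then show ?thesis by (simp add: pos_divide_le_eq)
  qed
  finally show ?case .
qed simp

section \<open>The mixed Walsh system\<close>

text \<open>
  Block \<open>k\<close> consists of the \<open>2\<^sup>k\<close> indices \<open>2\<^sup>k - 1, \<dots>, 2\<^bsup>k+1\<^esup> - 2\<close>, so the first \<open>K\<close> blocks
  are the indices below \<open>2\<^sup>K - 1\<close>.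
\<close>
definition block :: "nat \<Rightarrow> nat" where
  "block n = floor_log (Suc n)"

definition block_pos :: "nat \<Rightarrow> nat" where
  "block_pos n = Suc n - 2 ^ block n"

lemma Suc_eq_block: "Suc n = 2 ^ block n + block_pos n"
proof -
  have "2 ^ block n \<le> Suc n" unfolding block_def by (rule floor_log_exp2_le) simp
  then show ?thesis by (simp only: block_pos_def le_add_diff_inverse)
qed

lemma block_pos_less: "block_pos n < 2 ^ block n"
proof -
  have "Suc n < 2 * 2 ^ block n" unfolding block_def by (rule floor_log_exp2_gt)
  then show ?thesis using Suc_eq_block[of n] by linarith
qed

lemma block_of:
  assumes "i < 2 ^ k"
  shows "block (2 ^ k - 1 + i) = k" "block_pos (2 ^ k - 1 + i) = i"
proof -
  have eq: "Suc (2 ^ k - 1 + i) = 2 ^ k + i" by simp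
  show "block (2 ^ k - 1 + i) = k"
    unfolding block_def eq using assms by (intro floor_log_eqI) auto
  then show "block_pos (2 ^ k - 1 + i) = i"
    unfolding block_pos_def eq by simp
qed

lemma block_eqI: "block m = block n \<Longrightarrow> block_pos m = block_pos n \<Longrightarrow> m = n"
  by (metis Suc_eq_block nat.inject)

lemma block_less_iff: "block n < k \<longleftrightarrow> n < 2 ^ k - 1"
proof
  assume "block n < k"
  then have "(2::nat) ^ Suc (block n) \<le> 2 ^ k" by (intro power_increasing) auto
  then show "n < 2 ^ k - 1" using Suc_eq_block[of n] block_pos_less[of n] by simp
next
  assume n: "n < 2 ^ k - 1"
  show "block n < k"
  proof (rule ccontr)
    assume "\<not> block n < k"
    then have "(2::nat) ^ k \<le> 2 ^ block n" by (intro power_increasing) auto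
    then show False using Suc_eq_block[of n] n by linarith
  qed
qed

lemma sum_over_block:
  fixes F :: "nat \<Rightarrow> 'a::comm_monoid_add"
  assumes "b < K"
  shows "(\<Sum>l<2 ^ K - 1. if block l = b then F (block_pos l) else 0) = (\<Sum>i<2 ^ b. F i)"
proof -
  have "(\<Sum>l<2 ^ K - 1. if block l = b then F (block_pos l) else 0) = (\<Sum>l | l < 2 ^ K - 1 \<and> block l = b. F (block_pos l))"
    by (intro sum.mono_neutral_cong_right) auto
  also have "\<dots> = (\<Sum>i<2 ^ b. F i)"
  proof (rule sum.reindex_bij_witness[of _ "\<lambda>i. 2 ^ b - 1 + i" block_pos])
    fix l assume "l \<in> {l. l < 2 ^ K - 1 \<and> block l = b}"
    then have l: "block l = b" by simp
    show "2 ^ b - 1 + block_pos l = l" using Suc_eq_block[of l] one_le_power[of "2::nat" b] unfolding l by linarith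
    show "block_pos l \<in> {..<2 ^ b}" using block_pos_less[of l] unfolding l by simp
  next
    fix i assume "i \<in> {..<(2::nat) ^ b}"
    then have i: "i < 2 ^ b" by simp
    show "block_pos (2 ^ b - 1 + i) = i" by (rule block_of(2)[OF i])
    show "2 ^ b - 1 + i \<in> {l. l < 2 ^ K - 1 \<and> block l = b}"
      unfolding mem_Collect_eq block_less_iff[symmetric] block_of(1)[OF i] using assms by simp
  qed simp
  finally show ?thesis .
qed

text \<open>
  The infinite block diagonal matrix with the Haar matrices as blocks. Its leading square parts of size
  \<open>2\<^sup>K - 1\<close> are orthogonal.
\<close>
definition mixing_matrix :: "nat \<Rightarrow> nat \<Rightarrow> real" where
  "mixing_matrix n l = (if block n = block l then haar_matrix (block n) (block_pos n) (block_pos l) else 0)"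

lemma mixing_matrix_rows:
  assumes "n < 2 ^ K - 1"
  shows "(\<Sum>l<2 ^ K - 1. mixing_matrix n l * mixing_matrix m l) = (if n = m then 1 else 0)"
proof -
  define b where "b = block n"
  have K: "b < K" using assms by (simp add: block_less_iff b_def)
  have "(\<Sum>l<2 ^ K - 1. mixing_matrix n l * mixing_matrix m l)
     = (\<Sum>l<2 ^ K - 1. if block l = b then (\<lambda>i. if block m = b then haar_matrix b (block_pos n) i * haar_matrix b (block_pos m) i else 0) (block_pos l) else 0)"
    by (intro sum.cong refl) (simp add: mixing_matrix_def b_def)
  also have "\<dots> = (\<Sum>i<2 ^ b. if block m = b then haar_matrix b (block_pos n) i * haar_matrix b (block_pos m) i else 0)"
    by (rule sum_over_block[OF K])
  also have "\<dots> = (if n = m then 1 else 0)"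
  proof (cases "block m = b")
    case True
    then have "block_pos n < 2 ^ b" "block_pos m < 2 ^ b" and eq: "block_pos n = block_pos m \<longleftrightarrow> n = m"
      using block_pos_less[of n] block_pos_less[of m] block_eqI[of n m] by (auto simp: b_def)
    then show ?thesis using True by (simp add: haar_matrix_row_orthonormal)
  qed (auto simp: b_def)
  finally show ?thesis .
qed

lemma mixing_matrix_columns:
  assumes "l < 2 ^ K - 1"
  shows "(\<Sum>n<2 ^ K - 1. mixing_matrix n l * mixing_matrix n m) = (if l = m then 1 else 0)"
proof -
  define b where "b = block l"
  have K: "b < K" using assms by (simp add: block_less_iff b_def)
  have "(\<Sum>n<2 ^ K - 1. mixing_matrix n l * mixing_matrix n m)
     = (\<Sum>n<2 ^ K - 1. if block n = b then (\<lambda>i. if block m = b then haar_matrix b i (block_pos l) * haar_matrix b i (block_pos m) else 0) (block_pos n) else 0)"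
    by (intro sum.cong refl) (simp add: mixing_matrix_def b_def)
  also have "\<dots> = (\<Sum>i<2 ^ b. if block m = b then haar_matrix b i (block_pos l) * haar_matrix b i (block_pos m) else 0)"
    by (rule sum_over_block[OF K])
  also have "\<dots> = (if l = m then 1 else 0)"
  proof (cases "block m = b")
    case True
    then have "block_pos l < 2 ^ b" "block_pos m < 2 ^ b" and eq: "block_pos l = block_pos m \<longleftrightarrow> l = m"
      using block_pos_less[of l] block_pos_less[of m] block_eqI[of l m] by (auto simp: b_def)
    then show ?thesis using True by (simp add: haar_matrix_column_orthonormal)
  qed (auto simp: b_def)
  finally show ?thesis .
qed

lemma mixing_matrix_row_l1:
  assumes "n < 2 ^ K - 1"
  shows "(\<Sum>l<2 ^ K - 1. \<bar>mixing_matrix n l\<bar>) \<le> 3"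
proof -
  define b where "b = block n"
  have K: "b < K" using assms by (simp add: block_less_iff b_def)
  have "(\<Sum>l<2 ^ K - 1. \<bar>mixing_matrix n l\<bar>)
     = (\<Sum>l<2 ^ K - 1. if block l = b then (\<lambda>i. \<bar>haar_matrix b (block_pos n) i\<bar>) (block_pos l) else 0)"
    by (intro sum.cong refl) (simp add: mixing_matrix_def b_def)
  also have "\<dots> = (\<Sum>i<2 ^ b. \<bar>haar_matrix b (block_pos n) i\<bar>)"
    by (rule sum_over_block[OF K])
  also have "\<dots> \<le> 3" using haar_matrix_row_l1[OF block_pos_less[of n]] by (simp add: b_def)
  finally show ?thesis .
qed

text \<open>
  Every row meets exactly one column at the start of a block, namely that of its own block.
\<close>
lemma mixing_matrix_first_columns:
  assumes "n < 2 ^ K - 1"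
  shows "(\<Sum>l | l < 2 ^ K - 1 \<and> block_pos l = 0. \<bar>mixing_matrix n l\<bar>) = 1 / sqrt (2 ^ block n)"
proof -
  define b where "b = block n"
  have K: "b < K" using assms by (simp add: block_less_iff b_def)
  have "(\<Sum>l | l < 2 ^ K - 1 \<and> block_pos l = 0. \<bar>mixing_matrix n l\<bar>)
     = (\<Sum>l<2 ^ K - 1. if block_pos l = 0 then \<bar>mixing_matrix n l\<bar> else 0)"
    by (intro sum.mono_neutral_cong_left) auto
  also have "\<dots> = (\<Sum>l<2 ^ K - 1. if block l = b then (\<lambda>i. if i = 0 then 1 / sqrt (2 ^ b) else 0) (block_pos l) else 0)"
    by (intro sum.cong refl) (simp add: mixing_matrix_def b_def haar_matrix_first_column)
  also have "\<dots> = (\<Sum>i<2 ^ b. if i = (0::nat) then 1 / sqrt (2 ^ b) else 0)"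
    by (rule sum_over_block[OF K])
  also have "\<dots> = 1 / sqrt (2 ^ block n)" by (simp add: b_def)
  finally show ?thesis .
qed

lemma orthonormal_rows_isometry:
  fixes a :: "'i \<Rightarrow> 'j \<Rightarrow> real" and c :: "'i \<Rightarrow> complex"
  assumes "finite I" and orth: "\<And>n m. n \<in> I \<Longrightarrow> m \<in> I \<Longrightarrow> (\<Sum>l\<in>L. a n l * a m l) = (if n = m then 1 else 0)"
  shows "(\<Sum>l\<in>L. (norm (\<Sum>n\<in>I. c n * of_real (a n l)))\<^sup>2) = (\<Sum>n\<in>I. (norm (c n))\<^sup>2)"
proof -
  have "complex_of_real (\<Sum>l\<in>L. (norm (\<Sum>n\<in>I. c n * of_real (a n l)))\<^sup>2)
      = (\<Sum>l\<in>L. \<Sum>n\<in>I. \<Sum>m\<in>I. c n * cnj (c m) * of_real (a n l * a m l))"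
    unfolding of_real_sum complex_norm_square by (simp add: sum_product mult_ac)
  also have "\<dots> = (\<Sum>n\<in>I. \<Sum>m\<in>I. \<Sum>l\<in>L. c n * cnj (c m) * of_real (a n l * a m l))"
    by (subst sum.swap, intro sum.cong refl sum.swap)
  also have "\<dots> = (\<Sum>n\<in>I. \<Sum>m\<in>I. c n * cnj (c m) * of_real (\<Sum>l\<in>L. a n l * a m l))"
    by (simp add: sum_distrib_left)
  also have "\<dots> = (\<Sum>n\<in>I. \<Sum>m\<in>I. if m = n then c n * cnj (c n) else 0)"
    by (intro sum.cong refl) (auto simp: orth)
  also have "\<dots> = of_real (\<Sum>n\<in>I. (norm (c n))\<^sup>2)"
    using assms(1) by (simp add: complex_norm_square of_real_sum del: of_real_power)
  finally show ?thesis unfolding of_real_eq_iff .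
qed

text \<open>
  The Rademacher function \<open>r\<^sub>l\<close> is placed at the index \<open>l\<close> itself unless \<open>l\<close> begins a block. The
  free place at the beginning of block \<open>k\<close> takes the \<open>k\<close>-th of the remaining Walsh functions, whose
  indices form this set. It keeps infinitely many Rademacher functions, those at the beginnings of blocks.
\<close>
definition unmixed_walsh :: "nat set" where
  "unmixed_walsh = {m. \<forall>l. block_pos l \<noteq> 0 \<longrightarrow> m \<noteq> 2 ^ l}"

lemma infinite_unmixed_walsh: "infinite unmixed_walsh"
proof -
  have "2 * n + 1 \<in> unmixed_walsh" for n
  proof -
    have "2 * n + 1 \<noteq> 2 ^ l" if l: "block_pos l \<noteq> 0" for l
    proof -
      have "l \<noteq> 0" using l block_of(2)[of 0 0] by (metis One_nat_def add_0 diff_self_eq_0 power_0 zero_less_one)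
      then have "even ((2::nat) ^ l)" by simp
      then show ?thesis by presburger
    qed
    then show ?thesis by (simp add: unmixed_walsh_def)
  qed
  then have "range (\<lambda>n. 2 * n + 1) \<subseteq> unmixed_walsh" by auto
  moreover have "infinite (range (\<lambda>n::nat. 2 * n + 1))"
    by (rule range_inj_infinite) (auto simp: inj_def)
  ultimately show ?thesis using finite_subset by blast
qed

definition walsh_index :: "nat \<Rightarrow> nat" where
  "walsh_index l = (if block_pos l = 0 then enumerate unmixed_walsh (block l) else 2 ^ l)"

lemma walsh_index_unmixed_iff: "walsh_index l \<in> unmixed_walsh \<longleftrightarrow> block_pos l = 0"
  using enumerate_in_set[OF infinite_unmixed_walsh] by (auto simp: walsh_index_def unmixed_walsh_def)

lemma inj_walsh_index: "inj walsh_index"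
proof (rule injI)
  fix l m assume eq: "walsh_index l = walsh_index m"
  then have iff: "block_pos l = 0 \<longleftrightarrow> block_pos m = 0"
    using walsh_index_unmixed_iff by metis
  show "l = m"
  proof (cases "block_pos l = 0")
    case True
    with eq iff have "enumerate unmixed_walsh (block l) = enumerate unmixed_walsh (block m)"
      by (simp add: walsh_index_def)
    then have "block l = block m"
      using inj_enumerate[OF infinite_unmixed_walsh] by (auto dest: injD)
    then show ?thesis by (rule block_eqI) (use True iff in simp)
  next
    case False
    with eq iff show ?thesis by (simp add: walsh_index_def)
  qed
qed

lemma surj_walsh_index: "surj walsh_index"
proof -
  have "\<exists>l. walsh_index l = m" for m
  proof (cases "m \<in> unmixed_walsh")
    case True
    then obtain k where "enumerate unmixed_walsh k = m"
      using enumerate_Ex[OF infinite_unmixed_walsh] by blast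
    then show ?thesis using block_of[of 0 k] by (intro exI[of _ "2 ^ k - 1"]) (simp add: walsh_index_def)
  next
    case False
    then obtain l where "block_pos l \<noteq> 0" "m = 2 ^ l" by (auto simp: unmixed_walsh_def)
    then show ?thesis by (intro exI[of _ l]) (simp add: walsh_index_def)
  qed
  then show ?thesis by (metis surjI)
qed

definition reordered_walsh :: "nat \<Rightarrow> real \<Rightarrow> complex" where
  "reordered_walsh l = walsh (walsh_index l)"

interpretation rw: bounded_orthonormal_system reordered_walsh 1
  by unfold_locales
     (auto simp: reordered_walsh_def LINT_walsh_mult inj_eq[OF inj_walsh_index])

text \<open>The system of the theorem. The sum runs over the blocks up to that of \<open>n\<close>, and only this last one contributes.\<close>
definition mixed_walsh :: "nat \<Rightarrow> real \<Rightarrow> complex" where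
  "mixed_walsh n x = (\<Sum>l<2 ^ Suc (block n) - 1. of_real (mixing_matrix n l) * reordered_walsh l x)"

lemma mixed_walsh_eq:
  assumes "n < 2 ^ K - 1"
  shows "mixed_walsh n x = (\<Sum>l<2 ^ K - 1. of_real (mixing_matrix n l) * reordered_walsh l x)"
  unfolding mixed_walsh_def
proof (rule sum.mono_neutral_left)
  have "block n < K" using assms by (simp add: block_less_iff)
  then have "(2::nat) ^ Suc (block n) \<le> 2 ^ K" by (intro power_increasing) auto
  then show "{..<(2::nat) ^ Suc (block n) - 1} \<subseteq> {..<2 ^ K - 1}" by auto
  show "\<forall>l\<in>{..<2 ^ K - 1} - {..<2 ^ Suc (block n) - 1}. of_real (mixing_matrix n l) * reordered_walsh l x = 0"
  proof
    fix l assume "l \<in> {..<(2::nat) ^ K - 1} - {..<2 ^ Suc (block n) - 1}"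
    then have "\<not> block l < Suc (block n)" unfolding Diff_iff lessThan_iff block_less_iff by blast
    then show "of_real (mixing_matrix n l) * reordered_walsh l x = 0" by (simp add: mixing_matrix_def)
  qed
qed auto

lemma less_block_end: "n \<le> N \<Longrightarrow> n < 2 ^ Suc N - 1"
  using less_exp[of N] unfolding power_Suc mult_2 by linarith

lemma reordered_walsh_eq:
  assumes "l < 2 ^ K - 1"
  shows "reordered_walsh l x = (\<Sum>n<2 ^ K - 1. of_real (mixing_matrix n l) * mixed_walsh n x)"
proof -
  have "(\<Sum>n<2 ^ K - 1. of_real (mixing_matrix n l) * mixed_walsh n x)
     = (\<Sum>n<2 ^ K - 1. \<Sum>m<2 ^ K - 1. of_real (mixing_matrix n l * mixing_matrix n m) * reordered_walsh m x)"
    by (intro sum.cong) (auto simp: mixed_walsh_eq[of _ K] sum_distrib_left mult.assoc)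
  also have "\<dots> = (\<Sum>m<2 ^ K - 1. of_real (\<Sum>n<2 ^ K - 1. mixing_matrix n l * mixing_matrix n m) * reordered_walsh m x)"
    by (subst sum.swap) (simp add: sum_distrib_right)
  also have "\<dots> = (\<Sum>m<2 ^ K - 1. if l = m then reordered_walsh m x else 0)"
    by (intro sum.cong refl, subst mixing_matrix_columns[OF assms]) simp
  finally show ?thesis using assms by simp
qed

interpretation mw: bounded_orthonormal_system mixed_walsh 3
proof
  fix m n :: nat and x :: real
  show "mixed_walsh n \<in> borel_measurable unit_lebesgue"
    unfolding mixed_walsh_def[abs_def] by measurable
  show "cnj (mixed_walsh n x) = mixed_walsh n x"
    by (simp add: mixed_walsh_def rw.cnj_e)
  have n: "n < 2 ^ Suc (max m n) - 1" and m: "m < 2 ^ Suc (max m n) - 1"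
    by (rule less_block_end; simp)+
  show "(LINT x|unit_lebesgue. mixed_walsh m x * mixed_walsh n x) = (if m = n then 1 else 0)"
  proof -
    have "(LINT x|unit_lebesgue. mixed_walsh m x * mixed_walsh n x)
        = (\<Sum>l<2 ^ Suc (max m n) - 1. of_real (mixing_matrix m l) * of_real (mixing_matrix n l))"
      unfolding mixed_walsh_eq[OF m] mixed_walsh_eq[OF n] by (subst rw.LINT_sums_mult) auto
    also have "\<dots> = of_real (\<Sum>l<2 ^ Suc (max m n) - 1. mixing_matrix m l * mixing_matrix n l)"
      by simp
    also have "\<dots> = (if m = n then 1 else 0)"
      by (simp only: mixing_matrix_rows[OF m]) simp
    finally show ?thesis .
  qed
  assume x: "x \<in> {0..1}"
  have "norm (mixed_walsh n x) \<le> (\<Sum>l<2 ^ Suc (max m n) - 1. norm (of_real (mixing_matrix n l) * reordered_walsh l x))"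
    unfolding mixed_walsh_eq[OF n] by (rule norm_sum)
  also have "\<dots> = (\<Sum>l<2 ^ Suc (max m n) - 1. \<bar>mixing_matrix n l\<bar>)"
    by (simp add: norm_mult reordered_walsh_def)
  also have "\<dots> \<le> 3" by (rule mixing_matrix_row_l1[OF n])
  finally show "norm (mixed_walsh n x) \<le> 3" .
qed

lemma coeff_mixed_walsh:
  assumes "1 < p" "f \<in> Lp_space p" "n < 2 ^ K - 1"
  shows "fourier_coeff mixed_walsh f n = (\<Sum>l<2 ^ K - 1. of_real (mixing_matrix n l) * fourier_coeff reordered_walsh f l)"
  unfolding fourier_coeff_def[of mixed_walsh] mixed_walsh_eq[OF assms(3)]
  by (rule rw.LINT_times_sum[OF assms(1,2)])

lemma mixed_walsh_dense:
  assumes p: "1 \<le> p"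
  shows "mw.dense_in_Lp p"
  unfolding mw.dense_in_Lp_def
proof (intro ballI allI impI)
  fix f e assume f: "f \<in> Lp_space p" and e: "0 < (e::real)"
  obtain n c where c: "Lp_norm p (\<lambda>x. f x - (\<Sum>m<2 ^ n. c m * walsh m x)) < e"
    using walsh_sums_dense_Lp[OF p f e] by blast
  define L where "L = inv walsh_index ` {..<2 ^ n}"
  obtain N where "L \<subseteq> {..<N}" using finite_nat_bounded[of L] by (auto simp: L_def)
  then have L: "l < 2 ^ Suc N - 1" if "l \<in> L" for l
    using that by (intro less_block_end) auto
  define d where "d k = (\<Sum>l\<in>L. c (walsh_index l) * of_real (mixing_matrix k l))" for k
  have bij: "bij_betw walsh_index L {..<2 ^ n}"
    unfolding L_def bij_betw_def using surj_f_inv_f[OF surj_walsh_index]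
    by (auto simp: inj_on_def image_image)
  have "(\<Sum>m<2 ^ n. c m * walsh m x) = (\<Sum>k<2 ^ Suc N - 1. d k * mixed_walsh k x)" for x
  proof -
    have "(\<Sum>m<2 ^ n. c m * walsh m x) = (\<Sum>l\<in>L. c (walsh_index l) * reordered_walsh l x)"
      unfolding reordered_walsh_def by (rule sum.reindex_bij_betw[OF bij, symmetric])
    also have "\<dots> = (\<Sum>l\<in>L. \<Sum>k<2 ^ Suc N - 1. c (walsh_index l) * of_real (mixing_matrix k l) * mixed_walsh k x)"
      by (intro sum.cong refl) (simp only: reordered_walsh_eq[OF L] sum_distrib_left mult.assoc)
    also have "\<dots> = (\<Sum>k<2 ^ Suc N - 1. d k * mixed_walsh k x)"
      unfolding d_def by (subst sum.swap) (simp add: sum_distrib_right)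
    finally show ?thesis .
  qed
  then show "\<exists>N c. Lp_norm p (\<lambda>x. f x - (\<Sum>k<N. c k * mixed_walsh k x)) < e"
    using c by auto
qed

text \<open>
  The basic estimate. Returning to the functions before mixing, the part on the first functions
  of the blocks is estimated by the triangle inequality, which produces the weights
  \<open>2\<^bsup>-k/2\<^esup>\<close>, and the Rademacher part by Khintchine, where the matrix does not increase the \<open>\<ell>\<^sub>2\<close>-norm
  of the coefficients.
\<close>
lemma mixed_walsh_sum_le:
  assumes p: "1 \<le> p"
  shows "\<exists>C\<ge>0. \<forall>A c. finite A \<longrightarrow> Lp_norm p (\<lambda>x. \<Sum>n\<in>A. c n * mixed_walsh n x)
    \<le> (\<Sum>n\<in>A. norm (c n) / sqrt (2 ^ block n)) + C * sqrt (\<Sum>n\<in>A. (norm (c n))\<^sup>2)"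
proof -
  obtain C where C: "0 \<le> C" "\<And>J b. finite J \<Longrightarrow>
    Lp_norm p (\<lambda>x. \<Sum>j\<in>J. b j * walsh (2 ^ j) x) \<le> C * sqrt (\<Sum>j\<in>J. (norm (b j))\<^sup>2)"
    using Khintchine[OF p] by blast
  have "Lp_norm p (\<lambda>x. \<Sum>n\<in>A. c n * mixed_walsh n x)
    \<le> (\<Sum>n\<in>A. norm (c n) / sqrt (2 ^ block n)) + C * sqrt (\<Sum>n\<in>A. (norm (c n))\<^sup>2)"
    if A: "finite A" for A c
  proof -
    obtain N where "A \<subseteq> {..<N}" using finite_nat_bounded[OF A] by blast
    then have AI: "n < 2 ^ Suc N - 1" if "n \<in> A" for n
      using that by (intro less_block_end) auto
    define I where "I = {..<2 ^ Suc N - 1 :: nat}"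
    define I0 where "I0 = {l\<in>I. block_pos l = 0}"
    define I1 where "I1 = {l\<in>I. block_pos l \<noteq> 0}"
    have I: "finite I" "finite I0" "finite I1" "I = I0 \<union> I1" "I0 \<inter> I1 = {}"
      by (auto simp: I_def I0_def I1_def)
    define b where "b l = (\<Sum>n\<in>A. c n * of_real (mixing_matrix n l))" for l
    have eq: "(\<Sum>n\<in>A. c n * mixed_walsh n x)
        = (\<Sum>l\<in>I0. b l * reordered_walsh l x) + (\<Sum>l\<in>I1. b l * walsh (2 ^ l) x)" for x
    proof -
      have "(\<Sum>n\<in>A. c n * mixed_walsh n x) = (\<Sum>n\<in>A. \<Sum>l\<in>I. c n * of_real (mixing_matrix n l) * reordered_walsh l x)"
        unfolding I_def by (intro sum.cong refl) (simp only: mixed_walsh_eq[OF AI] sum_distrib_left mult.assoc)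
      also have "\<dots> = (\<Sum>l\<in>I. b l * reordered_walsh l x)"
        unfolding b_def by (subst sum.swap) (simp add: sum_distrib_right)
      also have "\<dots> = (\<Sum>l\<in>I0. b l * reordered_walsh l x) + (\<Sum>l\<in>I1. b l * reordered_walsh l x)"
        unfolding I(4) using I by (intro sum.union_disjoint) auto
      also have "(\<Sum>l\<in>I1. b l * reordered_walsh l x) = (\<Sum>l\<in>I1. b l * walsh (2 ^ l) x)"
        by (intro sum.cong) (auto simp: I1_def reordered_walsh_def walsh_index_def)
      finally show ?thesis .
    qed
    have "Lp_norm p (\<lambda>x. \<Sum>l\<in>I0. b l * reordered_walsh l x) \<le> (\<Sum>l\<in>I0. norm (b l))"
      using rw.Lp_norm_sum_le_l1[OF p, of b I0] by simp
    also have "\<dots> \<le> (\<Sum>l\<in>I0. \<Sum>n\<in>A. norm (c n) * \<bar>mixing_matrix n l\<bar>)"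
      unfolding b_def by (intro sum_mono order.trans[OF norm_sum]) (simp add: norm_mult)
    also have "\<dots> = (\<Sum>n\<in>A. norm (c n) * (\<Sum>l\<in>I0. \<bar>mixing_matrix n l\<bar>))"
      by (subst sum.swap) (simp add: sum_distrib_left)
    also have "\<dots> = (\<Sum>n\<in>A. norm (c n) / sqrt (2 ^ block n))"
      using mixing_matrix_first_columns[OF AI] by (intro sum.cong refl) (simp add: I0_def I_def)
    finally have part0: "Lp_norm p (\<lambda>x. \<Sum>l\<in>I0. b l * reordered_walsh l x) \<le> (\<Sum>n\<in>A. norm (c n) / sqrt (2 ^ block n))" .
    have "(\<Sum>l\<in>I1. (norm (b l))\<^sup>2) \<le> (\<Sum>l\<in>I. (norm (b l))\<^sup>2)"
      using I by (intro sum_mono2) auto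
    also have "\<dots> = (\<Sum>n\<in>A. (norm (c n))\<^sup>2)"
      unfolding b_def I_def using AI by (intro orthonormal_rows_isometry A mixing_matrix_rows) auto
    finally have part1: "Lp_norm p (\<lambda>x. \<Sum>l\<in>I1. b l * walsh (2 ^ l) x) \<le> C * sqrt (\<Sum>n\<in>A. (norm (c n))\<^sup>2)"
      using order.trans[OF C(2)[OF I(3), of b]] C(1) by (simp add: mult_left_mono)
    have "Lp_norm p (\<lambda>x. \<Sum>n\<in>A. c n * mixed_walsh n x)
       \<le> Lp_norm p (\<lambda>x. \<Sum>l\<in>I0. b l * reordered_walsh l x) + Lp_norm p (\<lambda>x. \<Sum>l\<in>I1. b l * walsh (2 ^ l) x)"
      unfolding eq using p by (intro Lp_norm_triangle rw.sum_in_Lp Lp_space_sum Lp_space_cmult walsh.e_in_Lp) auto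
    with part0 part1 show ?thesis by linarith
  qed
  with C(1) show ?thesis by blast
qed

text \<open>
  The sum is largest for an initial segment. In the induction the largest element \<open>b\<close> is removed,
  which is at least the number \<open>m\<close> of the other elements.
\<close>
lemma sum_inverse_sqrt_le:
  assumes "finite (A :: nat set)"
  shows "(\<Sum>n\<in>A. 1 / sqrt (real (Suc n))) \<le> 2 * sqrt (card A)"
  using assms
proof (induction A rule: finite_linorder_max_induct)
  case (insert b A)
  define m where "m = card A"
  have "A \<subseteq> {..<b}" using insert by auto
  then have mb: "m \<le> b" using card_mono[of "{..<b}" A] by (simp add: m_def)
  define u v where "u = sqrt (real (Suc m))" and "v = sqrt (real m)"
  have uv: "0 < u" "0 \<le> v" "v \<le> u" "u\<^sup>2 - v\<^sup>2 = 1" by (auto simp: u_def v_def)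
  have "1 / sqrt (real (Suc b)) \<le> 1 / u"
    unfolding u_def using mb by (intro divide_left_mono) auto
  also have "\<dots> \<le> 2 * (u - v)"
  proof -
    have "1 = (u - v) * (u + v)" using uv by (simp add: power2_eq_square algebra_simps)
    also have "\<dots> \<le> (u - v) * (2 * u)" using uv by (intro mult_left_mono) auto
    finally show ?thesis using uv by (simp add: pos_divide_le_eq mult_ac)
  qed
  finally have "1 / sqrt (real (Suc b)) + 2 * v \<le> 2 * u" by simp
  moreover have "b \<notin> A" using insert by auto
  ultimately show ?case using insert by (simp add: u_def v_def m_def)
qed simp

lemma block_weight_le: "1 / sqrt (2 ^ block n) \<le> sqrt 2 * (1 / sqrt (real (Suc n)))"
proof -
  have "real (Suc n) \<le> real (2 * 2 ^ block n)"
    unfolding of_nat_le_iff using Suc_eq_block[of n] block_pos_less[of n] by linarith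
  then have "sqrt (real (Suc n)) \<le> sqrt 2 * sqrt (2 ^ block n)"
    by (simp add: real_sqrt_mult[symmetric])
  then show ?thesis by (simp add: field_simps del: of_nat_Suc)
qed

lemma mixed_walsh_square_root_upper_bound:
  assumes p: "1 \<le> p"
  shows "mw.square_root_upper_bound p"
proof -
  obtain C where C: "0 \<le> C" "\<forall>A c. finite A \<longrightarrow> Lp_norm p (\<lambda>x. \<Sum>n\<in>A. c n * mixed_walsh n x)
    \<le> (\<Sum>n\<in>A. norm (c n) / sqrt (2 ^ block n)) + C * sqrt (\<Sum>n\<in>A. (norm (c n))\<^sup>2)"
    using mixed_walsh_sum_le[OF p] by (elim exE conjE)
  have "Lp_norm p (\<lambda>x. \<Sum>n\<in>A. c n * mixed_walsh n x) \<le> (2 * sqrt 2 + C) * (t * sqrt (card A))"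
    if A: "finite A" and c: "\<forall>n\<in>A. norm (c n) \<le> t" for A c t
  proof (cases "A = {}")
    case False
    then have t: "0 \<le> t" using c by (meson all_not_in_conv norm_ge_zero order.trans)
    have "(\<Sum>n\<in>A. norm (c n) / sqrt (2 ^ block n)) \<le> (\<Sum>n\<in>A. t * (sqrt 2 * (1 / sqrt (real (Suc n)))))"
    proof (rule sum_mono)
      fix n assume "n \<in> A"
      then have "norm (c n) * (1 / sqrt (2 ^ block n)) \<le> t * (sqrt 2 * (1 / sqrt (real (Suc n))))"
        using c t block_weight_le[of n] by (intro mult_mono) auto
      then show "norm (c n) / sqrt (2 ^ block n) \<le> t * (sqrt 2 * (1 / sqrt (real (Suc n))))" by simp
    qed
    also have "\<dots> = t * sqrt 2 * (\<Sum>n\<in>A. 1 / sqrt (real (Suc n)))"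
      by (simp add: sum_distrib_left mult.assoc)
    also have "\<dots> \<le> t * sqrt 2 * (2 * sqrt (card A))"
      using t by (intro mult_left_mono sum_inverse_sqrt_le A) auto
    finally have 1: "(\<Sum>n\<in>A. norm (c n) / sqrt (2 ^ block n)) \<le> 2 * sqrt 2 * (t * sqrt (card A))"
      by (simp add: mult_ac)
    have "(\<Sum>n\<in>A. (norm (c n))\<^sup>2) \<le> (\<Sum>n\<in>A. t\<^sup>2)"
      using c by (intro sum_mono power_mono) auto
    then have "sqrt (\<Sum>n\<in>A. (norm (c n))\<^sup>2) \<le> sqrt (t\<^sup>2 * card A)"
      by (simp add: mult.commute)
    also have "\<dots> = t * sqrt (card A)" using t by (simp add: real_sqrt_mult)
    finally have 2: "C * sqrt (\<Sum>n\<in>A. (norm (c n))\<^sup>2) \<le> C * (t * sqrt (card A))"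
      using C by (intro mult_left_mono) auto
    show ?thesis using C(2)[rule_format, OF A, of c] 1 2 by (simp add: distrib_right)
  qed simp
  then show ?thesis
    unfolding mw.square_root_upper_bound_def using C(1) by (intro exI[of _ "2 * sqrt 2 + C"]) simp
qed

text \<open>
  The numbers \<open>d\<^sub>n\<close> are the contribution of the Rademacher coefficients of \<open>f\<close>, which are square summable.
  What remains comes from the single coefficient at the beginning of the block, of modulus at most
  \<open>\<parallel>f\<parallel>\<^sub>p\<close>, with the weight \<open>2\<^bsup>-k/2\<^esup>\<close>.
  For \<open>p < 2\<close> the coefficients themselves need not be square summable, hence the split.
\<close>
lemma mixed_walsh_coeff_split:
  assumes p: "1 < p"
  shows "\<exists>C\<ge>0. \<forall>f\<in>Lp_space p. \<forall>K. \<exists>d.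
    (\<forall>n<2 ^ K - 1. norm (fourier_coeff mixed_walsh f n - d n) \<le> Lp_norm p f / sqrt (2 ^ block n)) \<and>
    sqrt (\<Sum>n<2 ^ K - 1. (norm (d n))\<^sup>2) \<le> C * Lp_norm p f"
proof -
  obtain C where C: "0 \<le> C" "\<And>f J. f \<in> Lp_space p \<Longrightarrow> finite J \<Longrightarrow>
    sqrt (\<Sum>j\<in>J. (norm (fourier_coeff walsh f (2 ^ j)))\<^sup>2) \<le> C * Lp_norm p f"
    using rademacher_coeffs_square_summable[OF p] by blast
  have "\<exists>d. (\<forall>n<2 ^ K - 1. norm (fourier_coeff mixed_walsh f n - d n) \<le> Lp_norm p f / sqrt (2 ^ block n)) \<and>
    sqrt (\<Sum>n<2 ^ K - 1. (norm (d n))\<^sup>2) \<le> C * Lp_norm p f" if f: "f \<in> Lp_space p" for f K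
  proof -
    define a where "a = fourier_coeff reordered_walsh f"
    define a1 where "a1 l = (if block_pos l = 0 then 0 else a l)" for l
    define d where "d n = (\<Sum>l<2 ^ K - 1. a1 l * of_real (mixing_matrix n l))" for n
    have "norm (fourier_coeff mixed_walsh f n - d n) \<le> Lp_norm p f / sqrt (2 ^ block n)" if n: "n < 2 ^ K - 1" for n
    proof -
      have "fourier_coeff mixed_walsh f n - d n = (\<Sum>l<2 ^ K - 1. if block_pos l = 0 then of_real (mixing_matrix n l) * a l else 0)"
        unfolding coeff_mixed_walsh[OF p f n] d_def sum_subtractf[symmetric] a_def[symmetric]
        by (intro sum.cong) (auto simp: a1_def)
      also have "\<dots> = (\<Sum>l | l < 2 ^ K - 1 \<and> block_pos l = 0. of_real (mixing_matrix n l) * a l)"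
        by (intro sum.mono_neutral_cong_right) auto
      also have "norm \<dots> \<le> (\<Sum>l | l < 2 ^ K - 1 \<and> block_pos l = 0. \<bar>mixing_matrix n l\<bar> * Lp_norm p f)"
        using rw.norm_coeff_le[OF p f]
        by (intro order.trans[OF norm_sum] sum_mono) (simp add: norm_mult a_def mult_left_mono)
      also have "\<dots> = Lp_norm p f / sqrt (2 ^ block n)"
        unfolding sum_distrib_right[symmetric] mixing_matrix_first_columns[OF n] by simp
      finally show ?thesis .
    qed
    moreover have "sqrt (\<Sum>n<2 ^ K - 1. (norm (d n))\<^sup>2) \<le> C * Lp_norm p f"
    proof -
      have "(\<Sum>n<2 ^ K - 1. (norm (d n))\<^sup>2) = (\<Sum>l<2 ^ K - 1. (norm (a1 l))\<^sup>2)"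
        unfolding d_def by (rule orthonormal_rows_isometry[where a = "\<lambda>l n. mixing_matrix n l"]) (rule finite_lessThan, rule mixing_matrix_columns, unfold lessThan_iff)
      also have "\<dots> = (\<Sum>l | l < 2 ^ K - 1 \<and> block_pos l \<noteq> 0. (norm (fourier_coeff walsh f (2 ^ l)))\<^sup>2)"
        by (intro sum.mono_neutral_cong_right)
           (auto simp: a1_def a_def fourier_coeff_def reordered_walsh_def walsh_index_def)
      finally show ?thesis using C(2)[OF f, of "{l. l < 2 ^ K - 1 \<and> block_pos l \<noteq> 0}"] by simp
    qed
    ultimately show ?thesis by blast
  qed
  with C(1) show ?thesis by blast
qed

section \<open>Partial sums and threshold sums of the mixed Walsh system\<close>

lemma block_end_sum_eq:
  assumes p: "1 < p" and f: "f \<in> Lp_space p"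
  shows "(\<Sum>n<2 ^ K - 1. fourier_coeff mixed_walsh f n * mixed_walsh n x)
    = (\<Sum>l<2 ^ K - 1. fourier_coeff reordered_walsh f l * reordered_walsh l x)"
proof -
  have "(\<Sum>n<2 ^ K - 1. fourier_coeff mixed_walsh f n * mixed_walsh n x)
      = (\<Sum>n<2 ^ K - 1. \<Sum>l<2 ^ K - 1. fourier_coeff reordered_walsh f l * (of_real (mixing_matrix n l) * mixed_walsh n x))"
    by (intro sum.cong refl) (simp only: coeff_mixed_walsh[OF p f] lessThan_iff sum_distrib_left mult_ac)
  also have "\<dots> = (\<Sum>l<2 ^ K - 1. fourier_coeff reordered_walsh f l * (\<Sum>n<2 ^ K - 1. of_real (mixing_matrix n l) * mixed_walsh n x))"
    by (subst sum.swap) (simp only: sum_distrib_left)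
  also have "\<dots> = (\<Sum>l<2 ^ K - 1. fourier_coeff reordered_walsh f l * reordered_walsh l x)"
    by (intro sum.cong refl) (simp only: reordered_walsh_eq lessThan_iff)
  finally show ?thesis .
qed

text \<open>
  At the end of a block the partial sum is unaffected by the mixing. It is then a partial sum of the Walsh
  series in which Rademacher terms are exchanged: those set aside for the mixing are removed from it, and
  those of the first \<open>K\<close> blocks are added.
\<close>
lemma mixed_walsh_block_end_sums_bounded:
  assumes p: "1 < p"
  shows "\<exists>C\<ge>0. \<forall>f\<in>Lp_space p. \<forall>K.
    Lp_norm p (\<lambda>x. \<Sum>n<2 ^ K - 1. fourier_coeff mixed_walsh f n * mixed_walsh n x) \<le> C * Lp_norm p f"
proof -
  obtain C where C: "0 \<le> C" "\<And>f N. f \<in> Lp_space p \<Longrightarrow>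
      Lp_norm p (\<lambda>x. \<Sum>m<N. fourier_coeff walsh f m * walsh m x) \<le> C * Lp_norm p f"
    using walsh_partial_sum_bounded[OF p] by blast
  obtain R where R: "0 \<le> R" "\<And>f J. f \<in> Lp_space p \<Longrightarrow> finite J \<Longrightarrow>
    Lp_norm p (\<lambda>x. \<Sum>j\<in>J. fourier_coeff walsh f (2 ^ j) * walsh (2 ^ j) x) \<le> R * Lp_norm p f"
    using rademacher_projection_bounded[OF p] by blast
  have "Lp_norm p (\<lambda>x. \<Sum>n<2 ^ K - 1. fourier_coeff mixed_walsh f n * mixed_walsh n x) \<le> (C + R + R) * Lp_norm p f"
    if f: "f \<in> Lp_space p" for f K
  proof -
    define a where "a m x = fourier_coeff walsh f m * walsh m x" for m x
    define N where "N = enumerate unmixed_walsh K"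
    define I0 where "I0 = {l. l < 2 ^ K - 1 \<and> block_pos l = 0}"
    define I1 where "I1 = {l. l < 2 ^ K - 1 \<and> block_pos l \<noteq> 0}"
    define J where "J = {j. block_pos j \<noteq> 0 \<and> (2::nat) ^ j < N}"
    have fin: "finite I0" "finite I1" by (auto simp: I0_def I1_def)
    have "J \<subseteq> {..<N}" unfolding J_def using less_exp order.strict_trans by blast
    then have J: "finite J" by (rule finite_subset) simp
    have bij: "bij_betw walsh_index I0 {m\<in>unmixed_walsh. m < N}"
    proof (rule bij_betwI')
      fix l m assume "l \<in> I0" "m \<in> I0"
      show "walsh_index l = walsh_index m \<longleftrightarrow> l = m" by (rule inj_eq[OF inj_walsh_index])
    next
      fix l assume "l \<in> I0"
      then have l: "block l < K" "block_pos l = 0" by (simp_all add: I0_def block_less_iff)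
      then show "walsh_index l \<in> {m\<in>unmixed_walsh. m < N}"
        using walsh_index_unmixed_iff[of l] enumerate_mono[OF l(1) infinite_unmixed_walsh]
        by (simp add: walsh_index_def N_def)
    next
      fix m assume m: "m \<in> {m\<in>unmixed_walsh. m < N}"
      then obtain l where l: "m = walsh_index l" using surj_walsh_index by (metis surjD)
      then have pos: "block_pos l = 0" using m walsh_index_unmixed_iff by simp
      then have "enumerate unmixed_walsh (block l) < enumerate unmixed_walsh K"
        using l m by (simp add: walsh_index_def N_def)
      then have "block l < K" using enumerate_mono_iff[OF infinite_unmixed_walsh] by simp
      then have "l \<in> I0" using pos by (simp add: I0_def block_less_iff)
      then show "\<exists>l\<in>I0. m = walsh_index l" using l by blast
    qed
    have "(\<Sum>n<2 ^ K - 1. fourier_coeff mixed_walsh f n * mixed_walsh n x)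
        = (\<Sum>m<N. a m x) - (\<Sum>j\<in>J. a (2 ^ j) x) + (\<Sum>j\<in>I1. a (2 ^ j) x)" for x
    proof -
      have "{..<2 ^ K - 1} = I0 \<union> I1" "I0 \<inter> I1 = {}" by (auto simp: I0_def I1_def)
      then have "(\<Sum>n<2 ^ K - 1. fourier_coeff mixed_walsh f n * mixed_walsh n x)
          = (\<Sum>l\<in>I0. a (walsh_index l) x) + (\<Sum>l\<in>I1. a (walsh_index l) x)"
        unfolding block_end_sum_eq[OF p f] using fin
        by (simp add: sum.union_disjoint a_def reordered_walsh_def fourier_coeff_def)
      also have "(\<Sum>l\<in>I1. a (walsh_index l) x) = (\<Sum>j\<in>I1. a (2 ^ j) x)"
        by (intro sum.cong) (auto simp: I1_def walsh_index_def)
      also have "(\<Sum>l\<in>I0. a (walsh_index l) x) = (\<Sum>m\<in>{m\<in>unmixed_walsh. m < N}. a m x)"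
        by (rule sum.reindex_bij_betw[OF bij])
      also have "\<dots> = (\<Sum>m<N. a m x) - (\<Sum>m\<in>(\<lambda>j. 2 ^ j) ` J. a m x)"
      proof -
        have "{..<N} = {m\<in>unmixed_walsh. m < N} \<union> (\<lambda>j. 2 ^ j) ` J"
          "{m\<in>unmixed_walsh. m < N} \<inter> (\<lambda>j. 2 ^ j) ` J = {}"
          by (auto simp: J_def unmixed_walsh_def)
        then show ?thesis using J by (simp add: sum.union_disjoint)
      qed
      also have "(\<Sum>m\<in>(\<lambda>j. 2 ^ j) ` J. a m x) = (\<Sum>j\<in>J. a (2 ^ j) x)"
        by (subst sum.reindex) (auto simp: inj_on_def)
      finally show ?thesis .
    qed
    moreover have L: "(\<lambda>x. \<Sum>m<N. a m x) \<in> Lp_space p" "(\<lambda>x. \<Sum>j\<in>J. a (2 ^ j) x) \<in> Lp_space p" "(\<lambda>x. \<Sum>j\<in>I1. a (2 ^ j) x) \<in> Lp_space p"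
      unfolding a_def using p by (intro Lp_space_sum Lp_space_cmult walsh.e_in_Lp; simp)+
    moreover have "Lp_norm p (\<lambda>x. (\<Sum>m<N. a m x) - (\<Sum>j\<in>J. a (2 ^ j) x) + (\<Sum>j\<in>I1. a (2 ^ j) x))
       \<le> Lp_norm p (\<lambda>x. \<Sum>m<N. a m x) + Lp_norm p (\<lambda>x. \<Sum>j\<in>J. a (2 ^ j) x) + Lp_norm p (\<lambda>x. \<Sum>j\<in>I1. a (2 ^ j) x)"
      using p order.trans[OF Lp_norm_triangle[OF _ Lp_space_diff[OF _ L(1,2)] L(3)] add_right_mono[OF Lp_norm_triangle_diff[OF _ L(1,2)]]]
      by simp
    moreover have "Lp_norm p (\<lambda>x. \<Sum>m<N. a m x) \<le> C * Lp_norm p f"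
      "Lp_norm p (\<lambda>x. \<Sum>j\<in>J. a (2 ^ j) x) \<le> R * Lp_norm p f"
      "Lp_norm p (\<lambda>x. \<Sum>j\<in>I1. a (2 ^ j) x) \<le> R * Lp_norm p f"
      unfolding a_def by (rule C(2)[OF f] R(2)[OF f J] R(2)[OF f fin(2)])+
    ultimately show ?thesis by (simp add: distrib_right)
  qed
  then show ?thesis using C(1) R(1) by (intro exI[of _ "C + R + R"]) auto
qed

text \<open>
  A partial sum exceeds a partial sum at the end of a block by a piece of one single block. There the
  \<open>2\<^sup>k\<close> terms \<open>2\<^bsup>-k/2\<^esup> a\<^sub>k\<close> of the coefficients have \<open>\<ell>\<^sub>2\<close>-norm at most \<open>\<bar>a\<^sub>k\<bar>\<close>, so the coefficients
  within the block are square summable with a uniform bound.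
\<close>
lemma mixed_walsh_bounded_partial_sums:
  assumes p: "1 < p"
  shows "mw.bounded_partial_sums p"
proof -
  obtain E where E: "0 \<le> E" "\<And>f K. f \<in> Lp_space p \<Longrightarrow>
      Lp_norm p (\<lambda>x. \<Sum>n<2 ^ K - 1. fourier_coeff mixed_walsh f n * mixed_walsh n x) \<le> E * Lp_norm p f"
    using mixed_walsh_block_end_sums_bounded[OF p] by blast
  obtain C where C: "0 \<le> C" "\<forall>A c. finite A \<longrightarrow> Lp_norm p (\<lambda>x. \<Sum>n\<in>A. c n * mixed_walsh n x)
    \<le> (\<Sum>n\<in>A. norm (c n) / sqrt (2 ^ block n)) + C * sqrt (\<Sum>n\<in>A. (norm (c n))\<^sup>2)"
    using mixed_walsh_sum_le[OF less_imp_le[OF p]] by (elim exE conjE)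
  obtain S where S: "0 \<le> S" "\<forall>f\<in>Lp_space p. \<forall>K. \<exists>d.
    (\<forall>n<2 ^ K - 1. norm (fourier_coeff mixed_walsh f n - d n) \<le> Lp_norm p f / sqrt (2 ^ block n)) \<and>
    sqrt (\<Sum>n<2 ^ K - 1. (norm (d n))\<^sup>2) \<le> S * Lp_norm p f"
    using mixed_walsh_coeff_split[OF p] by (elim exE conjE)
  have "Lp_norm p (\<lambda>x. \<Sum>n<N. fourier_coeff mixed_walsh f n * mixed_walsh n x)
      \<le> (E + (1 + C) * sqrt (2 + 2 * S\<^sup>2)) * Lp_norm p f" if f: "f \<in> Lp_space p" for f N
  proof -
    define c where "c = fourier_coeff mixed_walsh f"
    define F where "F = Lp_norm p f"
    define k where "k = block N"
    define A where "A = {2 ^ k - 1..<N}"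
    have N: "2 ^ k - 1 \<le> N" "N < 2 ^ Suc k - 1"
      using block_less_iff[of N k] block_less_iff[of N "Suc k"] by (auto simp: k_def)
    have block: "block n = k" if "n \<in> A" for n
    proof -
      have "\<not> n < 2 ^ k - 1" "n < 2 ^ Suc k - 1" using that N by (auto simp: A_def)
      then show ?thesis unfolding block_less_iff[symmetric] by simp
    qed
    have A: "finite A" by (simp add: A_def)
    have cardA: "card A \<le> 2 ^ k" using N by (simp add: A_def)
    obtain d where d: "\<And>n. n < 2 ^ Suc k - 1 \<Longrightarrow> norm (c n - d n) \<le> F / sqrt (2 ^ block n)"
      "sqrt (\<Sum>n<2 ^ Suc k - 1. (norm (d n))\<^sup>2) \<le> S * F"
      using S(2) f unfolding c_def F_def by blast
    have sq: "(norm (c n))\<^sup>2 \<le> 2 * F\<^sup>2 / 2 ^ k + 2 * (norm (d n))\<^sup>2" if n: "n \<in> A" for n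
    proof -
      have "norm (c n - d n) \<le> F / sqrt (2 ^ k)"
        using d(1)[of n] n N block[OF n] by (simp add: A_def)
      then have u: "(norm (c n - d n))\<^sup>2 \<le> (F / sqrt (2 ^ k))\<^sup>2" by (intro power_mono) auto
      have "norm (c n) \<le> norm (c n - d n) + norm (d n)" by (metis norm_triangle_ineq diff_add_cancel)
      then have "(norm (c n))\<^sup>2 \<le> (norm (c n - d n) + norm (d n))\<^sup>2" by (intro power_mono) auto
      also have "\<dots> \<le> 2 * (norm (c n - d n))\<^sup>2 + 2 * (norm (d n))\<^sup>2"
        using sum_squares_bound[of "norm (c n - d n)" "norm (d n)"] by (simp add: power2_sum)
      finally show ?thesis using u by (simp add: power_divide)
    qed
    have "(\<Sum>n\<in>A. (norm (c n))\<^sup>2) \<le> (\<Sum>n\<in>A. 2 * F\<^sup>2 / 2 ^ k + 2 * (norm (d n))\<^sup>2)"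
      by (intro sum_mono sq)
    also have "\<dots> = card A * (2 * F\<^sup>2 / 2 ^ k) + 2 * (\<Sum>n\<in>A. (norm (d n))\<^sup>2)"
      by (simp add: sum.distrib sum_distrib_left)
    also have "\<dots> \<le> 2 ^ k * (2 * F\<^sup>2 / 2 ^ k) + 2 * (S * F)\<^sup>2"
    proof (intro add_mono mult_right_mono mult_left_mono)
      show "real (card A) \<le> 2 ^ k" using cardA by (metis of_nat_le_iff of_nat_numeral of_nat_power)
      have "(\<Sum>n\<in>A. (norm (d n))\<^sup>2) \<le> (\<Sum>n<2 ^ Suc k - 1. (norm (d n))\<^sup>2)"
        using N by (intro sum_mono2) (auto simp: A_def)
      also have "\<dots> = (sqrt (\<Sum>n<2 ^ Suc k - 1. (norm (d n))\<^sup>2))\<^sup>2"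
        by (simp add: sum_nonneg)
      also have "\<dots> \<le> (S * F)\<^sup>2"
        using d(2) by (intro power_mono) (auto simp: sum_nonneg)
      finally show "(\<Sum>n\<in>A. (norm (d n))\<^sup>2) \<le> (S * F)\<^sup>2" .
    qed auto
    also have "\<dots> = (2 + 2 * S\<^sup>2) * F\<^sup>2" by (simp add: algebra_simps power_mult_distrib)
    finally have "sqrt (\<Sum>n\<in>A. (norm (c n))\<^sup>2) \<le> sqrt ((2 + 2 * S\<^sup>2) * F\<^sup>2)" by (rule real_sqrt_le_mono)
    then have sqA: "sqrt (\<Sum>n\<in>A. (norm (c n))\<^sup>2) \<le> sqrt (2 + 2 * S\<^sup>2) * F"
      by (simp add: real_sqrt_mult F_def)
    have "(\<Sum>n\<in>A. norm (c n) / sqrt (2 ^ block n)) = (\<Sum>n\<in>A. \<bar>norm (c n)\<bar> * \<bar>1 / sqrt (2 ^ k)\<bar>)"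
      by (intro sum.cong) (auto simp: block)
    also have "\<dots> \<le> L2_set (\<lambda>n. norm (c n)) A * L2_set (\<lambda>n. 1 / sqrt (2 ^ k)) A"
      by (rule L2_set_mult_ineq)
    also have "\<dots> \<le> L2_set (\<lambda>n. norm (c n)) A * 1"
    proof (intro mult_left_mono)
      have "real (card A) \<le> 2 ^ k" using cardA by (metis of_nat_le_iff of_nat_numeral of_nat_power)
      then show "L2_set (\<lambda>n. 1 / sqrt (2 ^ k)) A \<le> 1"
        by (simp add: L2_set_def power_divide divide_le_eq)
    qed (simp add: L2_set_nonneg)
    finally have l1: "(\<Sum>n\<in>A. norm (c n) / sqrt (2 ^ block n)) \<le> sqrt (\<Sum>n\<in>A. (norm (c n))\<^sup>2)"
      by (simp add: L2_set_def)
    have eq: "(\<Sum>n<N. c n * mixed_walsh n x) = (\<Sum>n<2 ^ k - 1. c n * mixed_walsh n x) + (\<Sum>n\<in>A. c n * mixed_walsh n x)" for x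
      unfolding A_def lessThan_atLeast0 using N by (intro sum.atLeastLessThan_concat[symmetric]) auto
    have "Lp_norm p (\<lambda>x. \<Sum>n<N. c n * mixed_walsh n x)
        \<le> Lp_norm p (\<lambda>x. \<Sum>n<2 ^ k - 1. c n * mixed_walsh n x) + Lp_norm p (\<lambda>x. \<Sum>n\<in>A. c n * mixed_walsh n x)"
      unfolding eq using p by (intro Lp_norm_triangle mw.sum_in_Lp) auto
    also have "\<dots> \<le> E * F + ((\<Sum>n\<in>A. norm (c n) / sqrt (2 ^ block n)) + C * sqrt (\<Sum>n\<in>A. (norm (c n))\<^sup>2))"
      unfolding c_def F_def by (intro add_mono E(2) f C(2)[rule_format] A)
    also have "\<dots> \<le> E * F + (1 + C) * sqrt (\<Sum>n\<in>A. (norm (c n))\<^sup>2)"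
      using l1 by (simp add: distrib_right)
    also have "\<dots> \<le> E * F + (1 + C) * (sqrt (2 + 2 * S\<^sup>2) * F)"
      using sqA C(1) by (intro add_left_mono mult_left_mono) auto
    finally show ?thesis by (simp add: c_def F_def algebra_simps)
  qed
  then show ?thesis
    unfolding mw.bounded_partial_sums_def using E(1) C(1)
    by (intro exI[of _ "E + (1 + C) * sqrt (2 + 2 * S\<^sup>2)"]) auto
qed

text \<open>
  The set \<open>I\<close> below comprises the blocks in which \<open>2\<^bsup>-k/2\<^esup> \<parallel>f\<parallel>\<^sub>p > t/2\<close>, and \<open>H\<close> the elements of \<open>A\<close> in later
  blocks. On \<open>H\<close> one has \<open>2\<^bsup>-k/2\<^esup> \<parallel>f\<parallel>\<^sub>p \<le> t/2 \<le> \<bar>d\<^sub>n\<bar>\<close> and \<open>\<bar>c\<^sub>n\<bar> \<le> 2 \<bar>d\<^sub>n\<bar>\<close>, so that both terms of the basic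
  estimate are controlled by \<open>\<Sum> \<bar>d\<^sub>n\<bar>\<^sup>2\<close>. The sum over \<open>A \<inter> I\<close> is the partial sum over \<open>I\<close> minus
  the sum over \<open>I - A\<close>, whose coefficients are at most \<open>t\<close>.
\<close>
lemma mixed_walsh_bounded_threshold_sums:
  assumes p: "1 < p"
  shows "mw.bounded_threshold_sums p"
proof -
  obtain P where P: "0 \<le> P" "\<And>f N. f \<in> Lp_space p \<Longrightarrow>
      Lp_norm p (\<lambda>x. \<Sum>n<N. fourier_coeff mixed_walsh f n * mixed_walsh n x) \<le> P * Lp_norm p f"
    using mixed_walsh_bounded_partial_sums[OF p] unfolding mw.bounded_partial_sums_def by blast
  obtain D where D: "0 \<le> D" "\<forall>A c t. finite A \<longrightarrow> (\<forall>n\<in>A. norm (c n) \<le> t) \<longrightarrow>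
       Lp_norm p (\<lambda>x. \<Sum>n\<in>A. c n * mixed_walsh n x) \<le> D * (t * sqrt (card A))"
    using mixed_walsh_square_root_upper_bound[OF less_imp_le[OF p]]
    unfolding mw.square_root_upper_bound_def by (elim exE conjE)
  obtain C where C: "0 \<le> C" "\<forall>A c. finite A \<longrightarrow> Lp_norm p (\<lambda>x. \<Sum>n\<in>A. c n * mixed_walsh n x)
    \<le> (\<Sum>n\<in>A. norm (c n) / sqrt (2 ^ block n)) + C * sqrt (\<Sum>n\<in>A. (norm (c n))\<^sup>2)"
    using mixed_walsh_sum_le[OF less_imp_le[OF p]] by (elim exE conjE)
  obtain S where S: "0 \<le> S" "\<forall>f\<in>Lp_space p. \<forall>K. \<exists>d.
    (\<forall>n<2 ^ K - 1. norm (fourier_coeff mixed_walsh f n - d n) \<le> Lp_norm p f / sqrt (2 ^ block n)) \<and>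
    sqrt (\<Sum>n<2 ^ K - 1. (norm (d n))\<^sup>2) \<le> S * Lp_norm p f"
    using mixed_walsh_coeff_split[OF p] by (elim exE conjE)
  define Q where "Q = 2 * S\<^sup>2 + 2 * C * S + P + 2 * sqrt 2 * D"
  have Q: "P \<le> Q" "0 \<le> Q" using S(1) C(1) D(1) P(1) by (auto simp: Q_def)
  have "Lp_norm p (\<lambda>x. \<Sum>n\<in>A. fourier_coeff mixed_walsh f n * mixed_walsh n x) \<le> Q * Lp_norm p f"
    if f: "f \<in> Lp_space p" and A: "finite A" and t0: "0 \<le> t"
      and ge: "\<forall>n\<in>A. t \<le> norm (fourier_coeff mixed_walsh f n)"
      and le: "\<forall>n. n \<notin> A \<longrightarrow> norm (fourier_coeff mixed_walsh f n) \<le> t" for f A t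
  proof -
    define c where "c = fourier_coeff mixed_walsh f"
    define F where "F = Lp_norm p f"
    have F0: "0 \<le> F" by (simp add: F_def)
    obtain N where N: "A \<subseteq> {..<N}" using finite_nat_bounded[OF A] by blast
    show ?thesis
    proof (cases "t = 0 \<or> A = {}")
      case True
      then show ?thesis
      proof
        assume "t = 0"
        have "(\<Sum>n<N. c n * mixed_walsh n x) = (\<Sum>n\<in>A. c n * mixed_walsh n x)" for x
          using N le \<open>t = 0\<close> by (intro sum.mono_neutral_right) (auto simp: c_def)
        then have "Lp_norm p (\<lambda>x. \<Sum>n\<in>A. c n * mixed_walsh n x) \<le> P * F"
          using P(2)[OF f, of N] by (simp add: c_def F_def)
        also have "\<dots> \<le> Q * F" using Q F0 by (intro mult_right_mono)
        finally show ?thesis by (simp add: c_def F_def)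
      qed (use Q in simp)
    next
      case False
      then have t: "0 < t" using t0 by simp
      have "F \<noteq> 0"
      proof
        assume "F = 0"
        then have "c n = 0" for n
          using mw.norm_coeff_le[OF p f, of n] by (simp add: c_def F_def)
        then show False using False ge t by (auto simp: c_def)
      qed
      then have F: "0 < F" using F0 by simp
      have "\<exists>k. F / sqrt (2 ^ k) \<le> t / 2"
      proof -
        obtain k where k: "(2 * F / t)\<^sup>2 < 2 ^ k" using real_arch_pow[of 2] by auto
        have "2 * F / t \<le> sqrt (2 ^ k)"
          using k by (intro real_le_rsqrt) simp
        then show ?thesis using t F by (intro exI[of _ k]) (simp add: field_simps)
      qed
      then obtain \<kappa> where \<kappa>: "F / sqrt (2 ^ \<kappa>) \<le> t / 2" and min: "\<And>k. k < \<kappa> \<Longrightarrow> t / 2 < F / sqrt (2 ^ k)"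
        using exists_least_iff[of "\<lambda>k. F / sqrt (2 ^ k) \<le> t / 2"] by (auto simp: not_le)
      define I where "I = {..<2 ^ \<kappa> - 1 :: nat}"
      define H where "H = A - I"
      have H: "finite H" using A by (simp add: H_def)
      have HN: "H \<subseteq> {..<2 ^ Suc N - 1}"
      proof
        fix n assume "n \<in> H"
        then have "n \<le> N" using N by (auto simp: H_def)
        then show "n \<in> {..<2 ^ Suc N - 1}" unfolding lessThan_iff by (rule less_block_end)
      qed
      obtain d where d: "\<And>n. n < 2 ^ Suc N - 1 \<Longrightarrow> norm (c n - d n) \<le> F / sqrt (2 ^ block n)"
        "sqrt (\<Sum>n<2 ^ Suc N - 1. (norm (d n))\<^sup>2) \<le> S * F"
        using S(2) f unfolding c_def F_def by blast
      have w: "F / sqrt (2 ^ block n) \<le> t / 2" if "n \<in> H" for n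
      proof -
        have "\<not> n < 2 ^ \<kappa> - 1" using that by (auto simp: H_def I_def)
        then have "\<kappa> \<le> block n" unfolding block_less_iff[symmetric] by simp
        then have "sqrt (2 ^ \<kappa>) \<le> sqrt (2 ^ block n)"
          by (intro real_sqrt_le_mono power_increasing) auto
        then have "F / sqrt (2 ^ block n) \<le> F / sqrt (2 ^ \<kappa>)"
          using F by (intro divide_left_mono) auto
        then show ?thesis using \<kappa> by linarith
      qed
      have dn: "t / 2 \<le> norm (d n)" "norm (c n) \<le> 2 * norm (d n)" if n: "n \<in> H" for n
      proof -
        have "n < 2 ^ Suc N - 1" using subsetD[OF HN n] unfolding lessThan_iff .
        then have 1: "norm (c n - d n) \<le> t / 2" using d(1)[of n] w[OF n] by linarith
        have 2: "t \<le> norm (c n)" using ge n by (auto simp: H_def c_def)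
        have 3: "norm (c n) \<le> norm (c n - d n) + norm (d n)" by (metis norm_triangle_ineq diff_add_cancel)
        show "t / 2 \<le> norm (d n)" "norm (c n) \<le> 2 * norm (d n)" using 1 2 3 by linarith+
      qed
      have sumd: "(\<Sum>n\<in>H. (norm (d n))\<^sup>2) \<le> (S * F)\<^sup>2"
      proof -
        have "(\<Sum>n\<in>H. (norm (d n))\<^sup>2) \<le> (\<Sum>n<2 ^ Suc N - 1. (norm (d n))\<^sup>2)"
          using HN by (intro sum_mono2) auto
        also have "\<dots> = (sqrt (\<Sum>n<2 ^ Suc N - 1. (norm (d n))\<^sup>2))\<^sup>2"
          by (simp add: sum_nonneg)
        also have "\<dots> \<le> (S * F)\<^sup>2"
          using d(2) by (intro power_mono) (auto simp: sum_nonneg)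
        finally show ?thesis .
      qed
      \<comment> \<open>Multiplied by \<open>F\<close>, each weight is at most \<open>\<bar>d\<^sub>n\<bar>\<close>, which turns the linear sum into a sum of
         squares.\<close>
      have h1: "(\<Sum>n\<in>H. norm (c n) / sqrt (2 ^ block n)) \<le> 2 * S\<^sup>2 * F"
      proof -
        have "F * (\<Sum>n\<in>H. norm (c n) / sqrt (2 ^ block n)) = (\<Sum>n\<in>H. norm (c n) * (F / sqrt (2 ^ block n)))"
          by (simp add: sum_distrib_left mult.commute)
        also have "\<dots> \<le> (\<Sum>n\<in>H. (2 * norm (d n)) * norm (d n))"
        proof (intro sum_mono mult_mono dn)
          fix n assume n: "n \<in> H"
          show "F / sqrt (2 ^ block n) \<le> norm (d n)" using w[OF n] dn(1)[OF n] by linarith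
        qed (use F in auto)
        also have "\<dots> = 2 * (\<Sum>n\<in>H. (norm (d n))\<^sup>2)"
          by (simp add: sum_distrib_left power2_eq_square mult.assoc)
        also have "\<dots> \<le> F * (2 * S\<^sup>2 * F)"
          using sumd by (simp add: power_mult_distrib power2_eq_square mult_ac)
        finally show ?thesis using F by simp
      qed
      have h2: "sqrt (\<Sum>n\<in>H. (norm (c n))\<^sup>2) \<le> 2 * S * F"
      proof -
        have "(\<Sum>n\<in>H. (norm (c n))\<^sup>2) \<le> (\<Sum>n\<in>H. (2 * norm (d n))\<^sup>2)"
          by (intro sum_mono power_mono dn) auto
        also have "\<dots> \<le> (2 * (S * F))\<^sup>2"
          using sumd by (simp add: power_mult_distrib sum_distrib_left[symmetric])
        finally have "(\<Sum>n\<in>H. (norm (c n))\<^sup>2) \<le> (2 * S * F)\<^sup>2" by (simp only: mult.assoc)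
        then show ?thesis using S(1) F0 by (intro real_le_lsqrt) (auto simp: sum_nonneg)
      qed
      have high: "Lp_norm p (\<lambda>x. \<Sum>n\<in>H. c n * mixed_walsh n x) \<le> 2 * S\<^sup>2 * F + C * (2 * S * F)"
        using C(2)[rule_format, OF H, of c] h1 mult_left_mono[OF h2 C(1)] by linarith
      have low: "Lp_norm p (\<lambda>x. \<Sum>n\<in>I-A. c n * mixed_walsh n x) \<le> D * (2 * sqrt 2 * F)"
      proof -
        have "Lp_norm p (\<lambda>x. \<Sum>n\<in>I-A. c n * mixed_walsh n x) \<le> D * (t * sqrt (card (I - A)))"
          using le by (intro D(2)[rule_format]) (auto simp: I_def c_def)
        also have "t * sqrt (card (I - A)) \<le> 2 * sqrt 2 * F"
        proof (cases \<kappa>)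
          case 0
          then show ?thesis using F0 by (simp add: I_def)
        next
          case (Suc k)
          have "card (I - A) \<le> card I" by (intro card_mono) (auto simp: I_def)
          also have "\<dots> \<le> 2 ^ \<kappa>" by (simp add: I_def)
          finally have "real (card (I - A)) \<le> 2 ^ \<kappa>" by (metis of_nat_le_iff of_nat_numeral of_nat_power)
          then have "sqrt (card (I - A)) \<le> sqrt (2 ^ \<kappa>)" by (rule real_sqrt_le_mono)
          then have "t * sqrt (card (I - A)) \<le> t * sqrt (2 ^ \<kappa>)" using t by (intro mult_left_mono) auto
          also have "\<dots> = sqrt 2 * (t * sqrt (2 ^ k))" by (simp add: Suc real_sqrt_mult)
          also have "\<dots> \<le> sqrt 2 * (2 * F)"
            using min[of k] Suc by (intro mult_left_mono) (auto simp: field_simps)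
          finally show ?thesis by simp
        qed
        finally show ?thesis using D(1) by (simp add: mult_left_mono)
      qed
      have eq: "(\<Sum>n\<in>A. c n * mixed_walsh n x)
          = ((\<Sum>n\<in>I. c n * mixed_walsh n x) - (\<Sum>n\<in>I-A. c n * mixed_walsh n x)) + (\<Sum>n\<in>H. c n * mixed_walsh n x)" for x
        using A sum.Int_Diff[of A "\<lambda>n. c n * mixed_walsh n x" I] sum.Int_Diff[of I "\<lambda>n. c n * mixed_walsh n x" A]
        by (simp add: H_def Int_commute I_def)
      have "Lp_norm p (\<lambda>x. \<Sum>n\<in>A. c n * mixed_walsh n x)
          \<le> Lp_norm p (\<lambda>x. (\<Sum>n\<in>I. c n * mixed_walsh n x) - (\<Sum>n\<in>I-A. c n * mixed_walsh n x))
            + Lp_norm p (\<lambda>x. \<Sum>n\<in>H. c n * mixed_walsh n x)"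
        unfolding eq using p by (intro Lp_norm_triangle Lp_space_diff mw.sum_in_Lp) auto
      also have "\<dots> \<le> (Lp_norm p (\<lambda>x. \<Sum>n\<in>I. c n * mixed_walsh n x) + Lp_norm p (\<lambda>x. \<Sum>n\<in>I-A. c n * mixed_walsh n x))
            + Lp_norm p (\<lambda>x. \<Sum>n\<in>H. c n * mixed_walsh n x)"
        using p by (intro add_right_mono Lp_norm_triangle_diff mw.sum_in_Lp) auto
      also have "\<dots> \<le> (P * F + D * (2 * sqrt 2 * F)) + (2 * S\<^sup>2 * F + C * (2 * S * F))"
        using P(2)[OF f, of "2 ^ \<kappa> - 1"] low high by (intro add_mono) (auto simp: I_def c_def F_def)
      also have "\<dots> = Q * F" by (simp add: Q_def algebra_simps)
      finally show ?thesis by (simp add: c_def F_def)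
    qed
  qed
  then show ?thesis
    unfolding mw.bounded_threshold_sums_def using Q(2) by blast
qed

theorem theorem1p4:
  fixes p :: real
  assumes "1 < p"
  shows "\<exists>e :: nat \<Rightarrow> real \<Rightarrow> complex.
           uniformly_bounded e \<and> orthonormal_basis_L2 e \<and> almost_greedy_basis_Lp p e"
proof (intro exI conjI)
  obtain q where q: "1 < q" "1 / p + 1 / q = 1" using conjugate_exponent[OF assms] .
  show "uniformly_bounded mixed_walsh" by (rule mw.uniformly_bounded)
  show "orthonormal_basis_L2 mixed_walsh" by (intro mw.orthonormal_basis mixed_walsh_dense) simp
  show "almost_greedy_basis_Lp p mixed_walsh"
    using assms q
    by (intro mw.almost_greedy_criterion[of p q] mixed_walsh_dense mixed_walsh_bounded_partial_sums
        mixed_walsh_square_root_upper_bound mixed_walsh_bounded_threshold_sums) auto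
qed

end
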